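(* Let $F$ be a non-Archimedean local field, $X=\mathbb{P}\mathfrak{gl}_2(F)$ and $G=PGL_2(F)$. Let $G\times G$ act on $X\times X$ diagonally, i.e. $(g,h).(x,y)=(gxh^{-1},gyh^{-1})$. Then $$\mathcal{S}^*(X\times X)^{G\times G}\subseteq \mathcal{S}^*(X\times X)^{\operatorname{swap}},$$ i.e. every $G\times G$-invariant distribution on $X\times X$ is invariant under the map $\operatorname{swap}:(x,y)\mapsto(y,x)$.
   Context: $\mathbb{P}\mathfrak{gl}_2(F)$ is the projective space of nonzero $2\times 2$ matrices over $F$ modulo nonzero scalars, with the topology coming from $F$. For a Hausdorff, locally compact, totally disconnected space $Y$, $\mathcal{S}(Y)$ denotes the space of locally constant compactly supported functions $Y\to\mathbb{C}$, and $\mathcal{S}^*(Y)$ (the space of distributions) is its full linear dual; a group acting on $Y$ acts on $\mathcal{S}^*(Y)$. *)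

theory Defs
  imports "HOL-Analysis.Analysis" "HOL-Algebra.Coset"
begin

section \<open>Non-Archimedean local fields\<close>

text \<open>
  A field, of any characteristic, complete with respect to a nontrivial discrete
  non-Archimedean absolute value with finite residue field; \<open>absval\<close> need not be
  normalised. Its nonnegativity and definiteness, completeness and the topology of
  the field come from \<open>complete_space\<close> via \<open>dist_absval\<close>. The element \<open>p\<close> in
  \<open>absval_uniformizer\<close> is a uniformizer, and \<open>R\<close> in \<open>absval_finite_residue\<close>
  meets every residue class.
\<close>

class nonarch_local_field = field + complete_space +
  fixes absval :: "'a \<Rightarrow> real"
  assumes dist_absval: "dist x y = absval (x - y)"
    and absval_mult: "absval (x * y) = absval x * absval y"
    and absval_ultrametric: "absval (x + y) \<le> max (absval x) (absval y)"
    and absval_uniformizer: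
      "\<exists>p. 0 < absval p \<and> absval p < 1 \<and> (\<forall>x. absval x < 1 \<longrightarrow> absval x \<le> absval p)"
    and absval_finite_residue:
      "\<exists>R. finite R \<and> (\<forall>x. absval x \<le> 1 \<longrightarrow> (\<exists>r\<in>R. absval (x - r) < 1))"


section \<open>The group \<open>PGL\<^sub>2\<close> and the projective space of \<open>2 \<times> 2\<close> matrices\<close>

definition mat_monoid :: "('a::field ^ 2 ^ 2) monoid" where
  "mat_monoid = \<lparr>carrier = UNIV, monoid.mult = (**), one = mat 1\<rparr>"

definition GL2 :: "('a::field ^ 2 ^ 2) monoid" where
  "GL2 = units_of mat_monoid"

definition scalars :: "('a::field ^ 2 ^ 2) set" where
  "scalars = {mat c | c. c \<noteq> 0}"

definition PGL2 :: "('a::field ^ 2 ^ 2) set monoid" where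
  "PGL2 = GL2 Mod scalars"

definition proj_class :: "'a::field ^ 2 ^ 2 \<Rightarrow> ('a ^ 2 ^ 2) set" where
  "proj_class A = scalars #>\<^bsub>mat_monoid\<^esub> A"

definition Pgl2 :: "('a::field ^ 2 ^ 2) set set" where
  "Pgl2 = proj_class ` (- {0})"

text \<open>The quotient topology from the nonzero matrices (see \<open>quotient_map_proj_class\<close>).\<close>

definition Pgl2_topology :: "('a::{field, topological_space} ^ 2 ^ 2) set topology" where
  "Pgl2_topology =
     topology (\<lambda>U. U \<subseteq> Pgl2 \<and> openin (top_of_set (- {0})) {A \<in> - {0}. proj_class A \<in> U})"

text \<open>
  The action of \<open>PGL2 \<times>\<times> PGL2\<close> on \<open>Pgl2\<close>. As points of \<open>Pgl2\<close> and elements of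
  \<open>PGL2\<close> are both sets of matrices, it is given by elementwise products of sets
  (see \<open>pgl_act_proj_class\<close>).
\<close>

definition pgl_act ::
  "('a::field ^ 2 ^ 2) set \<times> ('a ^ 2 ^ 2) set \<Rightarrow> ('a ^ 2 ^ 2) set \<Rightarrow> ('a ^ 2 ^ 2) set" where
  "pgl_act = (\<lambda>(g, h) x. g <#>\<^bsub>mat_monoid\<^esub> x <#>\<^bsub>mat_monoid\<^esub> inv\<^bsub>PGL2\<^esub> h)"

definition diag_act ::
  "('a::field ^ 2 ^ 2) set \<times> ('a ^ 2 ^ 2) set \<Rightarrow>
   ('a ^ 2 ^ 2) set \<times> ('a ^ 2 ^ 2) set \<Rightarrow> ('a ^ 2 ^ 2) set \<times> ('a ^ 2 ^ 2) set" where
  "diag_act gh = map_prod (pgl_act gh) (pgl_act gh)"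


section \<open>Distributions\<close>

text \<open>Functions on \<open>topspace T\<close> are represented by their extensions by \<open>0\<close>.\<close>

definition schwartz_space :: "'b topology \<Rightarrow> ('b \<Rightarrow> complex) set" where
  "schwartz_space T = {f.
     (\<forall>y. y \<notin> topspace T \<longrightarrow> f y = 0) \<and>
     (\<forall>y\<in>topspace T. \<exists>U. openin T U \<and> y \<in> U \<and> (\<forall>z\<in>U. f z = f y)) \<and>
     compactin T (T closure_of {y \<in> topspace T. f y \<noteq> 0})}"

text \<open>The full linear dual; \<open>extensional\<close> fixes the irrelevant values off \<open>schwartz_space T\<close>.\<close>

definition distributions :: "'b topology \<Rightarrow> (('b \<Rightarrow> complex) \<Rightarrow> complex) set" where
  "distributions T = {\<xi> \<in> extensional (schwartz_space T).
     (\<forall>f\<in>schwartz_space T. \<forall>g\<in>schwartz_space T. \<xi> (\<lambda>y. f y + g y) = \<xi> f + \<xi> g) \<and>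
     (\<forall>c. \<forall>f\<in>schwartz_space T. \<xi> (\<lambda>y. c * f y) = c * \<xi> f)}"

definition pullback_fun :: "'b topology \<Rightarrow> ('b \<Rightarrow> 'b) \<Rightarrow> ('b \<Rightarrow> complex) \<Rightarrow> 'b \<Rightarrow> complex" where
  "pullback_fun T \<phi> f = (\<lambda>y. if y \<in> topspace T then f (\<phi> y) else 0)"

text \<open>
  For a group action, the action of \<open>g\<close> on distributions is the pushforward along
  \<open>y \<mapsto> g.y\<close>, since \<open>(g.\<xi>)(f) = \<xi> (g\<^sup>-\<^sup>1.f)\<close> and \<open>(g\<^sup>-\<^sup>1.f)(y) = f (g.y)\<close>.
\<close>

definition push_distribution ::
  "'b topology \<Rightarrow> ('b \<Rightarrow> 'b) \<Rightarrow> (('b \<Rightarrow> complex) \<Rightarrow> complex) \<Rightarrow> ('b \<Rightarrow> complex) \<Rightarrow> complex" where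
  "push_distribution T \<phi> \<xi> = restrict (\<lambda>f. \<xi> (pullback_fun T \<phi> f)) (schwartz_space T)"

definition invariant_distributions ::
  "'b topology \<Rightarrow> ('b \<Rightarrow> 'b) set \<Rightarrow> (('b \<Rightarrow> complex) \<Rightarrow> complex) set" where
  "invariant_distributions T \<Phi> =
     {\<xi> \<in> distributions T. \<forall>\<phi>\<in>\<Phi>. push_distribution T \<phi> \<xi> = \<xi>}"


section \<open>Basic facts\<close>

lemma mat_monoid_simps [simp]:
  "carrier mat_monoid = UNIV" "x \<otimes>\<^bsub>mat_monoid\<^esub> y = x ** y" "\<one>\<^bsub>mat_monoid\<^esub> = mat 1"
  by (simp_all add: mat_monoid_def)

lemma monoid_mat_monoid: "monoid mat_monoid"
  by unfold_locales (simp_all add: matrix_mul_assoc)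

lemma Units_mat_monoid: "Units mat_monoid = {A. invertible A}"
  unfolding Units_def invertible_def by auto

lemma GL2_simps [simp]:
  "carrier GL2 = {A. invertible A}" "x \<otimes>\<^bsub>GL2\<^esub> y = x ** y" "\<one>\<^bsub>GL2\<^esub> = mat 1"
  by (simp_all add: GL2_def units_of_def Units_mat_monoid)

lemma group_GL2: "group GL2"
  unfolding GL2_def by (rule monoid.units_group[OF monoid_mat_monoid])

lemma mat_times: "mat a ** A = (\<chi> i j. a * (A :: 'a::field ^ 2 ^ 2) $ i $ j)"
  by (simp add: vec_eq_iff matrix_matrix_mult_def mat_def sum_2 forall_2)

lemma times_mat: "(A :: 'a::field ^ 2 ^ 2) ** mat a = mat a ** A"
  by (simp add: vec_eq_iff matrix_matrix_mult_def mat_def sum_2 forall_2 mult.commute)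

lemma mat_mult_mat: "mat a ** mat b = (mat (a * b) :: 'a::field ^ 2 ^ 2)"
  by (simp add: vec_eq_iff matrix_matrix_mult_def mat_def sum_2 forall_2)

lemma matrix_inv_mult:
  assumes "invertible (A :: 'a::field ^ 2 ^ 2)"
  shows "matrix_inv A ** A = mat 1" "A ** matrix_inv A = mat 1"
  using someI_ex[OF assms[unfolded invertible_def]] by (simp_all add: matrix_inv_def)

lemma proj_class_eq: "proj_class A = {mat c ** A | c. c \<noteq> 0}"
  by (auto simp: proj_class_def r_coset_def scalars_def)

lemma subgroup_scalars: "subgroup scalars GL2"
proof (rule group.subgroupI[OF group_GL2])
  show sub: "scalars \<subseteq> carrier GL2"
    unfolding scalars_def GL2_simps invertible_def
    by clarify (metis (no_types, opaque_lifting) mat_mult_mat right_inverse left_inverse)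
  show "scalars \<noteq> {}" by (auto simp: scalars_def intro: exI[of _ 1])
  show "a \<otimes>\<^bsub>GL2\<^esub> b \<in> scalars" if "a \<in> scalars" "b \<in> scalars" for a b
    using that by (force simp: scalars_def mat_mult_mat)
  show "inv\<^bsub>GL2\<^esub> a \<in> scalars" if a: "a \<in> scalars" for a
  proof -
    from a obtain c where c: "a = mat c" "c \<noteq> 0" by (auto simp: scalars_def)
    have "mat (inverse c) \<in> scalars" using c(2) by (auto simp: scalars_def)
    moreover from this have "inv\<^bsub>GL2\<^esub> a = mat (inverse c)"
      using a sub c by (intro group.inv_equality[OF group_GL2]) (auto simp: mat_mult_mat)
    ultimately show ?thesis by simp
  qed
qed

lemma normal_scalars: "scalars \<lhd> GL2"
proof (rule group.normalI[OF group_GL2 subgroup_scalars], rule ballI)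
  show "scalars #>\<^bsub>GL2\<^esub> x = x <#\<^bsub>GL2\<^esub> scalars" for x
    by (auto simp: r_coset_def l_coset_def scalars_def times_mat)
qed

lemma group_PGL2: "group PGL2"
  unfolding PGL2_def by (rule normal.factorgroup_is_group[OF normal_scalars])

lemma carrier_PGL2: "carrier PGL2 = proj_class ` {A. invertible A}"
  by (auto simp: PGL2_def FactGroup_def RCOSETS_def proj_class_def r_coset_def)

lemma set_mult_proj_class:
  "proj_class A <#>\<^bsub>mat_monoid\<^esub> proj_class B = proj_class (A ** B)" (is "?L = ?R")
proof
  have eq: "(mat c ** A) ** (mat d ** B) = mat (c * d) ** (A ** B)" for c d
    by (metis matrix_mul_assoc times_mat mat_mult_mat)
  show "?L \<subseteq> ?R"
    by (force simp: set_mult_def proj_class_eq eq)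
  show "?R \<subseteq> ?L"
  proof
    fix z assume "z \<in> ?R"
    then obtain c where "c \<noteq> 0" "z = mat c ** (A ** B)" by (auto simp: proj_class_eq)
    then have "z = (mat c ** A) ** B" by (simp add: matrix_mul_assoc)
    moreover have "mat c ** A \<in> proj_class A" "B \<in> proj_class B"
      using \<open>c \<noteq> 0\<close> by (auto simp: proj_class_eq intro: exI[of _ 1])
    ultimately show "z \<in> ?L" by (auto simp: set_mult_def)
  qed
qed

lemma inv_PGL2:
  assumes "invertible A"
  shows "inv\<^bsub>PGL2\<^esub> (proj_class A) = proj_class (matrix_inv A)"
proof -
  have A': "invertible (matrix_inv A)"
    using matrix_inv_mult[OF assms] by (auto simp: invertible_def)
  have "proj_class (matrix_inv A) \<otimes>\<^bsub>PGL2\<^esub> proj_class A = proj_class (matrix_inv A ** A)"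
    by (simp add: set_mult_proj_class[symmetric] PGL2_def FactGroup_def set_mult_def)
  also have "\<dots> = \<one>\<^bsub>PGL2\<^esub>"
    using assms
    by (auto simp: matrix_inv_mult proj_class_eq PGL2_def FactGroup_def scalars_def)
  finally show ?thesis
    by (rule group.inv_equality[OF group_PGL2]) (use assms A' in \<open>auto simp: carrier_PGL2\<close>)
qed

lemma pgl_act_proj_class:
  assumes "invertible h"
  shows "pgl_act (proj_class g, proj_class h) (proj_class x) = proj_class (g ** x ** matrix_inv h)"
  by (simp add: pgl_act_def inv_PGL2[OF assms] set_mult_proj_class)

lemma openin_Pgl2_topology:
  "openin Pgl2_topology U \<longleftrightarrow>
     U \<subseteq> Pgl2 \<and> openin (top_of_set (- {0})) {A \<in> - {0}. proj_class A \<in> U}"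
proof -
  have "istopology (\<lambda>U. U \<subseteq> Pgl2 \<and>
          openin (top_of_set (- {0 :: 'a ^ 2 ^ 2})) {A \<in> - {0}. proj_class A \<in> U})"
    unfolding istopology_def
  proof (intro conjI allI impI)
    fix S T :: "('a ^ 2 ^ 2) set set"
    assume S: "S \<subseteq> Pgl2 \<and> openin (top_of_set (- {0})) {A \<in> - {0}. proj_class A \<in> S}"
      and T: "T \<subseteq> Pgl2 \<and> openin (top_of_set (- {0})) {A \<in> - {0}. proj_class A \<in> T}"
    have "{A \<in> - {0}. proj_class A \<in> S \<inter> T} =
        {A \<in> - {0}. proj_class A \<in> S} \<inter> {A \<in> - {0}. proj_class A \<in> T}" by blast
    with S T show "openin (top_of_set (- {0})) {A \<in> - {0}. proj_class A \<in> S \<inter> T}"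
      by (simp add: openin_Int)
    from S show "S \<inter> T \<subseteq> Pgl2" by blast
  next
    fix K :: "('a ^ 2 ^ 2) set set set"
    assume K: "\<forall>S\<in>K. S \<subseteq> Pgl2 \<and> openin (top_of_set (- {0})) {A \<in> - {0}. proj_class A \<in> S}"
    then show "\<Union>K \<subseteq> Pgl2" by blast
    have "{A \<in> - {0}. proj_class A \<in> \<Union>K} = (\<Union>S\<in>K. {A \<in> - {0}. proj_class A \<in> S})" by blast
    with K show "openin (top_of_set (- {0})) {A \<in> - {0}. proj_class A \<in> \<Union>K}"
      by auto
  qed
  then show ?thesis by (simp add: Pgl2_topology_def topology_inverse')
qed

lemma topspace_Pgl2_topology [simp]: "topspace Pgl2_topology = Pgl2"
proof -
  have "{A \<in> - {0 :: 'a ^ 2 ^ 2}. proj_class A \<in> Pgl2} = - {0}" by (auto simp: Pgl2_def)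
  then have "openin (Pgl2_topology :: ('a ^ 2 ^ 2) set topology) Pgl2"
    by (simp add: openin_Pgl2_topology)
  then show ?thesis
    by (meson openin_Pgl2_topology openin_subset openin_topspace subset_antisym)
qed

lemma quotient_map_proj_class: "quotient_map (top_of_set (- {0})) Pgl2_topology proj_class"
  by (auto simp: quotient_map_def openin_Pgl2_topology Pgl2_def[symmetric])

end

theory Submission
  imports Defs
begin

text \<open>
  An invariant distribution amounts to a \<open>G \<times> G\<close>-invariant finitely additive measure \<open>m\<close> on the
  clopen subsets of \<open>X \<times> X\<close>, and \<open>N\<close> minus its mirror image avoids the diagonal; so it suffices
  that \<open>m\<close> is symmetric off the diagonal. If \<open>A\<close> and \<open>B\<close> are not proportional, then there is a
  vector \<open>v\<close> such that \<open>A v\<close> and \<open>B v\<close> are independent, possibly after transposing both matrices.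
  Such a pair can be translated arbitrarily close to \<open>(E\<^sub>1\<^sub>1, E\<^sub>2\<^sub>1)\<close>, by taking \<open>A v\<close>, \<open>B v\<close> as
  basis and contracting the second column.

  Near \<open>(E\<^sub>1\<^sub>1, E\<^sub>2\<^sub>1)\<close> the action has a slice on which the diagonal torus acts on two
  coordinates by \<open>(c, c') \<mapsto> (t c, t\<^sup>-\<^sup>1 c')\<close>, and the swap acts by exchanging \<open>c\<close> and \<open>c'\<close>. Counting
  translates under unipotent matrices shows that \<open>m\<close> induces a torus-invariant measure on the slice,
  and such a measure is symmetric: \<open>t = c'/c\<close> moves a small disc around \<open>(c, c')\<close> to its mirror
  image if \<open>c, c' \<noteq> 0\<close>, products of balls around \<open>0\<close> are permuted by the torus, and the remaining
  case follows by averaging over a sphere.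
\<close>

subsection \<open>The absolute value\<close>

text \<open>The torus does not act on the slice alone: \<open>mat2 1 0 0 t\<close> also scales the
  two unipotent coordinates \<open>y\<close> and \<open>y'\<close>, by \<open>t\<close> and its
  inverse. Restoring the two radii costs the same index, that of \<open>t O\<close> in the valuation
  ring \<open>O\<close>, and so the two factors cancel. Unipotent translates respect the slice
  coordinates only up to factors \<open>1 + c * y'\<close>. If all radii are |s|, these factors are
  within |s|^2 of 1, so the sets used on the slice have to be stable at scale |s|^2. Hence there are
  two scales: a box of radius |s| has no proper nonempty subset of scale |s|, so it suffices to
  treat whole boxes, while the proof of symmetry cuts the slice more finely, down to |s|^2. A disc
  around \<open>c\<close> of relative radius |s| is still admissible if |c| > |s|; the points with
  |c| <= |s| form one ball around 0, which is the source of the case distinctions. Besides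
  \<open>c\<close> and \<open>c'\<close> the slice has two coordinates fixed by the torus but
  exchanged by the swap. They are exchanged back by a sign change and a column operation; nothing is
  divided by 2, so characteristic 2 is included.\<close>

lemma absval_0 [simp]: "absval (0 :: 'a::nonarch_local_field) = 0"
  by (metis diff_self dist_absval dist_self)

lemma absval_ge_0 [simp]: "0 \<le> absval (x :: 'a::nonarch_local_field)"
  by (metis diff_zero dist_absval zero_le_dist)

lemma absval_eq_0_iff [simp]: "absval (x :: 'a::nonarch_local_field) = 0 \<longleftrightarrow> x = 0"
  by (metis diff_zero dist_absval dist_eq_0_iff)

lemma absval_gt_0_iff [simp]: "0 < absval (x :: 'a::nonarch_local_field) \<longleftrightarrow> x \<noteq> 0"
  using absval_ge_0[of x] absval_eq_0_iff[of x] by linarith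

lemma absval_not_less_0 [simp]: "\<not> absval (x :: 'a::nonarch_local_field) < 0"
  using absval_ge_0[of x] by linarith

lemma absval_le_0_iff [simp]: "absval (x :: 'a::nonarch_local_field) \<le> 0 \<longleftrightarrow> x = 0"
  using absval_gt_0_iff[of x] by (simp only: not_less[symmetric]) blast

lemma absval_1 [simp]: "absval (1 :: 'a::nonarch_local_field) = 1"
  using absval_mult[of "1::'a" 1] absval_eq_0_iff[of "1::'a"] by (simp del: absval_eq_0_iff)

lemma absval_minus [simp]: "absval (- x) = absval (x :: 'a::nonarch_local_field)"
  by (metis diff_0 diff_zero dist_absval dist_commute)

lemma absval_minus_commute: "absval (x - y) = absval (y - x :: 'a::nonarch_local_field)"
  by (metis absval_minus minus_diff_eq)

lemma absval_inverse: "absval (inverse x) = inverse (absval (x :: 'a::nonarch_local_field))"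
proof (cases "x = 0")
  case False
  then have "absval x * absval (inverse x) = 1"
    by (simp flip: absval_mult)
  then show ?thesis by (metis inverse_unique)
qed simp

lemma absval_divide: "absval (x / y) = absval x / absval (y :: 'a::nonarch_local_field)"
  by (simp add: divide_inverse absval_mult absval_inverse)

lemma absval_power: "absval (x ^ n) = absval (x :: 'a::nonarch_local_field) ^ n"
  by (induction n) (simp_all add: absval_mult)

lemma absval_add_le:
  "absval x \<le> r \<Longrightarrow> absval y \<le> r \<Longrightarrow> absval (x + y :: 'a::nonarch_local_field) \<le> r"
  using absval_ultrametric[of x y] by linarith

lemma absval_diff_le:
  "absval x \<le> r \<Longrightarrow> absval y \<le> r \<Longrightarrow> absval (x - y :: 'a::nonarch_local_field) \<le> r"
  using absval_add_le[of x r "- y"] by simp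

lemma absval_add_less:
  "absval x < r \<Longrightarrow> absval y < r \<Longrightarrow> absval (x + y :: 'a::nonarch_local_field) < r"
  using absval_ultrametric[of x y] by linarith

lemma absval_diff_less:
  "absval x < r \<Longrightarrow> absval y < r \<Longrightarrow> absval (x - y :: 'a::nonarch_local_field) < r"
  using absval_add_less[of x r "- y"] by simp

lemma absval_diff_trans:
  "absval (x - y) \<le> r \<Longrightarrow> absval (y - z) \<le> r \<Longrightarrow> absval (x - z :: 'a::nonarch_local_field) \<le> r"
  using absval_add_le[of "x - y" r "y - z"] by simp

lemma absval_mult_le:
  "absval x \<le> r \<Longrightarrow> absval y \<le> s \<Longrightarrow> absval (x * y :: 'a::nonarch_local_field) \<le> r * s"
  unfolding absval_mult by (meson absval_ge_0 mult_mono order_trans)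

lemma absval_mult_le_left:
  "absval x \<le> r \<Longrightarrow> absval y \<le> 1 \<Longrightarrow> absval (x * y :: 'a::nonarch_local_field) \<le> r"
  using absval_mult_le[of x r y 1] by simp

lemma absval_mult_le_right:
  "absval x \<le> 1 \<Longrightarrow> absval y \<le> r \<Longrightarrow> absval (x * y :: 'a::nonarch_local_field) \<le> r"
  using absval_mult_le[of x 1 y r] by simp

lemma absval_mult_less_left:
  "absval x < r \<Longrightarrow> absval y \<le> 1 \<Longrightarrow> absval (x * y :: 'a::nonarch_local_field) < r"
  unfolding absval_mult by (meson absval_ge_0 le_less_trans mult_left_le)

lemma absval_mult_less_right:
  "absval x \<le> 1 \<Longrightarrow> absval y < r \<Longrightarrow> absval (x * y :: 'a::nonarch_local_field) < r"
  using absval_mult_less_left[of y r x] by (simp add: mult.commute)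

lemma absval_add_eq:
  "absval y < absval x \<Longrightarrow> absval (x + y) = absval (x :: 'a::nonarch_local_field)"
  using absval_ultrametric[of x y] absval_ultrametric[of "x + y" "- y"] by auto

lemma absval_eq_of_diff:
  "absval (x - y) < absval y \<Longrightarrow> absval x = absval (y :: 'a::nonarch_local_field)"
  using absval_add_eq[of "x - y" y] by simp

lemma absval_unit: "absval (u - 1) < 1 \<Longrightarrow> absval (u :: 'a::nonarch_local_field) = 1"
  using absval_eq_of_diff[of u 1] by simp

lemma ex_absval_less:
  assumes "0 < e" shows "\<exists>x :: 'a::nonarch_local_field. x \<noteq> 0 \<and> absval x < e"
proof -
  obtain p :: 'a where p: "0 < absval p" "absval p < 1" using absval_uniformizer by blast
  obtain n where "absval p ^ n < e" using real_arch_pow_inv[OF assms p(2)] by blast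
  then show ?thesis using p by (intro exI[of _ "p ^ n"]) (auto simp: absval_power)
qed

text \<open>Digit expansion: a net of precision \<open>absval p ^ n\<close> is refined by adding
  \<open>p ^ n\<close> times a residue digit. Discreteness of the absolute value turns the error
  \<open>< 1\<close> of a digit into \<open>\<le> absval p\<close>.\<close>

lemma finite_net:
  assumes "0 < e"
  shows "\<exists>R. finite R \<and> (\<forall>x :: 'a::nonarch_local_field. absval x \<le> 1 \<longrightarrow> (\<exists>r\<in>R. absval (x - r) \<le> e))"
proof -
  obtain p :: 'a where p: "0 < absval p" "absval p < 1"
    and pm: "\<And>x :: 'a. absval x < 1 \<Longrightarrow> absval x \<le> absval p"
    using absval_uniformizer by blast
  obtain R0 :: "'a set" where R0: "finite R0"
    "\<And>x. absval x \<le> 1 \<Longrightarrow> \<exists>r\<in>R0. absval (x - r) < 1"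
    using absval_finite_residue by blast
  have step: "\<exists>R. finite R \<and> (\<forall>x :: 'a. absval x \<le> 1 \<longrightarrow> (\<exists>r\<in>R. absval (x - r) \<le> absval p ^ n))" for n
  proof (induction n)
    case 0
    show ?case by (rule exI[of _ "{0}"]) simp
  next
    case (Suc n)
    then obtain R where R: "finite R"
      "\<And>x :: 'a. absval x \<le> 1 \<Longrightarrow> \<exists>r\<in>R. absval (x - r) \<le> absval p ^ n" by blast
    let ?S = "(\<lambda>(r, s). s + p ^ n * r) ` (R0 \<times> R)"
    have "\<exists>r\<in>?S. absval (x - r) \<le> absval p ^ Suc n" if x: "absval x \<le> 1" for x :: 'a
    proof -
      obtain s where s: "s \<in> R" "absval (x - s) \<le> absval p ^ n" using R(2)[OF x] by blast
      have pn: "absval p ^ n > 0" using p by simp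
      have "absval ((x - s) / p ^ n) \<le> 1"
        using s(2) pn by (simp add: absval_divide absval_power)
      then obtain r where r: "r \<in> R0" "absval ((x - s) / p ^ n - r) < 1" using R0(2) by blast
      have "absval (p ^ n * ((x - s) / p ^ n - r)) \<le> absval p ^ n * absval p"
        using pm[OF r(2)] pn by (simp add: absval_mult absval_power)
      moreover have "p ^ n * ((x - s) / p ^ n - r) = x - (s + p ^ n * r)"
        using p by (simp add: field_simps)
      ultimately show ?thesis using r s by (intro bexI[of _ "s + p ^ n * r"]) (auto simp: mult.commute)
    qed
    then show ?case using R0(1) R(1) by (intro exI[of _ ?S]) auto
  qed
  obtain n where n: "absval p ^ n < e" using real_arch_pow_inv[OF assms p(2)] by blast
  obtain R where "finite R" "\<forall>x :: 'a. absval x \<le> 1 \<longrightarrow> (\<exists>r\<in>R. absval (x - r) \<le> absval p ^ n)"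
    using step by blast
  then show ?thesis using n by (meson less_imp_le order_trans)
qed

text \<open>For \<open>e = absval t\<close> with \<open>0 < e \<le> 1\<close> this is a transversal
  of \<open>O / t O\<close>, where \<open>O\<close> is the valuation ring; its cardinality is the
  index that relates boxes of different radii.\<close>

definition residue_reps :: "real \<Rightarrow> 'a::nonarch_local_field set \<Rightarrow> bool" where
  "residue_reps e R \<longleftrightarrow> finite R \<and> (\<forall>r\<in>R. absval r \<le> 1) \<and>
     (\<forall>x. absval x \<le> 1 \<longrightarrow> (\<exists>r\<in>R. absval (x - r) \<le> e)) \<and>
     (\<forall>r\<in>R. \<forall>s\<in>R. absval (r - s) \<le> e \<longrightarrow> r = s)"

lemma ex_residue_reps:
  assumes "0 < e" shows "\<exists>R :: 'a::nonarch_local_field set. residue_reps e R"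
proof -
  obtain R0 :: "'a set" where R0: "finite R0"
    "\<And>x. absval x \<le> 1 \<Longrightarrow> \<exists>r\<in>R0. absval (x - r) \<le> e"
    using finite_net[OF assms] by blast
  let ?O = "{x :: 'a. absval x \<le> 1}"
  let ?cl = "\<lambda>x. {y \<in> ?O. absval (x - y) \<le> e}"
  define f where "f x = (SOME y. y \<in> ?cl x)" for x
  have f: "f x \<in> ?cl x" if "x \<in> ?O" for x
    unfolding f_def by (rule someI[of _ x]) (use that assms in auto)
  have feq: "f x = f y" if "absval (x - y) \<le> e" for x y
  proof -
    have "?cl x = ?cl y"
      using that absval_diff_trans[of x y e] absval_diff_trans[of y x e]
      by (auto simp: absval_minus_commute)
    then show ?thesis by (simp add: f_def)
  qed
  \<comment> \<open>The choice depends only on the class and every class contains a point close to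
    \<open>R0\<close>, so it takes finitely many values. Points of \<open>R0\<close> outside the
    unit ball do no harm, as \<open>feq\<close> holds for all elements.\<close>
  have fi: "f ` ?O \<subseteq> f ` R0" using R0(2) feq by blast
  have "residue_reps e (f ` ?O)"
    unfolding residue_reps_def
  proof (intro conjI ballI allI impI)
    show "finite (f ` ?O)" using fi R0(1) by (meson finite_imageI finite_subset)
    show "absval r \<le> 1" if "r \<in> f ` ?O" for r using that f by blast
    show "\<exists>r\<in>f ` ?O. absval (x - r) \<le> e" if "absval x \<le> 1" for x using that f by blast
    fix r s assume "r \<in> f ` ?O" "s \<in> f ` ?O" and rs: "absval (r - s) \<le> e"
    then obtain x y where "r = f x" "s = f y" "x \<in> ?O" "y \<in> ?O" by blast
    moreover have "f (f x) = f x" if "x \<in> ?O" for x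
      using f[OF that] feq[of x "f x"] by auto
    ultimately show "r = s" using feq[OF rs] by metis
  qed
  then show ?thesis by blast
qed

subsection \<open>Matrices up to relative perturbation\<close>

definition mnorm :: "'a::nonarch_local_field ^ 2 ^ 2 \<Rightarrow> real" where
  "mnorm A = max (max (absval (A$1$1)) (absval (A$1$2))) (max (absval (A$2$1)) (absval (A$2$2)))"

lemma mnorm_le_iff:
  "mnorm A \<le> r \<longleftrightarrow>
     absval (A$1$1) \<le> r \<and> absval (A$1$2) \<le> r \<and> absval (A$2$1) \<le> r \<and> absval (A$2$2) \<le> r"
  by (auto simp: mnorm_def)

lemma mnorm_entries [simp]:
  "absval (A$1$1) \<le> mnorm A" "absval (A$1$2) \<le> mnorm A"
  "absval (A$2$1) \<le> mnorm A" "absval (A$2$2) \<le> mnorm A"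
  by (simp_all add: mnorm_def)

lemma mnorm_0 [simp]: "mnorm 0 = 0"
  by (simp add: mnorm_def)

lemma mnorm_ge_0 [simp]: "0 \<le> mnorm A"
  by (simp add: mnorm_def le_max_iff_disj)

lemma mnorm_eq_0_iff [simp]: "mnorm A = 0 \<longleftrightarrow> A = 0"
proof
  assume "mnorm A = 0"
  then have "mnorm A \<le> 0" by simp
  then show "A = 0"
    by (simp add: mnorm_le_iff vec_eq_iff forall_2 order_antisym_conv)
qed simp

lemma mnorm_gt_0_iff [simp]: "0 < mnorm A \<longleftrightarrow> A \<noteq> 0"
  using mnorm_ge_0[of A] mnorm_eq_0_iff[of A] by linarith

lemma mnorm_minus_commute: "mnorm (A - B) = mnorm (B - A)"
  by (simp add: mnorm_def absval_minus_commute)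

lemma mnorm_add_le: "mnorm A \<le> r \<Longrightarrow> mnorm B \<le> r \<Longrightarrow> mnorm (A + B) \<le> r"
  by (simp add: mnorm_le_iff absval_add_le)

lemma mnorm_diff_trans: "mnorm (A - B) \<le> r \<Longrightarrow> mnorm (B - C) \<le> r \<Longrightarrow> mnorm (A - C) \<le> r"
  using mnorm_add_le[of "A - B" r "B - C"] by simp

lemma mnorm_eq_of_diff: "mnorm (A - B) < mnorm B \<Longrightarrow> mnorm A = mnorm B"
  using mnorm_add_le[of "A - B" "mnorm B" B] mnorm_add_le[of "B - A" "max (mnorm (A - B)) (mnorm A)" A]
  by (auto simp: mnorm_minus_commute)

lemma mnorm_mult_le: "mnorm (A ** B) \<le> mnorm A * mnorm B"
  unfolding mnorm_le_iff[of "A ** B"]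
  by (auto simp: matrix_matrix_mult_def sum_2 intro!: absval_add_le absval_mult_le)

lemma mnorm_mat_mult: "mnorm (mat c ** A) = absval c * mnorm A"
  by (simp add: mnorm_def mat_times absval_mult max_mult_distrib_left)

lemma mnorm_transpose [simp]: "mnorm (transpose A) = mnorm A"
  by (simp add: mnorm_def transpose_def ac_simps)

lemma mat_mult_assoc2: "mat c ** (mat d ** A) = mat (c * d) ** (A :: 'a::field ^ 2 ^ 2)"
  by (simp add: matrix_mul_assoc mat_mult_mat)

lemma mat_mult_eq_0_iff: "c \<noteq> 0 \<Longrightarrow> mat c ** A = 0 \<longleftrightarrow> (A :: 'a::field ^ 2 ^ 2) = 0"
  by (auto simp: mat_times vec_eq_iff)

lemma mat_mult_diff: "mat c ** A - mat c ** B = mat c ** (A - B :: 'a::field ^ 2 ^ 2)"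
  by (simp add: mat_times vec_eq_iff algebra_simps)

lemma ex_mnorm_1:
  assumes "A \<noteq> 0" shows "\<exists>c. c \<noteq> 0 \<and> mnorm (mat c ** A) = 1"
proof -
  have "mnorm A \<in> {absval (A$1$1), absval (A$1$2), absval (A$2$1), absval (A$2$2)}"
    by (auto simp: mnorm_def max_def)
  then obtain a :: 'a where a: "mnorm A = absval a" by blast
  with assms show ?thesis
    by (intro exI[of _ "inverse a"]) (metis absval_eq_0_iff absval_inverse left_inverse
        mnorm_eq_0_iff mnorm_mat_mult inverse_nonzero_iff_nonzero)
qed

text \<open>Relative size makes the relation invariant under scaling, so that it describes
  neighbourhoods in projective space. For \<open>0 \<le> e < 1\<close> it is an equivalence
  relation, by the ultrametric inequality.\<close>

definition near :: "real \<Rightarrow> 'a::nonarch_local_field ^ 2 ^ 2 \<Rightarrow> 'a ^ 2 ^ 2 \<Rightarrow> bool" where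
  "near e A B \<longleftrightarrow> mnorm (B - A) \<le> e * mnorm A"

lemma near_refl: "0 \<le> e \<Longrightarrow> near e A A"
  by (simp add: near_def)

lemma near_mono: "near e A B \<Longrightarrow> e \<le> d \<Longrightarrow> near d A B"
  unfolding near_def by (meson mnorm_ge_0 mult_right_mono order_trans)

lemma mnorm_near: "near e A B \<Longrightarrow> e < 1 \<Longrightarrow> mnorm B = mnorm A"
proof (cases "A = 0")
  case False
  assume "near e A B" "e < 1"
  moreover from False \<open>e < 1\<close> have "e * mnorm A < mnorm A" by simp
  ultimately show ?thesis by (intro mnorm_eq_of_diff) (simp add: near_def)
next
  case True
  assume "near e A B"
  with True have "mnorm B \<le> 0" by (simp add: near_def)
  then have "mnorm B = 0" by (rule order_antisym) simp
  with True show "mnorm B = mnorm A" by simp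
qed

lemma near_nonzero: "near e A B \<Longrightarrow> e < 1 \<Longrightarrow> A \<noteq> 0 \<Longrightarrow> B \<noteq> 0"
  using mnorm_near by fastforce

lemma near_sym: "near e A B \<Longrightarrow> e < 1 \<Longrightarrow> near e B A"
  using mnorm_near[of e A B] by (simp add: near_def mnorm_minus_commute)

lemma near_trans: "near e A B \<Longrightarrow> near e B C \<Longrightarrow> e < 1 \<Longrightarrow> near e A C"
  using mnorm_near[of e A B] mnorm_diff_trans[of C B "e * mnorm A" A] by (simp add: near_def)

lemma near_scale: "near e A B \<Longrightarrow> near e (mat c ** A) (mat c ** B)"
  using mult_left_mono[of "mnorm (B - A)" "e * mnorm A" "absval c"]
  by (simp add: near_def mat_mult_diff mnorm_mat_mult mult.left_commute)

lemma near_transpose: "near e A B \<Longrightarrow> near e (transpose A) (transpose B)"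
proof -
  have "transpose B - transpose A = transpose (B - A)" by (simp add: transpose_def vec_eq_iff)
  then show "near e A B \<Longrightarrow> near e (transpose A) (transpose B)" by (simp add: near_def)
qed

subsection \<open>Clopen sets of pairs\<close>

text \<open>
  Subsets of \<open>Pgl2 \<times> Pgl2\<close> are represented by their preimages, which are
  saturated under scaling. By compactness the clopen ones are those stable under
  relative perturbation of some fixed size.
\<close>

type_synonym 'a mpair = "('a ^ 2 ^ 2) \<times> ('a ^ 2 ^ 2)"

definition uniform :: "real \<Rightarrow> 'a::nonarch_local_field mpair set \<Rightarrow> bool" where
  "uniform e W \<longleftrightarrow> (\<forall>A B. (A, B) \<in> W \<longrightarrow> A \<noteq> 0 \<and> B \<noteq> 0 \<and>
     (\<forall>c d. c \<noteq> 0 \<longrightarrow> d \<noteq> 0 \<longrightarrow> (mat c ** A, mat d ** B) \<in> W) \<and>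
     (\<forall>A' B'. near e A A' \<longrightarrow> near e B B' \<longrightarrow> (A', B') \<in> W))"

definition clop :: "'a::nonarch_local_field mpair set \<Rightarrow> bool" where
  "clop W \<longleftrightarrow> (\<exists>e. 0 < e \<and> e < 1 \<and> uniform e W)"

lemma uniformI:
  assumes "\<And>A B. (A, B) \<in> W \<Longrightarrow> A \<noteq> 0 \<and> B \<noteq> 0"
    and "\<And>A B c d. (A, B) \<in> W \<Longrightarrow> c \<noteq> 0 \<Longrightarrow> d \<noteq> 0 \<Longrightarrow> (mat c ** A, mat d ** B) \<in> W"
    and "\<And>A B A' B'. (A, B) \<in> W \<Longrightarrow> near e A A' \<Longrightarrow> near e B B' \<Longrightarrow> (A', B') \<in> W"
  shows "uniform e W"
  using assms unfolding uniform_def by blast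

lemma uniform_nonzero: "uniform e W \<Longrightarrow> (A, B) \<in> W \<Longrightarrow> A \<noteq> 0 \<and> B \<noteq> 0"
  unfolding uniform_def by blast

lemma uniform_scale:
  "uniform e W \<Longrightarrow> (A, B) \<in> W \<Longrightarrow> c \<noteq> 0 \<Longrightarrow> d \<noteq> 0 \<Longrightarrow> (mat c ** A, mat d ** B) \<in> W"
  unfolding uniform_def by blast

lemma uniform_near: "uniform e W \<Longrightarrow> (A, B) \<in> W \<Longrightarrow> near e A A' \<Longrightarrow> near e B B' \<Longrightarrow> (A', B') \<in> W"
  unfolding uniform_def by blast

lemma uniform_unscale:
  assumes "uniform e W" "(mat c ** A, mat d ** B) \<in> W" "c \<noteq> 0" "d \<noteq> 0"
  shows "(A, B) \<in> W"
  using uniform_scale[OF assms(1,2), of "inverse c" "inverse d"] assms(3,4)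
  by (simp add: mat_mult_assoc2)

lemma uniform_mono:
  assumes "uniform e W" "d \<le> e" shows "uniform d W"
proof (rule uniformI)
  show "A \<noteq> 0 \<and> B \<noteq> 0" if "(A, B) \<in> W" for A B
    using assms(1) that by (rule uniform_nonzero)
  show "(mat c ** A, mat d ** B) \<in> W" if "(A, B) \<in> W" "c \<noteq> 0" "d \<noteq> 0" for A B c d
    using assms(1) that by (rule uniform_scale)
  show "(A', B') \<in> W" if "(A, B) \<in> W" "near d A A'" "near d B B'" for A B A' B'
    using assms(1) that(1) that(2,3)[THEN near_mono[OF _ assms(2)]] by (rule uniform_near)
qed

lemma uniform_empty: "uniform e {}"
  by (simp add: uniform_def)

lemma uniform_Un:
  assumes "uniform e U" "uniform e V" shows "uniform e (U \<union> V)"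
proof (rule uniformI)
  fix A B assume AB: "(A, B) \<in> U \<union> V"
  show "A \<noteq> 0 \<and> B \<noteq> 0"
    using AB uniform_nonzero[OF assms(1), of A B] uniform_nonzero[OF assms(2), of A B] by auto
  show "(mat c ** A, mat d ** B) \<in> U \<union> V" if "c \<noteq> 0" "d \<noteq> 0" for c d
    using AB uniform_scale[OF assms(1) _ that] uniform_scale[OF assms(2) _ that] by auto
  show "(A', B') \<in> U \<union> V" if "near e A A'" "near e B B'" for A' B'
    using AB uniform_near[OF assms(1) _ that] uniform_near[OF assms(2) _ that] by auto
qed

lemma uniform_Int:
  assumes "uniform e U" "uniform e V" shows "uniform e (U \<inter> V)"
proof (rule uniformI)
  fix A B assume AB: "(A, B) \<in> U \<inter> V"
  show "A \<noteq> 0 \<and> B \<noteq> 0"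
    using AB uniform_nonzero[OF assms(1), of A B] uniform_nonzero[OF assms(2), of A B] by auto
  show "(mat c ** A, mat d ** B) \<in> U \<inter> V" if "c \<noteq> 0" "d \<noteq> 0" for c d
    using AB uniform_scale[OF assms(1) _ that] uniform_scale[OF assms(2) _ that] by auto
  show "(A', B') \<in> U \<inter> V" if "near e A A'" "near e B B'" for A' B'
    using AB uniform_near[OF assms(1) _ that] uniform_near[OF assms(2) _ that] by auto
qed

lemma uniform_Diff:
  assumes "uniform e U" "uniform e V" "e < 1" shows "uniform e (U - V)"
proof (rule uniformI)
  fix A B assume AB: "(A, B) \<in> U - V"
  show "A \<noteq> 0 \<and> B \<noteq> 0" using AB uniform_nonzero[OF assms(1), of A B] by auto
  show "(mat c ** A, mat d ** B) \<in> U - V" if "c \<noteq> 0" "d \<noteq> 0" for c d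
    using AB uniform_scale[OF assms(1) _ that] uniform_unscale[OF assms(2) _ that] by auto
  show "(A', B') \<in> U - V" if "near e A A'" "near e B B'" for A' B'
    using AB uniform_near[OF assms(1) _ that]
      uniform_near[OF assms(2) _ that[THEN near_sym[OF _ assms(3)]]] by auto
qed

lemma clopE2:
  assumes "clop U" "clop V"
  obtains e where "0 < e" "e < 1" "uniform e U" "uniform e V"
proof -
  obtain d e where "0 < d" "d < 1" "uniform d U" "0 < e" "e < 1" "uniform e V"
    using assms by (auto simp: clop_def)
  then show ?thesis
    using that[of "min d e"] uniform_mono[of d U "min d e"] uniform_mono[of e V "min d e"] by simp
qed

lemma clop_empty [simp]: "clop {}"
  unfolding clop_def by (rule exI[of _ "1/2"]) (simp add: uniform_empty)

lemma clop_Un: "clop U \<Longrightarrow> clop V \<Longrightarrow> clop (U \<union> V)"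
  by (rule clopE2[of U V]) (auto simp: clop_def intro: uniform_Un)

lemma clop_Int: "clop U \<Longrightarrow> clop V \<Longrightarrow> clop (U \<inter> V)"
  by (rule clopE2[of U V]) (auto simp: clop_def intro: uniform_Int)

lemma clop_Diff: "clop U \<Longrightarrow> clop V \<Longrightarrow> clop (U - V)"
  by (rule clopE2[of U V]) (auto simp: clop_def intro: uniform_Diff)

lemma clop_UN: "finite I \<Longrightarrow> (\<And>i. i \<in> I \<Longrightarrow> clop (U i)) \<Longrightarrow> clop (\<Union>i\<in>I. U i)"
  by (induction I rule: finite_induct) (auto intro: clop_Un)

section \<open>Swap, transposition and translation of clopen sets\<close>

lemma clop_swap:
  assumes "clop U" shows "clop (prod.swap -` U)"
proof -
  obtain e where e: "0 < e" "e < 1" "uniform e U" using assms by (auto simp: clop_def)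
  then have "uniform e (prod.swap -` U)" by (simp add: uniform_def)
  with e show ?thesis by (auto simp: clop_def)
qed

abbreviation transp :: "'a mpair \<Rightarrow> 'a mpair" where
  "transp \<equiv> map_prod transpose transpose"

lemma transpose_mat_mult: "transpose (mat c ** A) = mat c ** transpose (A :: 'a::field ^ 2 ^ 2)"
  by (simp add: mat_times transpose_def)

lemma clop_transp:
  assumes "clop U" shows "clop (transp -` U)"
proof -
  obtain e where e: "0 < e" "e < 1" "uniform e U" using assms by (auto simp: clop_def)
  have "uniform e (transp -` U)"
  proof (rule uniformI)
    fix A B assume AB: "(A, B) \<in> transp -` U"
    have [simp]: "transpose 0 = (0 :: 'a ^ 2 ^ 2)" by (simp add: transpose_def vec_eq_iff)
    show "A \<noteq> 0 \<and> B \<noteq> 0" using AB uniform_nonzero[OF e(3), of "transpose A" "transpose B"] by auto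
    show "(mat c ** A, mat d ** B) \<in> transp -` U" if "c \<noteq> 0" "d \<noteq> 0" for c d
      using AB that uniform_scale[OF e(3)] by (simp add: transpose_mat_mult)
    show "(A', B') \<in> transp -` U" if "near e A A'" "near e B B'" for A' B'
      using AB that uniform_near[OF e(3)] near_transpose by fastforce
  qed
  with e show ?thesis by (auto simp: clop_def)
qed

text \<open>The right factor enters without inversion; the inverse of the original action reappears
  only in \<open>pullback_diag_act_ind\<close>.\<close>

definition lract :: "'a::nonarch_local_field ^ 2 ^ 2 \<Rightarrow> 'a ^ 2 ^ 2 \<Rightarrow> 'a mpair \<Rightarrow> 'a mpair" where
  "lract g h = map_prod (\<lambda>A. g ** A ** h) (\<lambda>A. g ** A ** h)"

lemma lract_simp [simp]: "lract g h (A, B) = (g ** A ** h, g ** B ** h)"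
  by (simp add: lract_def)

lemma mat_mult_commute2:
  fixes g A h :: "'a::field ^ 2 ^ 2"
  shows "g ** (mat c ** A) ** h = mat c ** (g ** A ** h)"
proof -
  have "g ** (mat c ** A) ** h = g ** mat c ** A ** h" by (simp only: matrix_mul_assoc)
  also have "\<dots> = mat c ** (g ** A ** h)" by (simp only: times_mat[where A = g and a = c] matrix_mul_assoc)
  finally show ?thesis .
qed

lemma matrix_mult_diff2:
  fixes g A h :: "'a::field ^ 2 ^ 2"
  shows "g ** (A - B) ** h = g ** A ** h - g ** B ** h"
  by (simp add: matrix_matrix_mult_def vec_eq_iff sum_2 algebra_simps)

lemma matrix_inv_cancel2:
  assumes "invertible g" "invertible h"
  shows "matrix_inv g ** (g ** A ** h) ** matrix_inv h = (A :: 'a::field ^ 2 ^ 2)"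
    "g ** (matrix_inv g ** A ** matrix_inv h) ** h = (A :: 'a::field ^ 2 ^ 2)"
proof -
  have "matrix_inv g ** (g ** A ** h) ** matrix_inv h = (matrix_inv g ** g) ** A ** (h ** matrix_inv h)"
    by (simp add: matrix_mul_assoc)
  then show "matrix_inv g ** (g ** A ** h) ** matrix_inv h = A"
    by (simp add: matrix_inv_mult assms)
  have "g ** (matrix_inv g ** A ** matrix_inv h) ** h = (g ** matrix_inv g) ** A ** (matrix_inv h ** h)"
    by (simp add: matrix_mul_assoc)
  then show "g ** (matrix_inv g ** A ** matrix_inv h) ** h = A"
    by (simp add: matrix_inv_mult assms)
qed

lemma invertible_matrix_inv: "invertible g \<Longrightarrow> invertible (matrix_inv g :: 'a::field ^ 2 ^ 2)"
  using matrix_inv_mult[of g] unfolding invertible_def by blast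

lemma mnorm_mult3_le: "mnorm (g ** A ** h) \<le> mnorm g * mnorm h * mnorm A"
proof -
  have "mnorm (g ** A ** h) \<le> mnorm (g ** A) * mnorm h" by (rule mnorm_mult_le)
  also have "\<dots> \<le> mnorm g * mnorm A * mnorm h" by (intro mult_right_mono mnorm_mult_le) simp
  finally show ?thesis by (simp add: mult_ac)
qed

text \<open>The product of the four norms is the condition number of
  \<open>A \<mapsto> g ** A ** h\<close>: it bounds the factor by which relative perturbations can
  grow.\<close>

lemma uniform_lract:
  assumes e: "uniform e U" and gh: "invertible g" "invertible h" and "0 \<le> d"
    and d: "mnorm g * mnorm h * (mnorm (matrix_inv g) * mnorm (matrix_inv h)) * d \<le> e"
  shows "uniform d (lract g h -` U)"
proof -
  define k where "k = mnorm g * mnorm h"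
  define k' where "k' = mnorm (matrix_inv g) * mnorm (matrix_inv h)"
  have le: "mnorm A \<le> k' * mnorm (g ** A ** h)" for A
    using mnorm_mult3_le[of "matrix_inv g" "g ** A ** h" "matrix_inv h"] gh
    by (simp add: k'_def matrix_inv_cancel2)
  have k: "0 \<le> k" "0 \<le> k'" by (simp_all add: k_def k'_def)
  have near: "near e (g ** A ** h) (g ** B ** h)" if "near d A B" for A B
  proof -
    have "mnorm (g ** B ** h - g ** A ** h) \<le> k * mnorm (B - A)"
      using mnorm_mult3_le[of g "B - A" h] by (simp add: k_def matrix_mult_diff2)
    also have "\<dots> \<le> k * (d * mnorm A)"
      using that k by (intro mult_left_mono) (auto simp: near_def)
    also have "\<dots> \<le> k * (d * (k' * mnorm (g ** A ** h)))"
      using le k \<open>0 \<le> d\<close> by (intro mult_left_mono) auto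
    also have "\<dots> = (k * k' * d) * mnorm (g ** A ** h)" by simp
    also have "\<dots> \<le> e * mnorm (g ** A ** h)"
      using d unfolding k_def k'_def by (rule mult_right_mono) simp
    finally show ?thesis by (simp add: near_def)
  qed
  show ?thesis
  proof (rule uniformI)
    fix A B assume AB: "(A, B) \<in> lract g h -` U"
    have "g ** 0 ** h = 0" by (simp add: matrix_matrix_mult_def vec_eq_iff)
    then show "A \<noteq> 0 \<and> B \<noteq> 0" using AB uniform_nonzero[OF e] by fastforce
    show "(mat c ** A, mat d ** B) \<in> lract g h -` U" if "c \<noteq> 0" "d \<noteq> 0" for c d
      using AB that uniform_scale[OF e] by (simp add: mat_mult_commute2)
    show "(A', B') \<in> lract g h -` U" if "near d A A'" "near d B B'" for A' B'
      using AB that uniform_near[OF e] near by simp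
  qed
qed

lemma clop_lract:
  assumes "clop U" "invertible g" "invertible h" shows "clop (lract g h -` U)"
proof -
  obtain e where e: "0 < e" "e < 1" "uniform e U" using assms(1) by (auto simp: clop_def)
  define k where "k = mnorm g * mnorm h * (mnorm (matrix_inv g) * mnorm (matrix_inv h))"
  have k: "0 \<le> k" by (simp add: k_def)
  \<comment> \<open>The summand 1 gives \<open>d \<le> e < 1\<close> whatever the size of
    \<open>k\<close>.\<close>
  define d where "d = e / (1 + k)"
  have d: "0 < d" "d \<le> e" using e k by (simp_all add: d_def divide_le_eq mult_le_cancel_left1)
  have "k * d = e * (k / (1 + k))" by (simp add: d_def)
  also have "\<dots> \<le> e" using e k by (intro mult_left_le) (simp_all add: divide_le_eq)
  finally have "uniform d (lract g h -` U)"
    using d by (intro uniform_lract[OF e(3) assms(2,3)]) (simp_all add: k_def)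
  with d e(2) show ?thesis unfolding clop_def by (intro exI[of _ d]) auto
qed

subsection \<open>Compactness\<close>

lemma mnorm_le_dist: "mnorm (A - B) \<le> dist A B"
proof -
  have "absval ((A - B)$i$j) \<le> dist A B" for i j
    using dist_vec_nth_le[of "A$i" j "B$i"] dist_vec_nth_le[of A i B] by (simp add: dist_absval)
  then show ?thesis unfolding mnorm_le_iff by blast
qed

lemma dist_le_mnorm: "dist A B \<le> 4 * mnorm (A - B)"
proof -
  have row: "dist (A$i) (B$i) \<le> 2 * mnorm (A - B)" for i
  proof -
    have "dist (A$i) (B$i) \<le> (\<Sum>j\<in>UNIV. dist (A$i$j) (B$i$j))"
      unfolding dist_vec_def[of "A$i"] by (rule L2_set_le_sum) simp
    also have "\<dots> \<le> (\<Sum>j\<in>(UNIV :: 2 set). mnorm (A - B))"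
    proof (rule sum_mono)
      fix j :: 2
      show "dist (A$i$j) (B$i$j) \<le> mnorm (A - B)"
        using exhaust_2[of i] exhaust_2[of j] mnorm_entries[of "A - B"]
        by (auto simp: dist_absval)
    qed
    finally show ?thesis by simp
  qed
  have "dist A B \<le> (\<Sum>i\<in>UNIV. dist (A$i) (B$i))"
    unfolding dist_vec_def[of A] by (rule L2_set_le_sum) simp
  also have "\<dots> \<le> (\<Sum>i\<in>(UNIV :: 2 set). 2 * mnorm (A - B))" by (intro sum_mono row)
  finally show ?thesis by simp
qed

definition mat2 :: "'a \<Rightarrow> 'a \<Rightarrow> 'a \<Rightarrow> 'a \<Rightarrow> 'a::zero ^ 2 ^ 2" where
  "mat2 a b c d = vector [vector [a, b], vector [c, d]]"

lemma mat2_nth [simp]: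
  "mat2 a b c d $ 1 $ 1 = a" "mat2 a b c d $ 1 $ 2 = b"
  "mat2 a b c d $ 2 $ 1 = c" "mat2 a b c d $ 2 $ 2 = d"
  by (simp_all add: mat2_def vector_2)

lemma compact_mnorm_1: "compact {A :: 'a::nonarch_local_field ^ 2 ^ 2. mnorm A = 1}" (is "compact ?P")
  unfolding compact_eq_totally_bounded
proof (intro conjI allI impI)
  \<comment> \<open>By the ultrametric inequality \<open>mnorm\<close> is constant on the open ball
    of radius \<open>mnorm A\<close> around \<open>A \<noteq> 0\<close>.\<close>
  have "open (- ?P)"
    unfolding open_dist
  proof
    fix A assume A: "A \<in> - ?P"
    define e where "e = (if A = 0 then 1 else mnorm A)"
    have "B \<in> - ?P" if "dist B A < e" for B
    proof (cases "A = 0")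
      case True
      then show ?thesis using that mnorm_le_dist[of B A] by (auto simp: e_def)
    next
      case False
      then show ?thesis
        using that A mnorm_le_dist[of B A] mnorm_eq_of_diff[of B A] by (auto simp: e_def)
    qed
    moreover have "e > 0" by (simp add: e_def)
    ultimately show "\<exists>e>0. \<forall>B. dist B A < e \<longrightarrow> B \<in> - ?P" by blast
  qed
  then show "complete ?P" by (simp add: complete_eq_closed closed_def)
  fix e :: real assume "e > 0"
  \<comment> \<open>By \<open>dist_le_mnorm\<close>, entries known up to \<open>e / 8\<close>
    determine the matrix up to \<open>e / 2\<close>.\<close>
  then obtain R :: "'a set" where R: "finite R"
    "\<And>x. absval x \<le> 1 \<Longrightarrow> \<exists>r\<in>R. absval (x - r) \<le> e / 8"
    using finite_net[of "e / 8"] by auto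
  let ?K = "(\<lambda>(a, b, c, d). mat2 a b c d) ` (R \<times> R \<times> R \<times> R)"
  have "?P \<subseteq> (\<Union>x\<in>?K. ball x e)"
  proof
    fix A assume "A \<in> ?P"
    then have A1: "mnorm A = 1" by simp
    obtain a where a: "a \<in> R" "absval (A$1$1 - a) \<le> e/8" using R(2)[of "A$1$1"] mnorm_entries(1)[of A] A1 by auto
    obtain b where b: "b \<in> R" "absval (A$1$2 - b) \<le> e/8" using R(2)[of "A$1$2"] mnorm_entries(2)[of A] A1 by auto
    obtain c where c: "c \<in> R" "absval (A$2$1 - c) \<le> e/8" using R(2)[of "A$2$1"] mnorm_entries(3)[of A] A1 by auto
    obtain d where d: "d \<in> R" "absval (A$2$2 - d) \<le> e/8" using R(2)[of "A$2$2"] mnorm_entries(4)[of A] A1 by auto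
    have "mnorm (A - mat2 a b c d) \<le> e / 8"
      using a(2) b(2) c(2) d(2) unfolding mnorm_le_iff by simp
    then have "dist (mat2 a b c d) A < e"
      using dist_le_mnorm[of A "mat2 a b c d"] \<open>e > 0\<close> by (simp add: dist_commute)
    moreover have "mat2 a b c d \<in> ?K"
      by (rule image_eqI[of _ _ "(a, b, c, d)"]) (use a b c d in auto)
    ultimately show "A \<in> (\<Union>x\<in>?K. ball x e)"
      by (intro UN_I[of "mat2 a b c d"]) (simp_all only: mem_ball)
  qed
  then show "\<exists>k. finite k \<and> ?P \<subseteq> (\<Union>x\<in>k. ball x e)"
    using R(1) by (intro exI[of _ ?K]) auto
qed

text \<open>Every class has a representative on the compact sphere \<open>mnorm A = 1\<close>, where
  a metric ball of radius \<open>e\<close> consists of matrices that are \<open>near e\<close> to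
  its centre. The radius function \<open>E\<close> is arbitrary, so this serves both measures and
  test functions.\<close>

lemma finite_near_cover:
  fixes E :: "'a::nonarch_local_field mpair \<Rightarrow> real"
  assumes "\<And>A B. A \<noteq> 0 \<Longrightarrow> B \<noteq> 0 \<Longrightarrow> 0 < E (A, B)"
  obtains T where "finite T" "T \<subseteq> (- {0}) \<times> (- {0})"
    "\<forall>A B. A \<noteq> 0 \<longrightarrow> B \<noteq> 0 \<longrightarrow> (\<exists>(A0, B0)\<in>T. \<exists>c d. c \<noteq> 0 \<and> d \<noteq> 0 \<and>
       near (E (A0, B0)) A0 (mat c ** A) \<and> near (E (A0, B0)) B0 (mat d ** B))"
proof -
  let ?P = "{A :: 'a ^ 2 ^ 2. mnorm A = 1}"
  let ?U = "\<lambda>p. ball (fst p) (E p) \<times> ball (snd p) (E p)"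
  have nz: "A \<noteq> 0" if "A \<in> ?P" for A using that by auto
  have "compact (?P \<times> ?P)" by (intro compact_Times compact_mnorm_1)
  moreover have "open (?U p)" for p by (intro open_Times open_ball)
  moreover have "p \<in> ?U p" if "p \<in> ?P \<times> ?P" for p
    using assms[of "fst p" "snd p"] nz that by (cases p) auto
  then have "?P \<times> ?P \<subseteq> (\<Union>p\<in>?P \<times> ?P. ?U p)" by blast
  ultimately obtain T where T: "T \<subseteq> ?P \<times> ?P" "finite T" "?P \<times> ?P \<subseteq> (\<Union>p\<in>T. ?U p)"
    by (rule compactE_image)
  show ?thesis
  proof
    show "finite T" by fact
    show "T \<subseteq> (- {0}) \<times> (- {0})" using T(1) by auto
  next
    show "\<forall>A B. A \<noteq> 0 \<longrightarrow> B \<noteq> 0 \<longrightarrow> (\<exists>(A0, B0)\<in>T. \<exists>c d. c \<noteq> 0 \<and> d \<noteq> 0 \<and>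
       near (E (A0, B0)) A0 (mat c ** A) \<and> near (E (A0, B0)) B0 (mat d ** B))"
    proof (intro allI impI)
      fix A B :: "'a ^ 2 ^ 2" assume "A \<noteq> 0" "B \<noteq> 0"
      then obtain c d where c: "c \<noteq> 0" "mnorm (mat c ** A) = 1" and d: "d \<noteq> 0" "mnorm (mat d ** B) = 1"
        using ex_mnorm_1 by meson
      then have "(mat c ** A, mat d ** B) \<in> (\<Union>p\<in>T. ?U p)" using T(3) by blast
      then obtain A0 B0 where AB: "(A0, B0) \<in> T" "dist A0 (mat c ** A) < E (A0, B0)"
        "dist B0 (mat d ** B) < E (A0, B0)" by auto
      moreover have "mnorm A0 = 1" "mnorm B0 = 1" using AB(1) T(1) by auto
      ultimately have "near (E (A0, B0)) A0 (mat c ** A)" "near (E (A0, B0)) B0 (mat d ** B)"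
        using mnorm_le_dist[of "mat c ** A" A0] mnorm_le_dist[of "mat d ** B" B0]
        by (auto simp: near_def dist_commute)
      then show "\<exists>(A0, B0)\<in>T. \<exists>c d. c \<noteq> 0 \<and> d \<noteq> 0 \<and>
         near (E (A0, B0)) A0 (mat c ** A) \<and> near (E (A0, B0)) B0 (mat d ** B)"
        using AB(1) c(1) d(1) by blast
    qed
  qed
qed

subsection \<open>Invariant finitely additive measures\<close>

locale invariant_measure =
  fixes m :: "'a::nonarch_local_field mpair set \<Rightarrow> complex"
  assumes m_Un: "clop U \<Longrightarrow> clop V \<Longrightarrow> U \<inter> V = {} \<Longrightarrow> m (U \<union> V) = m U + m V"
    and m_lract: "clop U \<Longrightarrow> invertible g \<Longrightarrow> invertible h \<Longrightarrow> m (lract g h -` U) = m U"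
begin

lemma m_empty [simp]: "m {} = 0"
  using m_Un[of "{}" "{}"] by simp

lemma m_split: "clop U \<Longrightarrow> clop V \<Longrightarrow> m U = m (U \<inter> V) + m (U - V)"
  using m_Un[of "U \<inter> V" "U - V"] by (simp add: clop_Int clop_Diff Int_Diff_Un Int_Diff_disjoint)

lemma m_UN:
  assumes "finite I" "\<And>i. i \<in> I \<Longrightarrow> clop (U i)"
    and "\<And>i j. i \<in> I \<Longrightarrow> j \<in> I \<Longrightarrow> i \<noteq> j \<Longrightarrow> U i \<inter> U j = {}"
  shows "m (\<Union>i\<in>I. U i) = (\<Sum>i\<in>I. m (U i))"
  using assms
proof (induction I rule: finite_induct)
  case (insert i I)
  have "U i \<inter> (\<Union>j\<in>I. U j) = {}"
    using insert.prems(2)[of i] insert.hyps(2) by auto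
  moreover have "clop (\<Union>j\<in>I. U j)" using insert by (intro clop_UN) auto
  ultimately show ?case using insert by (simp add: m_Un)
qed simp

text \<open>By compactness finitely many \<open>Y\<close> cover \<open>N\<close>; cutting
  \<open>N\<close> along them one after the other stays inside the ring \<open>Q\<close>. The ring
  is a parameter because the argument is applied once to the sets of one fixed scale and once to all
  clopen sets.\<close>

lemma local_vanishing:
  assumes Q: "\<And>Z. Q Z \<Longrightarrow> clop Z" "\<And>Y Z. Q Y \<Longrightarrow> Q Z \<Longrightarrow> Q (Y \<inter> Z)"
      "\<And>Y Z. Q Y \<Longrightarrow> Q Z \<Longrightarrow> Q (Y - Z)"
    and N: "Q N"
    and loc: "\<And>A B. (A, B) \<in> N \<Longrightarrow>
      \<exists>Y. Q Y \<and> (A, B) \<in> Y \<and> (\<forall>Z. Q Z \<longrightarrow> Z \<subseteq> N \<inter> Y \<longrightarrow> m Z = 0)"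
  shows "m N = 0"
proof -
  have "\<exists>Y. Q Y \<and> p \<in> Y \<and> (\<forall>Z. Q Z \<longrightarrow> Z \<subseteq> N \<inter> Y \<longrightarrow> m Z = 0)" if "p \<in> N" for p
    using loc[of "fst p" "snd p"] that by simp
  then have "\<exists>Y. \<forall>p\<in>N. Q (Y p) \<and> p \<in> Y p \<and> (\<forall>Z. Q Z \<longrightarrow> Z \<subseteq> N \<inter> Y p \<longrightarrow> m Z = 0)"
    by (intro bchoice) blast
  then obtain Y where Y': "\<forall>p\<in>N. Q (Y p) \<and> p \<in> Y p \<and> (\<forall>Z. Q Z \<longrightarrow> Z \<subseteq> N \<inter> Y p \<longrightarrow> m Z = 0)" ..
  have Y: "Q (Y p)" "p \<in> Y p" "\<And>Z. Q Z \<Longrightarrow> Z \<subseteq> N \<inter> Y p \<Longrightarrow> m Z = 0" if "p \<in> N" for p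
    using Y' that by blast+
  obtain e0 where e0: "0 < e0" "e0 < 1" "uniform e0 N" using Q(1)[OF N] by (auto simp: clop_def)
  have "\<exists>E'. \<forall>p\<in>N. 0 < E' p \<and> E' p < 1 \<and> uniform (E' p) (Y p)"
    using Q(1)[OF Y(1)] unfolding clop_def by (intro bchoice) blast
  then obtain E' where E': "\<forall>p\<in>N. 0 < E' p \<and> E' p < 1 \<and> uniform (E' p) (Y p)" ..
  \<comment> \<open>Outside \<open>N\<close> the radius \<open>e0\<close> keeps the neighbourhood
    disjoint from \<open>N\<close>, since \<open>N\<close> is stable at scale \<open>e0\<close>. So
    the centres in \<open>N\<close> already cover \<open>N\<close>.\<close>
  define E where "E p = (if p \<in> N then E' p else e0)" for p
  have E_pos: "0 < E (A, B)" for A B using E' e0 by (simp add: E_def)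
  obtain T where T: "finite T" "T \<subseteq> (- {0}) \<times> (- {0})"
    "\<forall>A B. A \<noteq> 0 \<longrightarrow> B \<noteq> 0 \<longrightarrow> (\<exists>(A0, B0)\<in>T. \<exists>c d. c \<noteq> 0 \<and> d \<noteq> 0 \<and>
       near (E (A0, B0)) A0 (mat c ** A) \<and> near (E (A0, B0)) B0 (mat d ** B))"
    by (rule finite_near_cover[of E, OF E_pos])
  have cover: "N \<subseteq> (\<Union>p\<in>T \<inter> N. Y p)"
  proof clarify
    fix A B assume AB: "(A, B) \<in> N"
    then have "A \<noteq> 0" "B \<noteq> 0" using uniform_nonzero[OF e0(3)] by auto
    then obtain A0 B0 c d where p: "(A0, B0) \<in> T" "c \<noteq> 0" "d \<noteq> 0"
      "near (E (A0, B0)) A0 (mat c ** A)" "near (E (A0, B0)) B0 (mat d ** B)"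
      using T(3)[rule_format, of A B] by auto
    have cAB: "(mat c ** A, mat d ** B) \<in> N" using uniform_scale[OF e0(3) AB p(2,3)] .
    have pN: "(A0, B0) \<in> N"
    proof (rule ccontr)
      assume "(A0, B0) \<notin> N"
      then have E: "E (A0, B0) = e0" by (simp add: E_def)
      show False using uniform_near[OF e0(3) cAB] p(4,5) near_sym[OF _ e0(2)] \<open>(A0, B0) \<notin> N\<close>
        unfolding E by blast
    qed
    then have E: "E (A0, B0) = E' (A0, B0)" by (simp add: E_def)
    have u: "uniform (E' (A0, B0)) (Y (A0, B0))" using E' pN by blast
    have "(mat c ** A, mat d ** B) \<in> Y (A0, B0)"
      using uniform_near[OF u Y(2)[OF pN]] p(4,5) unfolding E by blast
    then have "(A, B) \<in> Y (A0, B0)" using uniform_unscale[OF u _ p(2,3)] by blast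
    then show "(A, B) \<in> (\<Union>p\<in>T \<inter> N. Y p)" using p(1) pN by blast
  qed
  have "m Z = 0" if "finite S" "S \<subseteq> N" "Q Z" "Z \<subseteq> N" "Z \<subseteq> (\<Union>p\<in>S. Y p)" for S Z
    using that
  proof (induction S arbitrary: Z rule: finite_induct)
    case (insert p S)
    have "m (Z \<inter> Y p) = 0"
      using insert.prems Y(1)[of p] by (intro Y(3)[of p]) (auto intro: Q)
    moreover have "m (Z - Y p) = 0"
      using insert.prems Y(1)[of p] by (intro insert.IH) (auto intro: Q)
    ultimately show ?case
      using m_split[of Z "Y p"] insert.prems Y(1)[of p] by (simp add: Q)
  qed simp
  from this[OF _ _ N _ cover] T(1) show ?thesis by blast
qed

lemma invariant_measure_swap: "invariant_measure (\<lambda>U. m (prod.swap -` U))"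
proof
  fix U V :: "'a mpair set" assume U: "clop U"
  show "m (prod.swap -` (U \<union> V)) = m (prod.swap -` U) + m (prod.swap -` V)"
    if "clop V" "U \<inter> V = {}"
    using m_Un[OF clop_swap[OF U] clop_swap[OF that(1)]] that(2)
    by (simp add: vimage_Un flip: vimage_Int)
  fix g h :: "'a ^ 2 ^ 2" assume gh: "invertible g" "invertible h"
  have "prod.swap -` lract g h -` U = lract g h -` prod.swap -` U" by auto
  then show "m (prod.swap -` lract g h -` U) = m (prod.swap -` U)"
    using m_lract[OF clop_swap[OF U] gh] by simp
qed

lemma invertible_transpose: "invertible g \<Longrightarrow> invertible (transpose (g :: 'a ^ 2 ^ 2))"
  unfolding invertible_def by (metis matrix_transpose_mul transpose_mat)

text \<open>Transposition exchanges the left and the right factor of the group, so it preserves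
  invariance under both together.\<close>

lemma invariant_measure_transp: "invariant_measure (\<lambda>U. m (transp -` U))"
proof
  fix U V :: "'a mpair set" assume U: "clop U"
  show "m (transp -` (U \<union> V)) = m (transp -` U) + m (transp -` V)"
    if "clop V" "U \<inter> V = {}"
    using m_Un[OF clop_transp[OF U] clop_transp[OF that(1)]] that(2)
    by (simp add: vimage_Un flip: vimage_Int)
  fix g h :: "'a ^ 2 ^ 2" assume gh: "invertible g" "invertible h"
  have "transp -` lract g h -` U = lract (transpose h) (transpose g) -` transp -` U"
    by (auto simp: matrix_transpose_mul matrix_mul_assoc)
  then show "m (transp -` lract g h -` U) = m (transp -` U)"
    using m_lract[OF clop_transp[OF U] gh(2,1)[THEN invertible_transpose]] by simp
qed

definition skew :: "'a mpair set \<Rightarrow> complex" where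
  "skew U = m U - m (prod.swap -` U)"

lemma invariant_measure_skew: "invariant_measure skew"
proof -
  interpret s: invariant_measure "\<lambda>U. m (prod.swap -` U)" by (rule invariant_measure_swap)
  show ?thesis
    by unfold_locales (simp_all add: skew_def m_Un s.m_Un m_lract s.m_lract del: vimage_Un)
qed

end

subsection \<open>Boxes around a degenerate pair\<close>

text \<open>Affine coordinates around the pair of matrix units
  \<open>(mat2 1 0 0 0, mat2 0 0 1 0)\<close>: \<open>A\<close> is proportional to
  \<open>mat2 1 x y z\<close> and \<open>B\<close> to \<open>mat2 y' x' 1 z'\<close>.\<close>

definition chart :: "('a::nonarch_local_field \<Rightarrow> 'a \<Rightarrow> 'a \<Rightarrow> 'a \<Rightarrow> 'a \<Rightarrow> 'a \<Rightarrow> bool) \<Rightarrow> 'a mpair set" where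
  "chart Q = {(A, B). A$1$1 \<noteq> 0 \<and> B$2$1 \<noteq> 0 \<and>
     Q (A$1$2 / A$1$1) (A$2$1 / A$1$1) (A$2$2 / A$1$1)
       (B$1$2 / B$2$1) (B$1$1 / B$2$1) (B$2$2 / B$2$1)}"

text \<open>Coordinates bounded by 1 mean that the denominators \<open>A$1$1\<close> and
  \<open>B$2$1\<close> have the norm of the whole matrix. Then a relative perturbation by
  \<open>e\<close> moves each coordinate by at most \<open>e\<close>, which gives
  \<open>uniform_chart\<close>.\<close>

definition regular :: "real \<Rightarrow> ('a::nonarch_local_field \<Rightarrow> 'a \<Rightarrow> 'a \<Rightarrow> 'a \<Rightarrow> 'a \<Rightarrow> 'a \<Rightarrow> bool) \<Rightarrow> bool" where
  "regular e Q \<longleftrightarrow> (\<forall>x y z x' y' z'. Q x y z x' y' z' \<longrightarrow>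
     absval x \<le> 1 \<and> absval y \<le> 1 \<and> absval z \<le> 1 \<and>
     absval x' \<le> 1 \<and> absval y' \<le> 1 \<and> absval z' \<le> 1 \<and>
     (\<forall>X Y Z X' Y' Z'. absval (X - x) \<le> e \<longrightarrow> absval (Y - y) \<le> e \<longrightarrow> absval (Z - z) \<le> e \<longrightarrow>
        absval (X' - x') \<le> e \<longrightarrow> absval (Y' - y') \<le> e \<longrightarrow> absval (Z' - z') \<le> e \<longrightarrow>
        Q X Y Z X' Y' Z'))"

lemma absval_quotient_near:
  fixes a p :: "'a::nonarch_local_field"
  assumes "p \<noteq> 0" "absval a \<le> absval p" "absval (a' - a) \<le> e * absval p"
    "absval (p' - p) \<le> e * absval p" "e < 1"
  shows "p' \<noteq> 0" "absval (a' / p' - a / p) \<le> e"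
proof -
  have "absval (p' - p) < absval p"
    using assms(1,4,5) by (metis absval_gt_0_iff le_less_trans mult_less_cancel_right2 not_less)
  then have p': "absval p' = absval p" by (rule absval_eq_of_diff)
  with assms(1) show "p' \<noteq> 0" by (metis absval_eq_0_iff)
  then have "a' / p' - a / p = ((a' - a) * p - a * (p' - p)) / (p' * p)"
    using assms(1) by (simp add: field_simps)
  moreover have "absval ((a' - a) * p - a * (p' - p)) \<le> e * absval p * absval p"
    using absval_mult_le[OF assms(3), of p "absval p"] absval_mult_le[OF assms(2,4)]
    by (intro absval_diff_le) (simp_all add: mult_ac)
  ultimately show "absval (a' / p' - a / p) \<le> e"
    using assms(1) by (simp add: absval_divide absval_mult p' divide_le_eq mult_ac)
qed

lemma uniform_chart:
  assumes "regular e Q" "0 < e" "e < 1" shows "uniform e (chart Q)"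
proof (rule uniformI)
  fix A B assume AB: "(A, B) \<in> chart Q"
  then show "A \<noteq> 0 \<and> B \<noteq> 0" by (auto simp: chart_def)
  show "(mat c ** A, mat d ** B) \<in> chart Q" if "c \<noteq> 0" "d \<noteq> 0" for c d
    using AB that by (simp add: chart_def mat_times)
  let ?x = "A$1$2 / A$1$1" and ?y = "A$2$1 / A$1$1" and ?z = "A$2$2 / A$1$1"
  let ?x' = "B$1$2 / B$2$1" and ?y' = "B$1$1 / B$2$1" and ?z' = "B$2$2 / B$2$1"
  have nz: "A$1$1 \<noteq> 0" "B$2$1 \<noteq> 0" and Q: "Q ?x ?y ?z ?x' ?y' ?z'"
    using AB by (auto simp: chart_def)
  have b: "absval ?x \<le> 1" "absval ?y \<le> 1" "absval ?z \<le> 1"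
      "absval ?x' \<le> 1" "absval ?y' \<le> 1" "absval ?z' \<le> 1"
    using assms(1)[unfolded regular_def, rule_format, OF Q] by auto
  then have le: "absval (A$1$2) \<le> absval (A$1$1)" "absval (A$2$1) \<le> absval (A$1$1)"
      "absval (A$2$2) \<le> absval (A$1$1)" "absval (B$1$2) \<le> absval (B$2$1)"
      "absval (B$1$1) \<le> absval (B$2$1)" "absval (B$2$2) \<le> absval (B$2$1)"
    using nz by (simp_all add: absval_divide divide_le_eq)
  then have n: "mnorm A = absval (A$1$1)" "mnorm B = absval (B$2$1)"
    by (simp_all add: mnorm_def)
  show "(A', B') \<in> chart Q" if near: "near e A A'" "near e B B'" for A' B'
  proof -
    have A: "absval (A'$1$1 - A$1$1) \<le> e * absval (A$1$1)" "absval (A'$1$2 - A$1$2) \<le> e * absval (A$1$1)"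
        "absval (A'$2$1 - A$2$1) \<le> e * absval (A$1$1)" "absval (A'$2$2 - A$2$2) \<le> e * absval (A$1$1)"
      using near(1) by (simp_all add: near_def n mnorm_le_iff)
    have B: "absval (B'$1$1 - B$1$1) \<le> e * absval (B$2$1)" "absval (B'$1$2 - B$1$2) \<le> e * absval (B$2$1)"
        "absval (B'$2$1 - B$2$1) \<le> e * absval (B$2$1)" "absval (B'$2$2 - B$2$2) \<le> e * absval (B$2$1)"
      using near(2) by (simp_all add: near_def n mnorm_le_iff)
    note qA = absval_quotient_near[OF nz(1) _ _ A(1) assms(3)]
    note qB = absval_quotient_near[OF nz(2) _ _ B(3) assms(3)]
    have "Q (A'$1$2 / A'$1$1) (A'$2$1 / A'$1$1) (A'$2$2 / A'$1$1)
       (B'$1$2 / B'$2$1) (B'$1$1 / B'$2$1) (B'$2$2 / B'$2$1)"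
      using assms(1)[unfolded regular_def, rule_format, OF Q]
        qA(2)[OF le(1) A(2)] qA(2)[OF le(2) A(3)] qA(2)[OF le(3) A(4)]
        qB(2)[OF le(4) B(2)] qB(2)[OF le(5) B(1)] qB(2)[OF le(6) B(4)] by blast
    then show ?thesis
      using qA(1)[OF le(1) A(2)] qB(1)[OF le(4) B(2)] by (simp add: chart_def)
  qed
qed

definition padded :: "real \<Rightarrow> 'a::nonarch_local_field set \<Rightarrow> bool" where
  "padded e C \<longleftrightarrow> (\<forall>c\<in>C. absval c \<le> 1 \<and> (\<forall>c'. absval (c' - c) \<le> e \<longrightarrow> c' \<in> C))"

lemma paddedD: "padded e C \<Longrightarrow> c \<in> C \<Longrightarrow> absval (c' - c) \<le> e \<Longrightarrow> c' \<in> C"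
  by (auto simp: padded_def)

lemma padded_bound: "padded e C \<Longrightarrow> c \<in> C \<Longrightarrow> absval c \<le> 1"
  by (auto simp: padded_def)

lemma padded_mono: "padded e C \<Longrightarrow> d \<le> e \<Longrightarrow> padded d C"
  by (auto simp: padded_def)

lemma padded_divide:
  assumes "padded e C" "c \<in> C" "absval (u - 1) \<le> e" "e < 1"
  shows "c / u \<in> C"
proof (rule paddedD[OF assms(1,2)])
  have u: "absval u = 1" using assms(3,4) by (intro absval_unit) simp
  then have "u \<noteq> 0" by auto
  then have "c / u - c = - (c * (u - 1) / u)" by (simp add: field_simps)
  then show "absval (c / u - c) \<le> e"
    using absval_mult_le_right[OF padded_bound[OF assms(1,2)] assms(3)] u by (simp add: absval_divide)
qed

text \<open>
  For \<open>k = (1, y'; y, 1)\<close> a pair in \<open>chart\<close> is, up to scalars,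
  \<open>(k (1, a; 0, c), k (0, c'; 1, a'))\<close> with \<open>c\<close>, \<open>c'\<close>, \<open>a\<close>, \<open>a'\<close> given up to the factor
  \<open>1 - y y'\<close> by the four expressions below; the diagonal torus acts on \<open>(c, c')\<close> hyperbolically.
\<close>

definition pbox :: "'a \<Rightarrow> real \<Rightarrow> real \<Rightarrow> 'a set \<Rightarrow> 'a set \<Rightarrow> 'a set \<Rightarrow> 'a::nonarch_local_field set \<Rightarrow> 'a mpair set"
  where "pbox b p q C C' D D' = chart (\<lambda>x y z x' y' z'. absval (y - b) \<le> p \<and> absval y' \<le> q \<and>
     z - x * y \<in> C \<and> x' - y' * z' \<in> C' \<and> x - y' * z \<in> D \<and> z' - y * x' \<in> D')"

text \<open>A value of \<open>x\<close> above 1 would force \<open>absval x < absval z\<close>, and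
  a value of \<open>z\<close> above 1 would force \<open>absval z < absval x\<close>. Thus bounds on
  the slice coordinates bound the affine coordinates.\<close>

lemma absval_solve_le:
  fixes x z :: "'a::nonarch_local_field"
  assumes "absval (z - x * y) \<le> 1" "absval (x - y' * z) \<le> 1" "absval y < 1" "absval y' < 1"
  shows "absval x \<le> 1" "absval z \<le> 1"
proof -
  have x: "absval x \<le> max 1 (absval y' * absval z)"
    using absval_ultrametric[of "x - y' * z" "y' * z"] assms(2) by (auto simp: absval_mult)
  have z: "absval z \<le> max 1 (absval x * absval y)"
    using absval_ultrametric[of "z - x * y" "x * y"] assms(1) by (auto simp: absval_mult)
  have "absval y' * absval z \<le> absval z" "absval x * absval y \<le> absval x"
    using assms(3,4) by (simp_all add: mult_left_le_one_le mult_left_le)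
  moreover have "absval x * absval y < absval x" if "absval x > 1"
    using that assms(3) by (simp del: absval_gt_0_iff)
  moreover have "absval y' * absval z < absval z" if "absval z > 1"
    using that assms(4) by (simp del: absval_gt_0_iff)
  ultimately show "absval x \<le> 1" "absval z \<le> 1" using x z by (smt (verit))+
qed

lemma regular_pbox:
  assumes "absval b < 1" "p < 1" "q < 1" "e \<le> p" "e \<le> q"
    and padded: "padded e C" "padded e C'" "padded e D" "padded e D'"
  shows "regular e (\<lambda>x y z x' y' z'. absval (y - b) \<le> p \<and> absval y' \<le> q \<and>
     z - x * y \<in> C \<and> x' - y' * z' \<in> C' \<and> x - y' * z \<in> D \<and> z' - y * x' \<in> D')"
  unfolding regular_def
proof (intro allI impI, elim conjE)
  fix x y z x' y' z' :: 'a
  assume h: "absval (y - b) \<le> p" "absval y' \<le> q" "z - x * y \<in> C" "x' - y' * z' \<in> C'"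
    "x - y' * z \<in> D" "z' - y * x' \<in> D'"
  have y: "absval y < 1" "absval y' < 1"
    using absval_add_less[of "y - b" 1 b] h(1,2) assms by simp_all
  have xz: "absval x \<le> 1" "absval z \<le> 1"
    using absval_solve_le[of z x y y'] y h(3,5) padded by (auto dest: padded_bound)
  have xz': "absval x' \<le> 1" "absval z' \<le> 1"
    using absval_solve_le[of z' x' y y'] absval_solve_le[of x' z' y' y] y h(4,6) padded
    by (auto dest: padded_bound simp: mult.commute)
  have prod: "absval (X * Y - u * v) \<le> e"
    if "absval (X - u) \<le> e" "absval (Y - v) \<le> e" "absval X \<le> 1" "absval v \<le> 1" for X Y u v :: 'a
  proof -
    have "X * Y - u * v = X * (Y - v) + (X - u) * v" by (simp add: algebra_simps)
    then show ?thesis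
      using that absval_add_le[OF absval_mult_le_right absval_mult_le_left, of X "Y - v" e "X - u" v]
      by simp
  qed
  have bd: "absval X \<le> 1" if "absval (X - u) \<le> e" "absval u \<le> 1" for X u :: 'a
    using absval_add_le[of "X - u" 1 u] that assms by simp
  have "absval (Y - b) \<le> p \<and> absval Y' \<le> q \<and> Z - X * Y \<in> C \<and> X' - Y' * Z' \<in> C' \<and>
      X - Y' * Z \<in> D \<and> Z' - Y * X' \<in> D'"
    if d: "absval (X - x) \<le> e" "absval (Y - y) \<le> e" "absval (Z - z) \<le> e"
        "absval (X' - x') \<le> e" "absval (Y' - y') \<le> e" "absval (Z' - z') \<le> e" for X Y Z X' Y' Z'
  proof (intro conjI)
    show "absval (Y - b) \<le> p" using absval_diff_trans[of Y y p b] d h(1) assms by simp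
    show "absval Y' \<le> q" using absval_add_le[of "Y' - y'" q y'] d h(2) assms by simp
    have *: "absval ((U - V) - (u - v)) \<le> e" if "absval (U - u) \<le> e" "absval (V - v) \<le> e" for U V u v :: 'a
      using absval_diff_le[OF that] by (simp add: algebra_simps)
    show "Z - X * Y \<in> C" "X' - Y' * Z' \<in> C'" "X - Y' * Z \<in> D" "Z' - Y * X' \<in> D'"
      using d y xz xz' bd[OF d(1) xz(1)] bd[OF d(5)] bd[OF d(2)]
      by (auto intro!: paddedD[OF padded(1) h(3)] paddedD[OF padded(2) h(4)] paddedD[OF padded(3) h(5)]
           paddedD[OF padded(4) h(6)] * prod)
  qed
  then show "absval x \<le> 1 \<and> absval y \<le> 1 \<and> absval z \<le> 1 \<and> absval x' \<le> 1 \<and> absval y' \<le> 1 \<and> absval z' \<le> 1 \<and>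
    (\<forall>X Y Z X' Y' Z'. absval (X - x) \<le> e \<longrightarrow> absval (Y - y) \<le> e \<longrightarrow> absval (Z - z) \<le> e \<longrightarrow>
        absval (X' - x') \<le> e \<longrightarrow> absval (Y' - y') \<le> e \<longrightarrow> absval (Z' - z') \<le> e \<longrightarrow>
        absval (Y - b) \<le> p \<and> absval Y' \<le> q \<and> Z - X * Y \<in> C \<and> X' - Y' * Z' \<in> C' \<and>
        X - Y' * Z \<in> D \<and> Z' - Y * X' \<in> D')"
    using y xz xz' by simp
qed

lemma clop_pbox:
  assumes "absval b < 1" "0 < p" "p < 1" "0 < q" "q < 1" "0 < e"
    and padded: "padded e C" "padded e C'" "padded e D" "padded e D'"
  shows "clop (pbox b p q C C' D D')"
proof -
  let ?e = "min e (min p q)"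
  have "uniform ?e (pbox b p q C C' D D')"
    unfolding pbox_def using assms
    by (intro uniform_chart regular_pbox) (auto intro: padded_mono)
  then show ?thesis using assms unfolding clop_def by (intro exI[of _ ?e]) auto
qed

section \<open>Group elements acting on boxes\<close>

lemma mat2_mult:
  "mat2 a b c d ** A = mat2 (a * A$1$1 + b * A$2$1) (a * A$1$2 + b * A$2$2)
     (c * A$1$1 + d * A$2$1) (c * A$1$2 + d * A$2$2 :: 'a::field)"
  by (simp add: vec_eq_iff forall_2 matrix_matrix_mult_def sum_2)

lemma mult_mat2:
  "A ** mat2 a b c d = mat2 (A$1$1 * a + A$1$2 * c) (A$1$1 * b + A$1$2 * d)
     (A$2$1 * a + A$2$2 * c) (A$2$1 * b + A$2$2 * d :: 'a::field)"
  by (simp add: vec_eq_iff forall_2 matrix_matrix_mult_def sum_2)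

lemma mat_1_eq: "mat 1 = mat2 1 0 0 (1 :: 'a::field)"
  by (simp add: vec_eq_iff forall_2 mat_def)

lemma mat2_det_mult:
  "mat2 a b c d ** mat2 d (- b) (- c) a = mat (a * d - b * c :: 'a::field)"
  "mat2 d (- b) (- c) a ** mat2 a b c d = mat (a * d - b * c :: 'a::field)"
  by (simp_all add: vec_eq_iff forall_2 matrix_matrix_mult_def sum_2 mat_def algebra_simps)

lemma invertible_mat2:
  assumes "a * d - b * c \<noteq> (0 :: 'a::field)" shows "invertible (mat2 a b c d)"
  unfolding invertible_def
proof (intro exI conjI)
  let ?u = "inverse (a * d - b * c)"
  show "mat2 a b c d ** (mat ?u ** mat2 d (- b) (- c) a) = mat 1"
    using assms by (simp add: matrix_mul_assoc times_mat[where A = "mat2 a b c d"])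
      (simp add: mat2_det_mult mat_mult_mat flip: matrix_mul_assoc)
  show "(mat ?u ** mat2 d (- b) (- c) a) ** mat2 a b c d = mat 1"
    using assms by (simp add: mat2_det_mult mat_mult_mat flip: matrix_mul_assoc)
qed

lemma invertible_mat_1: "invertible (mat 1 :: 'a::field ^ 2 ^ 2)"
  unfolding mat_1_eq by (rule invertible_mat2) simp

text \<open>The translation adds \<open>c\<close> to \<open>y\<close> and keeps the coordinate in
  \<open>C\<close>. The coordinates in \<open>D\<close> and \<open>D'\<close> are divided by
  \<open>u = 1 + c * y'\<close>, that in \<open>C'\<close> by its square. As \<open>u\<close> is
  within \<open>e\<close> of 1, padded sets absorb these factors.\<close>

lemma lower_unipotent_pbox:
  assumes AB: "(A, B) \<in> pbox b p q C C' D D'"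
    and padded: "padded e C" "padded e C'" "padded e D" "padded e D'"
    and q: "0 \<le> q" "q < 1" "absval c \<le> 1" "absval c * q \<le> e" "e < 1"
  shows "lract (mat2 1 0 c 1) (mat 1) (A, B) \<in> pbox (b + c) p q C C' D D'"
proof -
  let ?x = "A$1$2 / A$1$1" and ?y = "A$2$1 / A$1$1" and ?z = "A$2$2 / A$1$1"
  let ?x' = "B$1$2 / B$2$1" and ?y' = "B$1$1 / B$2$1" and ?z' = "B$2$2 / B$2$1"
  have nz: "A$1$1 \<noteq> 0" "B$2$1 \<noteq> 0"
    and h: "absval (?y - b) \<le> p" "absval ?y' \<le> q" "?z - ?x * ?y \<in> C" "?x' - ?y' * ?z' \<in> C'"
    "?x - ?y' * ?z \<in> D" "?z' - ?y * ?x' \<in> D'"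
    using AB unfolding pbox_def chart_def mem_Collect_eq prod.case by blast+
  define u where "u = 1 + c * ?y'"
  have u1: "absval (u - 1) \<le> e"
    using absval_mult_le[of c "absval c" ?y' q] h(2) q by (simp add: u_def)
  then have u: "absval u = 1" using q(5) by (intro absval_unit) simp
  then have u0: "u \<noteq> 0" by auto
  have eB: "c * B$1$1 + B$2$1 = u * B$2$1" "c * B$1$2 + B$2$2 = (?z' + c * ?x') * B$2$1"
    "c * A$1$1 + A$2$1 = (?y + c) * A$1$1" "c * A$1$2 + A$2$2 = (?z + c * ?x) * A$1$1"
    using nz by (simp_all add: u_def field_simps)
  have C: "(?z + c * ?x) - ?x * (?y + c) = ?z - ?x * ?y" by (simp add: algebra_simps)
  have C': "?x' / u - (?y' / u) * ((?z' + c * ?x') / u) = (?x' - ?y' * ?z') / u / u"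
  proof -
    have "?x' / u - (?y' / u) * ((?z' + c * ?x') / u) = (?x' * u - ?y' * (?z' + c * ?x')) / u / u"
      using u0 by (simp add: diff_divide_distrib)
    also have "?x' * u - ?y' * (?z' + c * ?x') = ?x' - ?y' * ?z'"
      by (simp add: u_def algebra_simps)
    finally show ?thesis .
  qed
  have D: "?x - (?y' / u) * (?z + c * ?x) = (?x - ?y' * ?z) / u"
  proof -
    have "?x - (?y' / u) * (?z + c * ?x) = (?x * u - ?y' * (?z + c * ?x)) / u"
      using u0 by (simp add: diff_divide_distrib)
    also have "?x * u - ?y' * (?z + c * ?x) = ?x - ?y' * ?z"
      by (simp add: u_def algebra_simps)
    finally show ?thesis .
  qed
  have D': "(?z' + c * ?x') / u - (?y + c) * (?x' / u) = (?z' - ?y * ?x') / u"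
    using u0 by (simp add: diff_divide_distrib add_divide_distrib algebra_simps)
  have "(?z + c * ?x) - ?x * (?y + c) \<in> C" unfolding C by (rule h)
  moreover have "?x' / u - (?y' / u) * ((?z' + c * ?x') / u) \<in> C'"
    unfolding C' by (intro padded_divide[OF padded(2)] h u1 q)
  moreover have "?x - (?y' / u) * (?z + c * ?x) \<in> D"
    unfolding D by (intro padded_divide[OF padded(3)] h u1 q)
  moreover have "(?z' + c * ?x') / u - (?y + c) * (?x' / u) \<in> D'"
    unfolding D' by (intro padded_divide[OF padded(4)] h u1 q)
  moreover have "absval (?y' / u) \<le> q" using h(2) u by (simp add: absval_divide absval_mult)
  moreover have "absval (?y + c - (b + c)) \<le> p" using h(1) by simp
  moreover have "B$1$1 / (u * B$2$1) = ?y' / u" "B$1$2 / (u * B$2$1) = ?x' / u"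
    "(?z' + c * ?x') * B$2$1 / (u * B$2$1) = (?z' + c * ?x') / u"
    "(?y + c) * A$1$1 / A$1$1 = ?y + c" "(?z + c * ?x) * A$1$1 / A$1$1 = ?z + c * ?x"
    using nz u0 by simp_all
  ultimately show ?thesis
    using nz u0 by (simp only: pbox_def chart_def lract_simp matrix_mul_rid mat2_mult mat2_nth
        mult_1 mult_zero_left add_0_right add_0_left eB mem_Collect_eq prod.case) simp
qed

lemma lower_unipotent_vimage:
  assumes padded: "padded e C" "padded e C'" "padded e D" "padded e D'"
    and q: "0 \<le> q" "q < 1" "absval c \<le> 1" "absval c * q \<le> e" "e < 1"
  shows "lract (mat2 1 0 c 1) (mat 1) -` pbox (b + c) p q C C' D D' = pbox b p q C C' D D'"
proof (intro equalityI subsetI)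
  fix w assume w: "w \<in> lract (mat2 1 0 c 1) (mat 1) -` pbox (b + c) p q C C' D D'"
  obtain A B where AB: "w = (A, B)" by (cases w)
  have *: "mat2 1 0 (- c) 1 ** (mat2 1 0 c 1 ** X) = X" for X :: "'a ^ 2 ^ 2"
    by (simp add: mat2_mult vec_eq_iff forall_2)
  have "lract (mat2 1 0 (- c) 1) (mat 1) (mat2 1 0 c 1 ** A, mat2 1 0 c 1 ** B) \<in>
      pbox (b + c + - c) p q C C' D D'"
    by (rule lower_unipotent_pbox[OF _ padded]) (use w AB q in auto)
  then show "w \<in> pbox b p q C C' D D'" by (simp add: AB *)
next
  fix w assume "w \<in> pbox b p q C C' D D'"
  then show "w \<in> lract (mat2 1 0 c 1) (mat 1) -` pbox (b + c) p q C C' D D'"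
    using lower_unipotent_pbox[OF _ padded q] by (cases w) auto
qed

text \<open>The matrix \<open>mat2 1 0 0 t\<close> multiplies \<open>y\<close> and the coordinate in
  \<open>C\<close> by \<open>t\<close>, divides \<open>y'\<close> and the coordinate in
  \<open>C'\<close> by \<open>t\<close>, and fixes the other two. The product of the radii of
  \<open>y\<close> and \<open>y'\<close> is preserved.\<close>

lemma torus_vimage:
  assumes "t \<noteq> 0"
  shows "lract (mat2 1 0 0 t) (mat 1) -` pbox 0 (absval t * p) (q / absval t) C C' D D' =
    pbox 0 p q {c. t * c \<in> C} {c. c / t \<in> C'} D D'"
proof -
  have "(A, B) \<in> lract (mat2 1 0 0 t) (mat 1) -` pbox 0 (absval t * p) (q / absval t) C C' D D' \<longleftrightarrow>
    (A, B) \<in> pbox 0 p q {c. t * c \<in> C} {c. c / t \<in> C'} D D'" for A B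
  proof (cases "A$1$1 = 0 \<or> B$2$1 = 0")
    case False
    let ?x = "A$1$2 / A$1$1" and ?y = "A$2$1 / A$1$1" and ?z = "A$2$2 / A$1$1"
    let ?x' = "B$1$2 / B$2$1" and ?y' = "B$1$1 / B$2$1" and ?z' = "B$2$2 / B$2$1"
    have "absval (t * A$2$1 / A$1$1) \<le> absval t * p \<longleftrightarrow> absval ?y \<le> p"
      using assms by (simp add: absval_mult absval_divide flip: times_divide_eq_right)
    moreover have "absval (B$1$1 / (t * B$2$1)) \<le> q / absval t \<longleftrightarrow> absval ?y' \<le> q"
      using assms False by (simp add: absval_mult absval_divide field_simps)
    moreover have "t * A$2$2 / A$1$1 - ?x * (t * A$2$1 / A$1$1) = t * (?z - ?x * ?y)"
      by (simp add: algebra_simps)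
    moreover have "B$1$2 / (t * B$2$1) - B$1$1 / (t * B$2$1) * (t * B$2$2 / (t * B$2$1)) =
        (?x' - ?y' * ?z') / t"
      using assms False by (simp add: field_simps)
    moreover have "?x - B$1$1 / (t * B$2$1) * (t * A$2$2 / A$1$1) = ?x - ?y' * ?z"
      using assms False by (simp add: field_simps)
    moreover have "t * B$2$2 / (t * B$2$1) - t * A$2$1 / A$1$1 * (B$1$2 / (t * B$2$1)) = ?z' - ?y * ?x'"
      using assms False by (simp add: field_simps)
    ultimately show ?thesis
      using assms False by (simp add: pbox_def chart_def mat2_mult del: times_divide_eq_left
          times_divide_eq_right divide_divide_eq_left mult_divide_mult_cancel_left_if)
  qed (use assms in \<open>auto simp: pbox_def chart_def mat2_mult\<close>)
  then show ?thesis by auto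
qed

text \<open>After the swap, exchanging the two rows returns to the same chart with primed and
  unprimed coordinates interchanged.\<close>

lemma swap_pbox:
  "prod.swap -` pbox 0 p q C C' D D' = lract (mat2 0 1 1 0) (mat 1) -` pbox 0 q p C' C D' D"
  by (auto simp: pbox_def chart_def mat2_mult mult.commute)

lemma neg_pbox:
  "lract (mat2 1 0 0 (- 1)) (mat2 1 0 0 (- 1)) -` pbox 0 p q C C' D D' =
    pbox 0 p q C C' (uminus -` D) (uminus -` D')"
  by (auto simp: pbox_def chart_def mat2_mult mult_mat2)

text \<open>The coordinates in \<open>C\<close> and \<open>C'\<close> are unchanged. Those in
  \<open>D\<close> and \<open>D'\<close> are shifted by \<open>c\<close> up to the error
  \<open>c * y * y'\<close>, which is at most \<open>p * q\<close> and is absorbed by the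
  padding.\<close>

lemma column_shift_pbox:
  assumes padded: "padded e D" "padded e D'" and "p * q \<le> e" "0 \<le> p" "absval c \<le> 1"
  shows "lract (mat 1) (mat2 1 c 0 1) -` pbox 0 p q C C' D D' =
    pbox 0 p q C C' {v. v + c \<in> D} {v. v + c \<in> D'}"
proof -
  have "(A, B) \<in> lract (mat 1) (mat2 1 c 0 1) -` pbox 0 p q C C' D D' \<longleftrightarrow>
    (A, B) \<in> pbox 0 p q C C' {v. v + c \<in> D} {v. v + c \<in> D'}" for A B
  proof (cases "A$1$1 \<noteq> 0 \<and> B$2$1 \<noteq> 0 \<and> absval (A$2$1 / A$1$1) \<le> p \<and> absval (B$1$1 / B$2$1) \<le> q")
    case True
    let ?x = "A$1$2 / A$1$1" and ?y = "A$2$1 / A$1$1" and ?z = "A$2$2 / A$1$1"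
    let ?x' = "B$1$2 / B$2$1" and ?y' = "B$1$1 / B$2$1" and ?z' = "B$2$2 / B$2$1"
    have "absval (?y * ?y') \<le> p * q" using True by (intro absval_mult_le) auto
    then have small: "absval (c * (?y * ?y')) \<le> e"
      using absval_mult_le_right[OF assms(5)] assms(3) by (meson order_trans)
    have st: "v - c * (?y * ?y') \<in> E \<longleftrightarrow> v \<in> E" if "padded e E" for v E
      using paddedD[OF that, of v "v - c * (?y * ?y')"] paddedD[OF that, of "v - c * (?y * ?y')" v] small
      by auto
    have "(A$1$1 * c + A$1$2) / A$1$1 = ?x + c" "(A$2$1 * c + A$2$2) / A$1$1 = ?z + c * ?y"
      "(B$1$1 * c + B$1$2) / B$2$1 = ?x' + c * ?y'" "(B$2$1 * c + B$2$2) / B$2$1 = ?z' + c"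
      using True by (simp_all add: field_simps)
    moreover have "?z + c * ?y - (?x + c) * ?y = ?z - ?x * ?y"
      "?x' + c * ?y' - ?y' * (?z' + c) = ?x' - ?y' * ?z'"
      "?x + c - ?y' * (?z + c * ?y) = ?x - ?y' * ?z + c - c * (?y * ?y')"
      "?z' + c - ?y * (?x' + c * ?y') = ?z' - ?y * ?x' + c - c * (?y * ?y')"
      by (simp_all add: algebra_simps)
    ultimately show ?thesis
      using True st[OF padded(1)] st[OF padded(2)]
      by (simp only: pbox_def chart_def lract_simp matrix_mul_lid mult_mat2 mat2_nth
          mult_1_right mult_zero_right add_0_right add_0_left mem_Collect_eq prod.case vimage_eq)
  qed (auto simp: pbox_def chart_def mult_mat2)
  then show ?thesis by auto
qed

lemma pbox_iff:
  "(A, B) \<in> pbox b p q C C' D D' \<longleftrightarrow> A$1$1 \<noteq> 0 \<and> B$2$1 \<noteq> 0 \<and>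
     absval (A$2$1 / A$1$1 - b) \<le> p \<and> absval (B$1$1 / B$2$1) \<le> q \<and>
     A$2$2 / A$1$1 - A$1$2 / A$1$1 * (A$2$1 / A$1$1) \<in> C \<and>
     B$1$2 / B$2$1 - B$1$1 / B$2$1 * (B$2$2 / B$2$1) \<in> C' \<and>
     A$1$2 / A$1$1 - B$1$1 / B$2$1 * (A$2$2 / A$1$1) \<in> D \<and>
     B$2$2 / B$2$1 - A$2$1 / A$1$1 * (B$1$2 / B$2$1) \<in> D'"
  unfolding pbox_def chart_def mem_Collect_eq prod.case ..

section \<open>Discs and their subdivision\<close>

abbreviation disc :: "'a::nonarch_local_field \<Rightarrow> real \<Rightarrow> 'a set" where
  "disc c r \<equiv> {v. absval (v - c) \<le> r}"

lemma padded_disc: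
  assumes "absval c \<le> 1" "r \<le> 1" "e \<le> r" shows "padded e (disc c r)"
  unfolding padded_def
proof (intro ballI conjI allI impI)
  fix v assume v: "v \<in> disc c r"
  show "absval v \<le> 1" using absval_add_le[of "v - c" 1 c] v assms by simp
  show "w \<in> disc c r" if "absval (w - v) \<le> e" for w
    using absval_diff_trans[of w v r c] v that assms by simp
qed

lemma disc_eq: "absval (c - d) \<le> r \<Longrightarrow> disc c r = disc d r"
  using absval_diff_trans[of _ c r d] absval_diff_trans[of _ d r c]
  by (auto simp: absval_minus_commute[of d])

lemma disc_scale:
  assumes "t \<noteq> 0"
  shows "{v. t * v \<in> disc c r} = disc (c / t) (r / absval t)"
    "{v. v / t \<in> disc c r} = disc (t * c) (r * absval t)"
proof -
  have "t * v - c = t * (v - c / t)" "v / t - c = (v - t * c) / t" for v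
    using assms by (simp_all add: field_simps)
  then show "{v. t * v \<in> disc c r} = disc (c / t) (r / absval t)"
    "{v. v / t \<in> disc c r} = disc (t * c) (r * absval t)"
    using assms by (simp_all add: absval_mult absval_divide field_simps)
qed

text \<open>These are the cosets of \<open>s t O\<close> inside \<open>c + s O\<close>, indexed by
  the transversal \<open>R\<close> of \<open>O / t O\<close>.\<close>

lemma disc_split:
  assumes "residue_reps (absval t) R" "s \<noteq> 0" "absval t \<le> 1"
  shows "disc c (absval s) = (\<Union>r\<in>R. disc (c + s * r) (absval s * absval t))"
    and "r \<in> R \<Longrightarrow> r' \<in> R \<Longrightarrow> r \<noteq> r' \<Longrightarrow>
      disc (c + s * r) (absval s * absval t) \<inter> disc (c + s * r') (absval s * absval t) = {}"
proof -
  have eq: "absval (v - (c + s * r)) \<le> absval s * absval t \<longleftrightarrow> absval ((v - c) / s - r) \<le> absval t" for v r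
  proof -
    have "v - (c + s * r) = s * ((v - c) / s - r)" using assms(2) by (simp add: field_simps)
    then show ?thesis using assms(2) by (simp add: absval_mult)
  qed
  have R: "\<And>r. r \<in> R \<Longrightarrow> absval r \<le> 1"
    "\<And>x. absval x \<le> 1 \<Longrightarrow> \<exists>r\<in>R. absval (x - r) \<le> absval t"
    "\<And>r s. r \<in> R \<Longrightarrow> s \<in> R \<Longrightarrow> absval (r - s) \<le> absval t \<Longrightarrow> r = s"
    using assms(1) by (auto simp: residue_reps_def)
  have eq1: "absval (v - c) \<le> absval s \<longleftrightarrow> absval ((v - c) / s) \<le> 1" for v
    using assms(2) by (simp add: absval_divide)
  have "absval ((v - c) / s) \<le> 1 \<longleftrightarrow> (\<exists>r\<in>R. absval ((v - c) / s - r) \<le> absval t)" for v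
  proof
    assume "\<exists>r\<in>R. absval ((v - c) / s - r) \<le> absval t"
    then obtain r where "r \<in> R" "absval ((v - c) / s - r) \<le> absval t" ..
    then show "absval ((v - c) / s) \<le> 1"
      using absval_add_le[of "(v - c) / s - r" 1 r] R(1)[of r] assms(3) by simp
  qed (rule R(2))
  then show "disc c (absval s) = (\<Union>r\<in>R. disc (c + s * r) (absval s * absval t))"
    unfolding eq eq1 by blast
  show "disc (c + s * r) (absval s * absval t) \<inter> disc (c + s * r') (absval s * absval t) = {}"
    if r: "r \<in> R" "r' \<in> R" "r \<noteq> r'"
  proof (rule ccontr)
    assume "\<not> ?thesis"
    then obtain v where "absval ((v - c) / s - r) \<le> absval t" "absval ((v - c) / s - r') \<le> absval t"
      unfolding eq by blast
    then have "absval (r - r') \<le> absval t"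
      using absval_diff_trans[of r "(v - c) / s" "absval t" r'] by (simp add: absval_minus_commute)
    then show False using R(3)[OF r(1,2)] r(3) by blast
  qed
qed

section \<open>Effect of unipotent and torus translations on the measure of a box\<close>

context invariant_measure
begin

text \<open>The ball of \<open>y\<close> splits into \<open>card R\<close> smaller balls with
  centres \<open>s * r\<close>. The lower unipotent matrix with entry \<open>s * r\<close> moves the
  central subbox to the one over that centre, so all parts have equal measure.\<close>

lemma m_pbox_refine:
  fixes s t :: 'a and R :: "'a set"
  assumes s: "s \<noteq> 0" "absval s < 1" and t: "t \<noteq> 0" "absval t \<le> 1" and R: "residue_reps (absval t) R"
    and q: "0 < q" "q < 1" and e: "absval s * q \<le> e" "e < 1"
    and padded: "padded e C" "padded e C'" "padded e D" "padded e D'"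
  shows "m (pbox 0 (absval s) q C C' D D') =
    of_nat (card R) * m (pbox 0 (absval s * absval t) q C C' D D')"
proof -
  let ?U = "\<lambda>r. pbox (s * r) (absval s * absval t) q C C' D D'"
  have fin: "finite R" and R1: "\<And>r. r \<in> R \<Longrightarrow> absval r \<le> 1"
    using R by (auto simp: residue_reps_def)
  have e0: "0 < e" using s q e by (metis absval_gt_0_iff less_le_trans mult_pos_pos)
  have st: "0 < absval s * absval t" "absval s * absval t < 1"
    using s t absval_mult_less_left[OF s(2) t(2)] by (simp_all add: absval_mult)
  have cl: "clop (?U r)" if "r \<in> R" for r
    using s st q e0 padded absval_mult_less_left[OF s(2) R1[OF that]] by (intro clop_pbox) auto
  have U: "pbox 0 (absval s) q C C' D D' = (\<Union>r\<in>R. ?U r)"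
    using disc_split(1)[OF R s(1) t(2), of 0] by (auto simp: pbox_iff set_eq_iff)
  have "m (\<Union>r\<in>R. ?U r) = (\<Sum>r\<in>R. m (?U r))"
  proof (rule m_UN[OF fin cl])
    fix r r' assume "r \<in> R" "r' \<in> R" "r \<noteq> r'"
    then show "?U r \<inter> ?U r' = {}"
      using disc_split(2)[OF R s(1) t(2), of r r' 0] by (auto simp: pbox_iff disjoint_iff)
  qed
  also have "m (?U r) = m (pbox 0 (absval s * absval t) q C C' D D')" if "r \<in> R" for r
  proof -
    have sr: "absval (s * r) \<le> absval s" using R1[OF that] by (simp add: absval_mult mult_left_le)
    have "absval (s * r) * q \<le> e"
      using order_trans[OF mult_right_mono[OF sr, of q] e(1)] q by simp
    then show ?thesis
      using m_lract[OF cl[OF that], of "mat2 1 0 (s * r) 1" "mat 1"] sr s q e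
        lower_unipotent_vimage[OF padded, of q "s * r" 0]
      by (simp add: invertible_mat2 invertible_mat_1)
  qed
  then have "(\<Sum>r\<in>R. m (?U r)) = of_nat (card R) * m (pbox 0 (absval s * absval t) q C C' D D')"
    by simp
  finally show ?thesis unfolding U .
qed

lemma m_swap_pbox:
  assumes "clop (pbox 0 q p C' C D' D)"
  shows "m (prod.swap -` pbox 0 p q C C' D D') = m (pbox 0 q p C' C D' D)"
  unfolding swap_pbox using assms by (intro m_lract invertible_mat2) (simp_all add: invertible_mat_1)

text \<open>Refinement in \<open>y'\<close> is refinement in \<open>y\<close> for the swapped
  measure, which is invariant as well.\<close>

lemma m_pbox_refine2:
  fixes s t :: 'a and R :: "'a set"
  assumes s: "s \<noteq> 0" "absval s < 1" and t: "t \<noteq> 0" "absval t \<le> 1" and R: "residue_reps (absval t) R"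
    and p: "0 < p" "p < 1" and e: "absval s * p \<le> e" "e < 1"
    and padded: "padded e C" "padded e C'" "padded e D" "padded e D'"
  shows "m (pbox 0 p (absval s) C C' D D') =
    of_nat (card R) * m (pbox 0 p (absval s * absval t) C C' D D')"
proof -
  interpret s: invariant_measure "\<lambda>U. m (prod.swap -` U)" by (rule invariant_measure_swap)
  have e0: "0 < e" using s p e by (metis absval_gt_0_iff less_le_trans mult_pos_pos)
  have st: "0 < absval s * absval t" "absval s * absval t < 1"
    using s t absval_mult_less_left[OF s(2) t(2)] by (simp_all add: absval_mult)
  have "clop (pbox 0 p (absval s) C C' D D')" "clop (pbox 0 p (absval s * absval t) C C' D D')"
    using s st p e0 padded by (auto intro!: clop_pbox[where e = e])
  then show ?thesis
    using s.m_pbox_refine[OF s t R p e padded(2,1,4,3)] by (simp add: m_swap_pbox)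
qed

text \<open>The torus element turns the radii (|s|, |s|) into (|t s|, |s / t|). Refining
  \<open>y'\<close> in the new box and \<open>y\<close> in the box of radii (|s|, |s|) leads to the
  same box of radii (|t s|, |s|), with the same factor \<open>card R\<close>. The hypothesis |s| <
  |t| keeps the radius |s / t| below 1.\<close>

lemma m_pbox_torus:
  fixes s t :: 'a
  assumes s: "s \<noteq> 0" "absval s < 1" and t: "t \<noteq> 0" "absval t \<le> 1" "absval s < absval t"
    and e: "absval s * absval s \<le> e" "e < 1"
    and padded: "padded e C" "padded e C'" "padded e D" "padded e D'"
  shows "m (pbox 0 (absval s) (absval s) {c. t * c \<in> C} {c. c / t \<in> C'} D D') =
    m (pbox 0 (absval s) (absval s) C C' D D')"
proof -
  obtain R :: "'a set" where R: "residue_reps (absval t) R" using ex_residue_reps[of "absval t"] t by auto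
  have e0: "0 < e" using s e by (metis absval_gt_0_iff less_le_trans mult_pos_pos)
  have st: "0 < absval t * absval s" "absval t * absval s < 1" "absval s / absval t < 1"
    using s t absval_mult_less_right[OF t(2) s(2)] by (simp_all add: absval_mult)
  let ?W = "pbox 0 (absval t * absval s) (absval s / absval t) C C' D D'"
  have "clop ?W" using s t st e0 padded by (intro clop_pbox) auto
  then have "m (pbox 0 (absval s) (absval s) {c. t * c \<in> C} {c. c / t \<in> C'} D D') = m ?W"
    unfolding torus_vimage[OF t(1), symmetric] using t
    by (intro m_lract invertible_mat2) (simp_all add: invertible_mat_1)
  also have "\<dots> = of_nat (card R) * m (pbox 0 (absval t * absval s) (absval s) C C' D D')"
    using m_pbox_refine2[of "s / t", OF _ _ t(1,2) R st(1,2) _ e(2) padded] s t st e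
    by (simp add: absval_divide)
  also have "\<dots> = m (pbox 0 (absval s) (absval s) C C' D D')"
    using m_pbox_refine[OF s t(1,2) R _ s(2) e padded] s by (simp add: mult.commute)
  finally show ?thesis .
qed

section \<open>The measure on the slice and its symmetry\<close>

context
  fixes s :: 'a and D D' :: "'a set"
  assumes s: "s \<noteq> 0" "absval s < 1"
    and padded_D: "padded (absval s * absval s) D" "padded (absval s * absval s) D'"
begin

definition slice :: "'a set \<Rightarrow> 'a set \<Rightarrow> complex" where
  "slice C C' = m (pbox 0 (absval s) (absval s) C C' D D')"

private lemma s2: "0 < absval s * absval s" "absval s * absval s < 1" "absval s * absval s \<le> absval s"
  using s absval_mult_less_right[of s s 1] by (simp_all add: absval_mult mult_left_le)

lemma slice_UN:
  assumes "finite I" "\<And>i. i \<in> I \<Longrightarrow> padded (absval s * absval s) (C i)"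
    and "\<And>i j. i \<in> I \<Longrightarrow> j \<in> I \<Longrightarrow> i \<noteq> j \<Longrightarrow> C i \<inter> C j = {}"
    and "padded (absval s * absval s) X"
  shows "slice (\<Union>i\<in>I. C i) X = (\<Sum>i\<in>I. slice (C i) X)"
    and "slice X (\<Union>i\<in>I. C i) = (\<Sum>i\<in>I. slice X (C i))"
proof -
  have "pbox 0 (absval s) (absval s) (\<Union>i\<in>I. C i) X D D' =
      (\<Union>i\<in>I. pbox 0 (absval s) (absval s) (C i) X D D')"
    "pbox 0 (absval s) (absval s) X (\<Union>i\<in>I. C i) D D' =
      (\<Union>i\<in>I. pbox 0 (absval s) (absval s) X (C i) D D')"
    by (auto simp: pbox_iff simp del: times_divide_eq_left times_divide_eq_right)
  moreover have "clop (pbox 0 (absval s) (absval s) (C i) X D D')"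
      "clop (pbox 0 (absval s) (absval s) X (C i) D D')" if "i \<in> I" for i
    using assms(2)[OF that] assms(4) s s2 padded_D
    by (auto intro!: clop_pbox[where e = "absval s * absval s"])
  moreover have "pbox 0 (absval s) (absval s) (C i) X D D' \<inter> pbox 0 (absval s) (absval s) (C j) X D D' = {}"
     "pbox 0 (absval s) (absval s) X (C i) D D' \<inter> pbox 0 (absval s) (absval s) X (C j) D D' = {}"
    if "i \<in> I" "j \<in> I" "i \<noteq> j" for i j
    using assms(3)[OF that] by (auto simp: pbox_iff disjoint_iff
        simp del: times_divide_eq_left times_divide_eq_right)
  ultimately show "slice (\<Union>i\<in>I. C i) X = (\<Sum>i\<in>I. slice (C i) X)"
    and "slice X (\<Union>i\<in>I. C i) = (\<Sum>i\<in>I. slice X (C i))"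
    using assms(1) by (simp_all add: slice_def m_UN)
qed

lemma slice_torus:
  assumes t: "t \<noteq> 0" "absval t \<le> 1" "absval s < absval t" and "absval c \<le> 1" "absval c' \<le> 1"
    and r: "absval s * absval s \<le> r" "r \<le> 1" "absval s * absval s \<le> r'" "r' \<le> 1"
  shows "slice (disc (c / t) (r / absval t)) (disc (t * c') (r' * absval t)) =
    slice (disc c r) (disc c' r')"
  using m_pbox_torus[OF s t order_refl s2(2), of "disc c r" "disc c' r'" D D'] assms padded_D
  by (simp only: slice_def disc_scale[OF t(1)] padded_disc)

text \<open>Since the radii are proportional to the centres, one torus element carries the first
  disc to the second and the second to the first: \<open>c' / c\<close> if
  \<open>absval c' \<le> absval c\<close>, and its inverse otherwise. The lower bounds on the
  centres make its parameter larger than |s| and both radii at least |s|^2.\<close>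

lemma slice_sym_discs:
  assumes c: "absval s < absval c" "absval c \<le> 1" "absval s < absval c'" "absval c' \<le> 1"
  shows "slice (disc c (absval s * absval c)) (disc c' (absval s * absval c')) =
    slice (disc c' (absval s * absval c')) (disc c (absval s * absval c))"
proof -
  have *: "slice (disc c (absval s * absval c)) (disc c' (absval s * absval c')) =
    slice (disc c' (absval s * absval c')) (disc c (absval s * absval c))"
    if c: "absval s < absval c" "absval c \<le> 1" "absval s < absval c'" "absval c' \<le> absval c" for c c'
  proof -
    have nz: "c \<noteq> 0" "c' \<noteq> 0" using c s absval_ge_0[of s] by auto
    have "absval s * absval c \<le> absval s" using c by (simp add: mult_left_le)
    then have "absval s < absval (c' / c)"
      using c(3) nz by (simp add: absval_divide less_divide_eq)
    moreover have "absval s * absval c \<le> 1" "absval s * absval c' \<le> 1"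
      using c s by (auto intro!: mult_le_one)
    ultimately show ?thesis
      using slice_torus[of "c' / c" c' c "absval s * absval c'" "absval s * absval c"] nz c
      by (simp add: absval_divide mult_left_mono)
  qed
  show ?thesis
    using *[of c c'] *[of c' c] c by (cases "absval c' \<le> absval c") auto
qed

text \<open>All points of the disc around \<open>c\<close> have absolute value |c|, because |c| >
  |s|. So it splits into discs of relative radius |s|, likewise the disc around \<open>c'\<close>,
  and \<open>slice_sym_discs\<close> applies to each product of parts.\<close>

lemma slice_sym_nonzero:
  assumes c: "absval s < absval c" "absval c \<le> 1" "absval s < absval c'" "absval c' \<le> 1"
  shows "slice (disc c (absval s)) (disc c' (absval s)) = slice (disc c' (absval s)) (disc c (absval s))"
proof -
  have nz: "c \<noteq> 0" "c' \<noteq> 0" using c absval_ge_0[of s] by auto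
  obtain R R' :: "'a set" where R: "residue_reps (absval c) R" "residue_reps (absval c') R'"
    using ex_residue_reps nz by (meson absval_gt_0_iff)
  have fin: "finite R" "finite R'" using R by (auto simp: residue_reps_def)
  let ?C = "\<lambda>r. disc (c + s * r) (absval s * absval c)"
  let ?C' = "\<lambda>r. disc (c' + s * r) (absval s * absval c')"
  have abs: "absval (c + s * r) = absval c" if "r \<in> R" for r
  proof -
    have "absval (s * r) < absval c" using that R c(1)
      by (metis absval_mult_le_left le_less_trans order_refl residue_reps_def)
    then show ?thesis by (rule absval_add_eq)
  qed
  have abs': "absval (c' + s * r) = absval c'" if "r \<in> R'" for r
  proof -
    have "absval (s * r) < absval c'" using that R c(3)
      by (metis absval_mult_le_left le_less_trans order_refl residue_reps_def)
    then show ?thesis by (rule absval_add_eq)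
  qed
  have le: "absval s * absval c \<le> 1" "absval s * absval c' \<le> 1"
    using c s by (auto intro!: mult_le_one)
  have pad: "padded (absval s * absval s) (?C r)" if "r \<in> R" for r
    using abs[OF that] c le by (intro padded_disc) (auto intro: mult_left_mono)
  have pad': "padded (absval s * absval s) (?C' r)" if "r \<in> R'" for r
    using abs'[OF that] c le by (intro padded_disc) (auto intro: mult_left_mono)
  have pads: "padded (absval s * absval s) (disc c (absval s))" "padded (absval s * absval s) (disc c' (absval s))"
    using c s s2 by (auto intro!: padded_disc)
  have d: "disc c (absval s) = (\<Union>r\<in>R. ?C r)" "disc c' (absval s) = (\<Union>r\<in>R'. ?C' r)"
    using disc_split(1)[OF R(1) s(1) c(2)] disc_split(1)[OF R(2) s(1) c(4)] by auto
  note dj = disc_split(2)[OF R(1) s(1) c(2)] disc_split(2)[OF R(2) s(1) c(4)]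
  have "slice (disc c (absval s)) (disc c' (absval s)) = (\<Sum>r\<in>R. slice (?C r) (disc c' (absval s)))"
    unfolding d(1) by (intro slice_UN(1) fin pad dj(1) pads)
  also have "\<dots> = (\<Sum>r\<in>R. \<Sum>r'\<in>R'. slice (?C r) (?C' r'))"
    unfolding d(2) by (intro sum.cong refl slice_UN(2) fin pad' dj(2) pad)
  also have "\<dots> = (\<Sum>r\<in>R. \<Sum>r'\<in>R'. slice (?C' r') (?C r))"
  proof (intro sum.cong refl)
    fix r r' assume "r \<in> R" "r' \<in> R'"
    then show "slice (?C r) (?C' r') = slice (?C' r') (?C r)"
      using slice_sym_discs[of "c + s * r" "c' + s * r'"] abs abs' c by simp
  qed
  also have "\<dots> = (\<Sum>r\<in>R. slice (disc c' (absval s)) (?C r))"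
    unfolding d(2) by (intro sum.cong refl slice_UN(1)[symmetric] fin pad' dj(2) pad)
  also have "\<dots> = slice (disc c' (absval s)) (disc c (absval s))"
    unfolding d(1) by (intro slice_UN(2)[symmetric] fin pad dj(1) pads)
  finally show ?thesis .
qed

text \<open>The torus element \<open>s / a\<close> exchanges the two radii. Its absolute value
  exceeds |s| exactly because |a| < 1, whence the strict bound here and in
  \<open>slice_sym_zero\<close>.\<close>

lemma slice_sym_balls:
  fixes a :: 'a
  assumes "absval s \<le> absval a" "absval a < 1"
  shows "slice (disc 0 (absval s)) (disc 0 (absval a)) = slice (disc 0 (absval a)) (disc 0 (absval s))"
proof -
  have a: "a \<noteq> 0" using assms s by auto
  have "absval s * absval a < absval s" using s assms by simp
  then have "absval s < absval (s / a)" using a by (simp add: absval_divide less_divide_eq)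
  then show ?thesis
    using slice_torus[of "s / a" 0 0 "absval s" "absval a"] s s2 a assms
    by (simp add: absval_divide)
qed

text \<open>
  For fixed \<open>\<bar>c\<bar>\<close> the skew part of \<open>slice (disc 0 \<bar>s\<bar>) (disc c \<bar>s\<bar>)\<close> does not depend on \<open>c\<close>,
  and its sum over the sphere is a difference of two symmetric terms.
\<close>

lemma slice_sym_zero:
  assumes c: "absval s < absval c" "absval c < 1"
  shows "slice (disc 0 (absval s)) (disc c (absval s)) = slice (disc c (absval s)) (disc 0 (absval s))"
proof -
  define \<delta> where "\<delta> X = slice (disc 0 (absval s)) X - slice X (disc 0 (absval s))" for X
  have nz: "c \<noteq> 0" using c absval_ge_0[of s] by auto
  obtain p :: 'a where p: "0 < absval p" "absval p < 1"
    and pm: "\<And>x :: 'a. absval x < 1 \<Longrightarrow> absval x \<le> absval p"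
    using absval_uniformizer by blast
  have sc: "absval (s / c) < 1" using c nz by (simp add: absval_divide)
  obtain R :: "'a set" where R: "residue_reps (absval (s / c)) R"
    using ex_residue_reps[of "absval (s / c)"] nz s by auto
  have fin: "finite R" and R1: "\<And>r. r \<in> R \<Longrightarrow> absval r \<le> 1"
    using R by (auto simp: residue_reps_def)
  have rad: "absval c * absval (s / c) = absval s" using nz by (simp add: absval_divide)
  let ?C = "\<lambda>r. disc (c * r) (absval s)"
  have cr: "absval (c * r) \<le> 1" if "r \<in> R" for r
    using absval_mult_le_left[of c 1 r] c R1[OF that] by simp
  have pad: "padded (absval s * absval s) (?C r)" if "r \<in> R" for r
    using cr[OF that] s s2 by (intro padded_disc) auto
  have pad0: "padded (absval s * absval s) (disc (0 :: 'a) (absval s))"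
    using s s2 by (intro padded_disc) auto
  have dj: "?C r \<inter> ?C r' = {}" if "r \<in> R" "r' \<in> R" "r \<noteq> r'" for r r'
    using disc_split(2)[OF R nz _ that, of 0] sc by (simp add: rad)
  have sum: "\<delta> (\<Union>r\<in>S. ?C r) = (\<Sum>r\<in>S. \<delta> (?C r))" if "S \<subseteq> R" for S
  proof -
    have 1: "padded (absval s * absval s) (?C r)" if "r \<in> S" for r
      using pad \<open>S \<subseteq> R\<close> that by blast
    have 2: "?C r \<inter> ?C r' = {}" if "r \<in> S" "r' \<in> S" "r \<noteq> r'" for r r'
      using dj \<open>S \<subseteq> R\<close> that by blast
    show ?thesis
      using slice_UN[of S ?C, OF finite_subset[OF that fin] 1 2 pad0]
      by (simp add: \<delta>_def sum_subtractf)
  qed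
  have all: "(\<Union>r\<in>R. ?C r) = disc 0 (absval c)"
    using disc_split(1)[OF R nz, of 0] sc by (simp add: rad)
  have pc: "absval s \<le> absval (p * c)" "absval (p * c) < 1"
  proof -
    have "absval (s / c) \<le> absval p" by (rule pm[OF sc])
    then show "absval s \<le> absval (p * c)" using nz by (simp add: absval_divide absval_mult divide_le_eq)
    show "absval (p * c) < 1" using p c by (intro absval_mult_less_left) auto
  qed
  \<comment> \<open>The discs over the non-unit residues fill the ball of radius
    \<open>absval (p * c)\<close>, which by discreteness is the open ball of radius |c|. So
    \<open>R - S\<close> indexes the sphere of radius |c|.\<close>
  define S where "S = {r \<in> R. absval r < 1}"
  have S: "(\<Union>r\<in>S. ?C r) = disc 0 (absval (p * c))"
  proof (intro equalityI subsetI)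
    fix v assume "v \<in> (\<Union>r\<in>S. ?C r)"
    then obtain r where r: "r \<in> R" "absval r < 1" "absval (v - c * r) \<le> absval s" by (auto simp: S_def)
    have "absval (c * r) \<le> absval (p * c)"
      using pm[OF r(2)] by (simp add: absval_mult mult.commute mult_left_mono)
    then have "absval v \<le> absval (p * c)"
      using absval_add_le[of "v - c * r" "absval (p * c)" "c * r"] r(3) pc by simp
    then show "v \<in> disc 0 (absval (p * c))" by simp
  next
    fix v :: 'a assume v: "v \<in> disc 0 (absval (p * c))"
    have "absval (p * c) < absval c" using p nz by (simp add: absval_mult)
    then have vc: "absval v < absval c" using v by simp
    then have "v \<in> (\<Union>r\<in>R. ?C r)" unfolding all by simp
    then obtain r where r: "r \<in> R" "absval (v - c * r) \<le> absval s" by auto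
    have "absval (c * r) < absval c"
      using absval_diff_less[of v "absval c" "v - c * r"] vc r(2) c by simp
    then have "absval r < 1" using nz by (simp add: absval_mult)
    with r show "v \<in> (\<Union>r\<in>S. ?C r)" by (auto simp: S_def)
  qed
  have "(\<Sum>r\<in>R. \<delta> (?C r)) = 0"
    using sum[of R] slice_sym_balls[of c] c by (simp add: all \<delta>_def)
  moreover have "(\<Sum>r\<in>S. \<delta> (?C r)) = 0"
    using sum[of S] slice_sym_balls[OF pc] by (simp add: S \<delta>_def) (simp add: S_def)
  moreover have "(\<Sum>r\<in>R. \<delta> (?C r)) = (\<Sum>r\<in>R - S. \<delta> (?C r)) + (\<Sum>r\<in>S. \<delta> (?C r))"
    using fin by (intro sum.subset_diff) (auto simp: S_def)
  \<comment> \<open>The torus element given by the unit \<open>r\<close> preserves all radii and the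
    ball around 0. It relates the discs around \<open>c\<close> and \<open>c * r\<close> in either
    argument.\<close>
  moreover have "\<delta> (?C r) = \<delta> (disc c (absval s))" if "r \<in> R - S" for r
  proof -
    have r: "absval r = 1" "r \<noteq> 0" using that R1[of r] by (auto simp: S_def)
    show ?thesis
      using slice_torus[of r 0 c "absval s" "absval s"] slice_torus[of r "c * r" 0 "absval s" "absval s"]
        r s s2 c cr[of r] that by (simp add: \<delta>_def mult.commute)
  qed
  ultimately have "of_nat (card (R - S)) * \<delta> (disc c (absval s)) = 0" by simp
  \<comment> \<open>The residue class of 1 consists of units, so the sphere is not empty and its
    number of discs can be cancelled in the complex numbers.\<close>
  moreover have "R - S \<noteq> {}"
  proof -
    obtain r where r: "r \<in> R" "absval (1 - r) \<le> absval (s / c)"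
      using R by (metis absval_1 order_refl residue_reps_def)
    then have "absval r = 1" using sc by (intro absval_unit) (simp add: absval_minus_commute)
    with r show ?thesis by (auto simp: S_def)
  qed
  ultimately have "\<delta> (disc c (absval s)) = 0" using fin by simp
  then show ?thesis by (simp add: \<delta>_def)
qed

lemma slice_sym:
  assumes c: "absval c < 1" "absval c' < 1"
  shows "slice (disc c (absval s)) (disc c' (absval s)) = slice (disc c' (absval s)) (disc c (absval s))"
proof -
  have z: "disc d (absval s) = disc 0 (absval s)" if "absval d \<le> absval s" for d
    using that by (intro disc_eq) simp
  consider "absval c \<le> absval s" "absval c' \<le> absval s" | "absval c \<le> absval s" "absval s < absval c'"
    | "absval s < absval c" "absval c' \<le> absval s" | "absval s < absval c" "absval s < absval c'"
    by linarith
  then show ?thesis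
  proof cases
    case 1
    then show ?thesis by (simp only: z)
  next
    case 2
    then show ?thesis using slice_sym_zero[of c'] c by (simp only: z[of c])
  next
    case 3
    then show ?thesis using slice_sym_zero[of c] c by (simp only: z[of c'])
  next
    case 4
    then show ?thesis using slice_sym_nonzero[of c c'] c by simp
  qed
qed

end

text \<open>The swap exchanges both (c, c') and (d, d'). The reflection
  \<open>v \<mapsto> d + d' - v\<close>, made of the sign change in \<open>neg_pbox\<close> and a
  column shift, exchanges the discs around \<open>d\<close> and \<open>d'\<close> back and fixes the
  coordinates in the other two discs; what remains is the symmetry of the slice.\<close>

lemma skew_pbox:
  fixes s :: 'a
  assumes s: "s \<noteq> 0" "absval s < 1"
    and c: "absval c < 1" "absval c' < 1" "absval d < 1" "absval d' < 1"
  shows "skew (pbox 0 (absval s) (absval s) (disc c (absval s)) (disc c' (absval s))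
    (disc d (absval s)) (disc d' (absval s))) = 0"
proof -
  let ?r = "absval s"
  let ?P = "pbox (0 :: 'a) ?r ?r"
  have s2: "0 < ?r * ?r" "?r * ?r \<le> ?r" using s by (auto simp: mult_left_le)
  have pad: "padded (?r * ?r) (disc x ?r)" if "absval x < 1" for x :: 'a
    using that s s2 by (intro padded_disc) auto
  have cl: "clop (?P (disc x ?r) (disc x' ?r) (disc y ?r) (disc y' ?r))"
    if "absval x < 1" "absval x' < 1" "absval y < 1" "absval y' < 1" for x x' y y'
    using that s s2 by (intro clop_pbox[where e = "?r * ?r"]) (auto intro: pad)
  have neg: "uminus -` disc x ?r = disc (- x) ?r" for x :: 'a
  proof -
    have "absval (- v - x) = absval (v - - x)" for v
      using absval_minus[of "v + x"] by simp
    then show ?thesis by auto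
  qed
  have shift: "{v. v + x \<in> disc y ?r} = disc (y - x) ?r" for x y :: 'a
    by (simp add: algebra_simps)
  have "m (prod.swap -` ?P (disc c ?r) (disc c' ?r) (disc d ?r) (disc d' ?r)) =
      m (?P (disc c' ?r) (disc c ?r) (disc d' ?r) (disc d ?r))"
    using c by (intro m_swap_pbox cl)
  also have "\<dots> = m (?P (disc c' ?r) (disc c ?r) (disc (- d') ?r) (disc (- d) ?r))"
    using m_lract[OF cl, of c' c d' d "mat2 1 0 0 (- 1)" "mat2 1 0 0 (- 1)"] c
    by (simp only: neg_pbox neg invertible_mat2) (simp add: invertible_mat2)
  also have "\<dots> = m (?P (disc c' ?r) (disc c ?r) (disc d ?r) (disc d' ?r))"
  proof -
    have "absval (d + d') \<le> 1" using absval_add_less[of d 1 d'] c by simp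
    from column_shift_pbox[OF pad pad order_refl _ this, of d d' "disc c' ?r" "disc c ?r"] c
    have "lract (mat 1) (mat2 1 (d + d') 0 1) -` ?P (disc c' ?r) (disc c ?r) (disc d ?r) (disc d' ?r) =
      ?P (disc c' ?r) (disc c ?r) (disc (- d') ?r) (disc (- d) ?r)"
      by (simp only: shift) simp
    with m_lract[OF cl, of c' c d d' "mat 1" "mat2 1 (d + d') 0 1"] c show ?thesis
      by (simp add: invertible_mat2 invertible_mat_1)
  qed
  also have "\<dots> = m (?P (disc c ?r) (disc c' ?r) (disc d ?r) (disc d' ?r))"
    using slice_sym[OF s pad[OF c(3)] pad[OF c(4)] c(2,1)]
    by (simp only: slice_def[OF s pad[OF c(3)] pad[OF c(4)]])
  finally show ?thesis by (simp add: skew_def)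
qed

end

section \<open>From single boxes to a fixed neighbourhood\<close>

lemma mnorm_mat_1 [simp]: "mnorm (mat 1) = 1"
  by (simp add: mnorm_def mat_1_eq)

text \<open>The matrix and its inverse both have norm 1, since the determinant is a unit. So the
  condition number is 1 and the scale survives, in contrast to \<open>clop_lract\<close>; the atom
  argument in \<open>skew_local\<close> depends on this.\<close>

lemma uniform_lract_unipotent:
  assumes U: "uniform e U" "0 \<le> e" and ab: "absval a < 1" "absval b < 1"
  shows "uniform e (lract (mat2 1 a b 1) (mat 1) -` U)"
proof -
  let ?g = "mat2 1 a b 1" and ?h = "mat2 1 (- a) (- b) 1"
  have n: "mnorm ?g = 1" "mnorm ?h = 1" using ab by (simp_all add: mnorm_def)
  have u: "absval (1 - a * b) = 1"
    using absval_mult_less_left[of a 1 b] ab by (intro absval_unit) simp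
  then have "1 - a * b \<noteq> 0" by auto
  then have inv: "invertible ?g" by (intro invertible_mat2) simp
  have "?h = matrix_inv ?g ** (?g ** ?h)"
    by (simp add: matrix_mul_assoc matrix_inv_mult inv)
  also have "\<dots> = mat (1 - a * b) ** matrix_inv ?g"
    using mat2_det_mult(1)[of 1 a b 1] by (simp add: times_mat)
  finally have "mnorm (matrix_inv ?g) = 1"
    using n(2) u by (simp add: mnorm_mat_mult)
  moreover have "matrix_inv (mat 1 :: 'a ^ 2 ^ 2) = mat 1"
    using matrix_inv_mult(1)[OF invertible_mat_1] by simp
  ultimately show ?thesis
    using U n inv by (intro uniform_lract[OF U(1)]) (simp_all add: invertible_mat_1)
qed

text \<open>The products distinguishing slice coordinates from affine ones contain a factor
  \<open>y\<close> or \<open>y'\<close> and are invisible at scale \<open>r\<close>. Hence the box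
  lies in a polydisc of radius \<open>r\<close> in the affine coordinates.\<close>

lemma pbox_coords:
  assumes "(A, B) \<in> pbox 0 r r (disc c r) (disc c' r) (disc d r) (disc d' r)" "0 \<le> r" "r < 1"
    and c: "absval c < 1" "absval c' < 1" "absval d < 1" "absval d' < 1"
  shows "A$1$1 \<noteq> 0" "B$2$1 \<noteq> 0"
    "absval (A$1$2 / A$1$1 - d) \<le> r" "absval (A$2$1 / A$1$1) \<le> r" "absval (A$2$2 / A$1$1 - c) \<le> r"
    "absval (B$1$2 / B$2$1 - c') \<le> r" "absval (B$1$1 / B$2$1) \<le> r" "absval (B$2$2 / B$2$1 - d') \<le> r"
proof -
  let ?x = "A$1$2 / A$1$1" and ?y = "A$2$1 / A$1$1" and ?z = "A$2$2 / A$1$1"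
  let ?x' = "B$1$2 / B$2$1" and ?y' = "B$1$1 / B$2$1" and ?z' = "B$2$2 / B$2$1"
  have h: "A$1$1 \<noteq> 0" "B$2$1 \<noteq> 0" "absval ?y \<le> r" "absval ?y' \<le> r"
    "absval (?z - ?x * ?y - c) \<le> r" "absval (?x' - ?y' * ?z' - c') \<le> r"
    "absval (?x - ?y' * ?z - d) \<le> r" "absval (?z' - ?y * ?x' - d') \<le> r"
    using assms(1) unfolding pbox_iff mem_Collect_eq diff_0_right by blast+
  have le1: "absval v \<le> 1" if "absval (v - w) \<le> r" "absval w < 1" for v w :: 'a
    using absval_add_le[of "v - w" 1 w] that \<open>r < 1\<close> by simp
  have xz: "absval ?x \<le> 1" "absval ?z \<le> 1"
    using absval_solve_le[of ?z ?x ?y ?y'] le1[OF h(5) c(1)] le1[OF h(7) c(3)] h(3,4) \<open>r < 1\<close> by simp_all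
  have xz': "absval ?x' \<le> 1" "absval ?z' \<le> 1"
    using absval_solve_le[of ?z' ?x' ?y ?y'] le1[OF h(6) c(2)] le1[OF h(8) c(4)] h(3,4) \<open>r < 1\<close>
    by (simp_all only: mult.commute[of ?y])
  show "A$1$1 \<noteq> 0" "B$2$1 \<noteq> 0" "absval ?y \<le> r" "absval ?y' \<le> r" by fact+
  show "absval (?x - d) \<le> r"
    using absval_add_le[OF h(7) absval_mult_le_left[OF h(4) xz(2)]] by (simp add: algebra_simps)
  show "absval (?z - c) \<le> r"
    using absval_add_le[OF h(5) absval_mult_le_right[OF xz(1) h(3)]] by (simp add: algebra_simps)
  show "absval (?x' - c') \<le> r"
    using absval_add_le[OF h(6) absval_mult_le_left[OF h(4) xz'(2)]] by (simp add: algebra_simps)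
  show "absval (?z' - d') \<le> r"
    using absval_add_le[OF h(8) absval_mult_le_left[OF h(3) xz'(1)]] by (simp add: algebra_simps)
qed

text \<open>Normalising \<open>A$1$1\<close> and \<open>B$2$1\<close> to 1, any two pairs in the box
  differ by at most \<open>r\<close>. So the box is an atom among the sets of scale
  \<open>r\<close>.\<close>

lemma uniform_subset_pbox:
  assumes Z: "uniform r Z" "Z \<subseteq> pbox 0 r r (disc c r) (disc c' r) (disc d r) (disc d' r)" "Z \<noteq> {}"
    and r: "0 \<le> r" "r < 1"
    and c: "absval c < 1" "absval c' < 1" "absval d < 1" "absval d' < 1"
  shows "Z = pbox 0 r r (disc c r) (disc c' r) (disc d r) (disc d' r)"
proof (intro equalityI subsetI)
  obtain A B where AB: "(A, B) \<in> Z" using Z(3) by auto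
  note p = pbox_coords[OF subsetD[OF Z(2) AB] r c]
  fix w assume w: "w \<in> pbox 0 r r (disc c r) (disc c' r) (disc d r) (disc d' r)"
  obtain A' B' where w': "w = (A', B')" by (cases w)
  note p' = pbox_coords[OF w[unfolded w'] r c]
  have close: "absval (v - u) \<le> r" if "absval (u - x) \<le> r" "absval (v - x) \<le> r" for u v x :: 'a
    using absval_diff_trans[of v x r u] that by (simp add: absval_minus_commute)
  have close0: "absval (v - u) \<le> r" if "absval u \<le> r" "absval v \<le> r" for u v :: 'a
    using that by (rule absval_diff_le[rotated])
  have near: "near r M N" if "mnorm (N - M) \<le> r" "1 \<le> mnorm M" for M N :: "'a ^ 2 ^ 2"
  proof -
    have "r \<le> r * mnorm M" using that(2) r(1) by (simp add: mult_le_cancel_left1)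
    with that(1) show ?thesis by (simp add: near_def)
  qed
  have "near r (mat (inverse (A$1$1)) ** A) (mat (inverse (A'$1$1)) ** A')"
  proof (rule near)
    show "1 \<le> mnorm (mat (inverse (A$1$1)) ** A)"
      using mnorm_entries(1)[of "mat (inverse (A$1$1)) ** A"] p(1) by (simp add: mat_times)
    show "mnorm (mat (inverse (A'$1$1)) ** A' - mat (inverse (A$1$1)) ** A) \<le> r"
      using p(1) p'(1) close[OF p(3) p'(3)] close0[OF p(4) p'(4)] close[OF p(5) p'(5)] r
      by (simp add: mnorm_le_iff mat_times divide_inverse mult.commute)
  qed
  moreover have "near r (mat (inverse (B$2$1)) ** B) (mat (inverse (B'$2$1)) ** B')"
  proof (rule near)
    show "1 \<le> mnorm (mat (inverse (B$2$1)) ** B)"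
      using mnorm_entries(3)[of "mat (inverse (B$2$1)) ** B"] p(2) by (simp add: mat_times)
    show "mnorm (mat (inverse (B'$2$1)) ** B' - mat (inverse (B$2$1)) ** B) \<le> r"
      using p(2) p'(2) close[OF p(6) p'(6)] close0[OF p(7) p'(7)] close[OF p(8) p'(8)] r
      by (simp add: mnorm_le_iff mat_times divide_inverse mult.commute)
  qed
  moreover have "(mat (inverse (A$1$1)) ** A, mat (inverse (B$2$1)) ** B) \<in> Z"
    using uniform_scale[OF Z(1) AB] p by simp
  ultimately have "(mat (inverse (A'$1$1)) ** A', mat (inverse (B'$2$1)) ** B') \<in> Z"
    using uniform_near[OF Z(1)] by blast
  then show "w \<in> Z" using uniform_unscale[OF Z(1)] p' w' by simp
qed (use Z in blast)

definition small_chart :: "'a::nonarch_local_field mpair set" where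
  "small_chart = chart (\<lambda>x y z x' y' z'. absval x < 1 \<and> absval y < 1 \<and> absval z < 1 \<and>
     absval x' < 1 \<and> absval y' < 1 \<and> absval z' < 1)"

lemma clop_small_chart: "clop small_chart"
proof -
  have *: "absval X < 1" if "absval x < 1" "absval (X - x) \<le> 1/2" for X x :: 'a
    using absval_add_less[of "X - x" 1 x] that by simp
  have "uniform (1/2) (small_chart :: 'a mpair set)"
    unfolding small_chart_def by (rule uniform_chart) (auto simp: regular_def intro: *)
  then show ?thesis unfolding clop_def by (intro exI[of _ "1/2"]) simp
qed

text \<open>\<open>g\<close> is the adjugate of the matrix formed by the first columns of
  \<open>A\<close> and \<open>B\<close>, so it sends them to multiples of the two basis vectors. The
  matrix \<open>mat2 1 0 0 t\<close> on the right then shrinks the second columns.\<close>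

lemma small_chart_translate:
  fixes A B :: "'a::nonarch_local_field ^ 2 ^ 2"
  assumes dd: "A$1$1 * B$2$1 - A$2$1 * B$1$1 \<noteq> 0"
  obtains g h :: "'a ^ 2 ^ 2" where "invertible g" "invertible h" "lract g h (A, B) \<in> small_chart"
proof -
  let ?d = "A$1$1 * B$2$1 - A$2$1 * B$1$1"
  define g where "g = mat2 (B$2$1) (- B$1$1) (- A$2$1) (A$1$1)"
  define C where "C = g ** A"
  define D where "D = g ** B"
  have CD: "C$1$1 = ?d" "C$2$1 = 0" "D$1$1 = 0" "D$2$1 = ?d"
    by (simp_all add: C_def D_def g_def mat2_mult algebra_simps)
  define M where "M = 1 + absval (C$1$2) + absval (C$2$2) + absval (D$1$2) + absval (D$2$2)"
  have M: "1 \<le> M" "absval (C$1$2) \<le> M" "absval (C$2$2) \<le> M" "absval (D$1$2) \<le> M" "absval (D$2$2) \<le> M"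
    by (simp_all add: M_def)
  have "0 < absval ?d / M" using dd M(1) by (intro divide_pos_pos) simp_all
  from ex_absval_less[OF this] obtain t :: 'a where t: "t \<noteq> 0" "absval t < absval ?d / M" by blast
  have small: "absval (v * t / ?d) < 1" if "absval v \<le> M" for v
  proof -
    have "absval v * absval t \<le> M * absval t" using that by (intro mult_right_mono) simp_all
    also have "\<dots> < absval ?d" using t(2) M(1) by (simp add: less_divide_eq mult.commute)
    finally show ?thesis using dd by (simp add: absval_divide absval_mult)
  qed
  show ?thesis
  proof
    show "invertible g" unfolding g_def using dd by (intro invertible_mat2) (simp add: algebra_simps)
    show "invertible (mat2 1 0 0 t)" using t by (intro invertible_mat2) simp
    show "lract g (mat2 1 0 0 t) (A, B) \<in> small_chart"
      using dd small[OF M(2)] small[OF M(3)] small[OF M(4)] small[OF M(5)]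
      by (simp add: small_chart_def chart_def mult_mat2 flip: C_def D_def) (simp add: CD)
  qed
qed

lemma small_chart_translate_columns:
  fixes A B h :: "'a::nonarch_local_field ^ 2 ^ 2"
  assumes "invertible h" "(A ** h)$1$1 * (B ** h)$2$1 - (A ** h)$2$1 * (B ** h)$1$1 \<noteq> 0"
  shows "\<exists>g k. invertible g \<and> invertible k \<and> lract g k (A, B) \<in> small_chart"
proof -
  obtain g k where gk: "invertible g" "invertible k" "lract g k (A ** h, B ** h) \<in> small_chart"
    using small_chart_translate[OF assms(2)] by blast
  then have "lract g (h ** k) (A, B) \<in> small_chart" by (simp add: matrix_mul_assoc)
  then show ?thesis using gk assms(1) invertible_mult by blast
qed

text \<open>Otherwise the quadratic form \<open>v \<mapsto> det (A v, B v)\<close> vanishes at both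
  basis vectors and at their sum, and likewise for the transposed matrices. The six coefficients of
  the two forms are four of the minors of the 2 by 4 matrix with rows \<open>A\<close> and
  \<open>B\<close>, and the sum and difference of the other two, \<open>P\<close> and
  \<open>Q\<close>. Once all minors vanish, the rows are proportional.\<close>

lemma proportional_or_translate:
  fixes A B :: "'a::nonarch_local_field ^ 2 ^ 2"
  assumes "A \<noteq> 0" "\<And>c. B \<noteq> mat c ** A"
  shows "\<exists>g h. invertible g \<and> invertible h \<and>
    (lract g h (A, B) \<in> small_chart \<or> lract g h (transp (A, B)) \<in> small_chart)"
proof (rule ccontr)
  assume contr: "\<not> ?thesis"
  have inv: "invertible (mat2 0 1 1 0 :: 'a ^ 2 ^ 2)" "invertible (mat2 1 0 1 1 :: 'a ^ 2 ^ 2)"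
    by (simp_all add: invertible_mat2)
  have z: "(A ** h)$1$1 * (B ** h)$2$1 - (A ** h)$2$1 * (B ** h)$1$1 = 0" if "invertible h" for h :: "'a ^ 2 ^ 2"
    using small_chart_translate_columns[OF that, of A B] contr by blast
  have z': "(transpose A ** h)$1$1 * (transpose B ** h)$2$1 - (transpose A ** h)$2$1 * (transpose B ** h)$1$1 = 0"
    if "invertible h" for h :: "'a ^ 2 ^ 2"
    using small_chart_translate_columns[OF that, of "transpose A" "transpose B"] contr by auto
  define P where "P = A$1$1 * B$2$2 - A$2$2 * B$1$1"
  define Q where "Q = A$1$2 * B$2$1 - A$2$1 * B$1$2"
  have 1: "A$1$1 * B$2$1 - A$2$1 * B$1$1 = 0" "A$1$2 * B$2$2 - A$2$2 * B$1$2 = 0"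
    using z[OF invertible_mat_1] z[OF inv(1)] by (simp_all add: mult_mat2)
  have 2: "A$1$1 * B$1$2 - A$1$2 * B$1$1 = 0" "A$2$1 * B$2$2 - A$2$2 * B$2$1 = 0"
    using z'[OF invertible_mat_1] z'[OF inv(1)] by (simp_all add: mult_mat2 transpose_def)
  have "(A$1$1 * B$2$1 - A$2$1 * B$1$1) + (A$1$2 * B$2$2 - A$2$2 * B$1$2) + (P + Q) = 0"
    using z[OF inv(2)] by (simp add: mult_mat2 P_def Q_def algebra_simps)
  then have PQ: "P + Q = 0" by (simp add: 1)
  have "(A$1$1 * B$1$2 - A$1$2 * B$1$1) + (A$2$1 * B$2$2 - A$2$2 * B$2$1) + (P - Q) = 0"
    using z'[OF inv(2)] by (simp add: mult_mat2 transpose_def P_def Q_def algebra_simps)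
  then have PQ': "P = Q" by (simp add: 2)
  \<comment> \<open>\<open>P + Q = P - Q = 0\<close> does not suffice in characteristic 2: this is the Pluecker relation.\<close>
  have "P * Q = (A$1$1 * B$2$1 - A$2$1 * B$1$1) * (A$1$2 * B$2$2 - A$2$2 * B$1$2)
      - (A$1$1 * B$1$2 - A$1$2 * B$1$1) * (A$2$1 * B$2$2 - A$2$2 * B$2$1)"
    by (simp add: P_def Q_def algebra_simps)
  then have "P = 0" "Q = 0" using PQ' by (simp_all add: 1 2)
  then have minors: "A$1$1 * B$2$2 = A$2$2 * B$1$1" "A$1$2 * B$2$1 = A$2$1 * B$1$2"
      "A$1$1 * B$2$1 = A$2$1 * B$1$1" "A$1$2 * B$2$2 = A$2$2 * B$1$2"
      "A$1$1 * B$1$2 = A$1$2 * B$1$1" "A$2$1 * B$2$2 = A$2$2 * B$2$1"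
    using 1 2 by (simp_all add: P_def Q_def)
  have "A$1$1 \<noteq> 0 \<or> A$1$2 \<noteq> 0 \<or> A$2$1 \<noteq> 0 \<or> A$2$2 \<noteq> 0"
    using assms(1) by (auto simp: vec_eq_iff forall_2)
  then consider "A$1$1 \<noteq> 0" | "A$1$2 \<noteq> 0" | "A$2$1 \<noteq> 0" | "A$2$2 \<noteq> 0" by blast
  then show False
  proof cases
    case 1
    then have "B = mat (B$1$1 / A$1$1) ** A"
      using minors by (simp add: vec_eq_iff forall_2 mat_times field_simps)
    with assms(2) show False by blast
  next
    case 2
    then have "B = mat (B$1$2 / A$1$2) ** A"
      using minors by (simp add: vec_eq_iff forall_2 mat_times field_simps)
    with assms(2) show False by blast
  next
    case 3
    then have "B = mat (B$2$1 / A$2$1) ** A"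
      using minors by (simp add: vec_eq_iff forall_2 mat_times field_simps)
    with assms(2) show False by blast
  next
    case 4
    then have "B = mat (B$2$2 / A$2$2) ** A"
      using minors by (simp add: vec_eq_iff forall_2 mat_times field_simps)
    with assms(2) show False by blast
  qed
qed

lemma lract_matrix_inv:
  assumes "invertible g" "invertible h"
  shows "lract g h (lract (matrix_inv g) (matrix_inv h) w) = w"
    "lract (matrix_inv g) (matrix_inv h) (lract g h w) = w"
  using assms by (cases w; simp add: matrix_inv_cancel2)+

section \<open>Vanishing of the skew part off the diagonal\<close>

context invariant_measure
begin

text \<open>The matrix \<open>?g\<close> moves the pair to \<open>y = y' = 0\<close> without loss of
  scale. There it lies in a box to which \<open>skew_pbox\<close> applies and which is an atom of
  scale |s|; \<open>?h\<close> inverts \<open>?g\<close> up to the scalar \<open>u\<close>.\<close>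

lemma skew_local:
  fixes s :: 'a
  assumes AB: "(A, B) \<in> small_chart" and s: "s \<noteq> 0" "absval s < 1"
  shows "\<exists>Y. uniform (absval s) Y \<and> (A, B) \<in> Y \<and>
    (\<forall>Z. uniform (absval s) Z \<longrightarrow> Z \<subseteq> Y \<longrightarrow> skew Z = 0)"
proof -
  interpret k: invariant_measure skew by (rule invariant_measure_skew)
  let ?x = "A$1$2 / A$1$1" and ?y = "A$2$1 / A$1$1" and ?z = "A$2$2 / A$1$1"
  let ?x' = "B$1$2 / B$2$1" and ?y' = "B$1$1 / B$2$1" and ?z' = "B$2$2 / B$2$1"
  have nz: "A$1$1 \<noteq> 0" "B$2$1 \<noteq> 0"
    and lt: "absval ?x < 1" "absval ?y < 1" "absval ?z < 1" "absval ?x' < 1" "absval ?y' < 1" "absval ?z' < 1"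
    using AB unfolding small_chart_def chart_def mem_Collect_eq prod.case by blast+
  define u where "u = 1 - ?y * ?y'"
  have u: "absval u = 1"
    unfolding u_def using absval_mult_less_left[OF lt(2), of ?y'] lt(5) by (intro absval_unit) simp
  then have u0: "u \<noteq> 0" by auto
  let ?g = "mat2 1 (- ?y') (- ?y) 1" and ?h = "mat2 1 ?y' ?y 1"
  define c where "c = (?z - ?y * ?x) / u"
  define c' where "c' = (?x' - ?y' * ?z') / u"
  define d where "d = (?x - ?y' * ?z) / u"
  define d' where "d' = (?z' - ?y * ?x') / u"
  have cd: "absval c < 1" "absval c' < 1" "absval d < 1" "absval d' < 1"
    using lt absval_diff_less[OF lt(3) absval_mult_less_left[OF lt(2), of ?x]]
      absval_diff_less[OF lt(4) absval_mult_less_left[OF lt(5), of ?z']]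
      absval_diff_less[OF lt(1) absval_mult_less_left[OF lt(5), of ?z]]
      absval_diff_less[OF lt(6) absval_mult_less_left[OF lt(2), of ?x']]
    unfolding c_def c'_def d_def d'_def absval_divide u div_by_1 by (meson less_imp_le)+
  let ?U = "pbox 0 (absval s) (absval s) (disc c (absval s)) (disc c' (absval s))
    (disc d (absval s)) (disc d' (absval s))"
  have unif: "uniform (absval s) ?U"
    unfolding pbox_def using s cd by (intro uniform_chart regular_pbox padded_disc) auto
  let ?Y = "lract ?g (mat 1) -` ?U"
  have "lract ?g (mat 1) (A, B) \<in> ?U"
  proof -
    have e: "(?g ** A)$1$1 = u * A$1$1" "(?g ** A)$1$2 = u * d * A$1$1"
      "(?g ** A)$2$1 = 0" "(?g ** A)$2$2 = u * c * A$1$1"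
      "(?g ** B)$1$1 = 0" "(?g ** B)$1$2 = u * c' * B$2$1"
      "(?g ** B)$2$1 = u * B$2$1" "(?g ** B)$2$2 = u * d' * B$2$1"
      using nz u0 by (simp_all add: mat2_mult c_def c'_def d_def d'_def u_def field_simps)
    show ?thesis
      unfolding lract_simp matrix_mul_rid pbox_iff e using nz u0 by simp
  qed
  moreover have "uniform (absval s) ?Y"
    using lt by (intro uniform_lract_unipotent unif) simp_all
  moreover have "skew Z = 0" if Z: "uniform (absval s) Z" "Z \<subseteq> ?Y" for Z
  proof -
    let ?Z = "lract ?h (mat 1) -` Z"
    have inv: "invertible ?h" using u0 by (intro invertible_mat2) (simp add: u_def mult.commute)
    have uZ: "uniform (absval s) ?Z" using lt by (intro uniform_lract_unipotent Z(1)) simp_all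
    have sub: "?Z \<subseteq> ?U"
    proof
      fix w assume "w \<in> ?Z"
      moreover obtain M N where w: "w = (M, N)" by (cases w)
      ultimately have "lract ?h (mat 1) (M, N) \<in> Z" by simp
      then have "lract ?g (mat 1) (lract ?h (mat 1) (M, N)) \<in> ?U" using Z(2) by blast
      moreover have "?g ** ?h = mat u"
        using mat2_det_mult(2)[of 1 ?y' ?y 1] by (simp add: u_def mult.commute)
      ultimately have "(mat u ** M, mat u ** N) \<in> ?U"
        by (simp only: lract_simp matrix_mul_rid matrix_mul_assoc)
      then show "w \<in> ?U" unfolding w by (rule uniform_unscale[OF unif _ u0 u0])
    qed
    have "?Z = {} \<or> ?Z = ?U"
      using uniform_subset_pbox[OF uZ sub _ _ s(2) cd] by auto
    then have "skew ?Z = 0"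
      using skew_pbox[OF s cd] k.m_empty by metis
    moreover have "clop Z" using Z(1) s unfolding clop_def by (intro exI[of _ "absval s"]) simp
    ultimately show ?thesis using k.m_lract[OF _ inv invertible_mat_1, of Z] by simp
  qed
  ultimately show ?thesis by blast
qed

text \<open>\<open>skew_local\<close> speaks only of sets of one scale |s|. Choosing |s| below the
  scale of \<open>N\<close> puts \<open>N\<close> itself into this ring, where local vanishing is
  applied.\<close>

lemma skew_small_chart:
  assumes N: "clop N" "N \<subseteq> small_chart" shows "skew N = 0"
proof -
  interpret k: invariant_measure skew by (rule invariant_measure_skew)
  obtain e where e: "0 < e" "e < 1" "uniform e N" using N(1) by (auto simp: clop_def)
  obtain s :: 'a where s: "s \<noteq> 0" "absval s < e" using ex_absval_less[OF e(1)] by blast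
  then have s1: "absval s < 1" using e by simp
  show ?thesis
  proof (rule k.local_vanishing[of "uniform (absval s)"])
    show "clop Z" if "uniform (absval s) Z" for Z :: "'a mpair set"
      using that s s1 unfolding clop_def by (intro exI[of _ "absval s"]) simp
    show "uniform (absval s) N" using uniform_mono[OF e(3)] s by simp
    show "\<exists>Y. uniform (absval s) Y \<and> (A, B) \<in> Y \<and>
        (\<forall>Z. uniform (absval s) Z \<longrightarrow> Z \<subseteq> N \<inter> Y \<longrightarrow> skew Z = 0)" if "(A, B) \<in> N" for A B
      using skew_local[of A B s] that N(2) s(1) s1 by blast
  qed (use s1 in \<open>auto intro: uniform_Int uniform_Diff\<close>)
qed

lemma skew_translate:
  assumes "invertible g" "invertible h" "clop Z" "Z \<subseteq> lract g h -` small_chart"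
  shows "skew Z = 0"
proof -
  interpret k: invariant_measure skew by (rule invariant_measure_skew)
  let ?Z = "lract (matrix_inv g) (matrix_inv h) -` Z"
  note inv = assms(1,2)[THEN invertible_matrix_inv]
  have "?Z \<subseteq> small_chart"
    using assms(4) lract_matrix_inv(1)[OF assms(1,2)] by fastforce
  then have "skew ?Z = 0" using clop_lract[OF assms(3) inv] by (intro skew_small_chart)
  then show ?thesis using k.m_lract[OF assms(3) inv] by simp
qed

lemma skew_off_diagonal:
  assumes N: "clop N" and off: "\<And>A c. (A, mat c ** A) \<notin> N" shows "skew N = 0"
proof -
  interpret k: invariant_measure skew by (rule invariant_measure_skew)
  interpret t: invariant_measure "\<lambda>U. m (transp -` U)" by (rule invariant_measure_transp)
  have transp2: "transp -` transp -` U = U" for U :: "'a mpair set" by auto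
  have "transp -` prod.swap -` transp -` U = prod.swap -` U" for U :: "'a mpair set" by auto
  \<comment> \<open>Transposition commutes with the swap, so results on the skew part of the
    transposed measure carry over to \<open>m\<close>.\<close>
  then have t_skew: "t.skew (transp -` U) = skew U" for U
    by (simp only: skew_def t.skew_def transp2)
  show ?thesis
  proof (rule k.local_vanishing[of clop])
    fix A B assume AB: "(A, B) \<in> N"
    then have A: "A \<noteq> 0" using N unfolding clop_def by (blast dest: uniform_nonzero)
    have "B \<noteq> mat c ** A" for c using AB off by blast
    from proportional_or_translate[OF A this]
    obtain g h where gh: "invertible g" "invertible h"
      and or: "lract g h (A, B) \<in> small_chart \<or> lract g h (transp (A, B)) \<in> small_chart" by blast
    from or show "\<exists>Y. clop Y \<and> (A, B) \<in> Y \<and> (\<forall>Z. clop Z \<longrightarrow> Z \<subseteq> N \<inter> Y \<longrightarrow> skew Z = 0)"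
    proof
      assume "lract g h (A, B) \<in> small_chart"
      then show ?thesis
        using clop_lract[OF clop_small_chart gh] skew_translate[OF gh]
        by (intro exI[of _ "lract g h -` small_chart"]) auto
    next
      assume *: "lract g h (transp (A, B)) \<in> small_chart"
      have "skew Z = 0" if "clop Z" "Z \<subseteq> transp -` lract g h -` small_chart" for Z
      proof -
        have "transp -` Z \<subseteq> lract g h -` small_chart" using that(2) by fastforce
        then have "t.skew (transp -` Z) = 0" by (rule t.skew_translate[OF gh clop_transp[OF that(1)]])
        then show ?thesis by (simp only: t_skew)
      qed
      then show ?thesis
        using clop_transp[OF clop_lract[OF clop_small_chart gh]] *
        by (intro exI[of _ "transp -` lract g h -` small_chart"]) auto
    qed
  qed (use N in \<open>auto intro: clop_Int clop_Diff\<close>)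
qed

lemma m_swap:
  assumes N: "clop N" shows "m (prod.swap -` N) = m N"
proof -
  interpret k: invariant_measure skew by (rule invariant_measure_skew)
  obtain e where e: "uniform e N" using N by (auto simp: clop_def)
  have "prod.swap -` (N \<inter> prod.swap -` N) = N \<inter> prod.swap -` N" by auto
  then have "skew (N \<inter> prod.swap -` N) = 0" by (simp add: skew_def)
  moreover have "skew (N - prod.swap -` N) = 0"
  proof (rule skew_off_diagonal)
    show "clop (N - prod.swap -` N)" using N by (intro clop_Diff clop_swap)
    fix A c
    \<comment> \<open>The two entries may be rescaled separately, here by \<open>c\<close> and its
      inverse: a pair of proportional matrices is equivalent to its mirror image.\<close>
    have "(mat c ** A, A) \<in> N" if "(A, mat c ** A) \<in> N"
    proof -
      have "mat c ** A \<noteq> 0" using uniform_nonzero[OF e that] by blast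
      then have "c \<noteq> 0" by (auto simp: mat_times vec_eq_iff)
      then show ?thesis using uniform_scale[OF e that, of c "inverse c"] by (simp add: mat_mult_assoc2)
    qed
    then show "(A, mat c ** A) \<notin> N - prod.swap -` N" by auto
  qed
  ultimately have "skew N = 0" using k.m_split[OF N clop_swap[OF N]] by simp
  then show ?thesis by (simp add: skew_def)
qed

end

subsection \<open>Distributions on pairs of classes\<close>

abbreviation pcl :: "'a::field mpair \<Rightarrow> ('a ^ 2 ^ 2) set \<times> ('a ^ 2 ^ 2) set" where
  "pcl \<equiv> map_prod proj_class proj_class"

abbreviation XX :: "(('a::nonarch_local_field ^ 2 ^ 2) set \<times> ('a ^ 2 ^ 2) set) topology" where
  "XX \<equiv> prod_topology Pgl2_topology Pgl2_topology"

lemma proj_class_scale: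
  assumes "c \<noteq> 0" shows "proj_class (mat c ** A) = proj_class A"
proof -
  have "\<exists>e. mat d ** (mat c ** A) = mat e ** A \<and> e \<noteq> 0" if "d \<noteq> 0" for d
    using that assms by (intro exI[of _ "d * c"]) (simp add: mat_mult_assoc2)
  moreover have "\<exists>e. mat d ** A = mat e ** (mat c ** A) \<and> e \<noteq> 0" if "d \<noteq> 0" for d
    using that assms by (intro exI[of _ "d / c"]) (simp add: mat_mult_assoc2)
  ultimately show ?thesis unfolding proj_class_eq by blast
qed

lemma proj_class_eqD:
  assumes "proj_class A = proj_class B" shows "\<exists>c. c \<noteq> 0 \<and> B = mat c ** A"
proof -
  have "mat 1 ** B \<in> proj_class B" unfolding proj_class_eq by (rule CollectI, rule exI[of _ 1]) simp
  then show ?thesis unfolding assms[symmetric] by (auto simp: proj_class_eq)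
qed

lemma pcl_in_image_iff:
  assumes "clop W" shows "pcl w \<in> pcl ` W \<longleftrightarrow> w \<in> W"
proof
  obtain e where e: "uniform e W" using assms by (auto simp: clop_def)
  obtain A B where w: "w = (A, B)" by (cases w)
  assume "pcl w \<in> pcl ` W"
  then obtain A' B' where AB: "(A', B') \<in> W" "proj_class A = proj_class A'" "proj_class B = proj_class B'"
    by (auto simp: w)
  obtain c d where "c \<noteq> 0" "A' = mat c ** A" "d \<noteq> 0" "B' = mat d ** B"
    using AB(2,3)[THEN proj_class_eqD] by blast
  then show "w \<in> W" using uniform_unscale[OF e] AB(1) w by simp
qed simp

text \<open>By transitivity of \<open>near\<close> and its invariance under scaling, the saturation
  contains with each \<open>B\<close> the open ball of radius \<open>e * mnorm B\<close>.\<close>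

lemma openin_proj_class_near:
  assumes A: "A \<noteq> 0" and e: "0 < e" "e < 1"
  shows "openin Pgl2_topology (proj_class ` {B. near e A B})"
  unfolding openin_Pgl2_topology
proof
  let ?S = "{B \<in> - {0}. proj_class B \<in> proj_class ` {B. near e A B}}"
  show "proj_class ` {B. near e A B} \<subseteq> Pgl2"
    using near_nonzero[OF _ e(2) A] by (auto simp: Pgl2_def)
  have "open ?S"
    unfolding open_dist
  proof
    fix B assume "B \<in> ?S"
    then obtain B' where B: "B \<noteq> 0" "near e A B'" "proj_class B = proj_class B'" by auto
    then obtain c where c: "c \<noteq> 0" "B' = mat c ** B" using proj_class_eqD by blast
    have "C \<in> ?S" if "dist C B < e * mnorm B" for C
    proof -
      have n: "near e B C" using that mnorm_le_dist[of C B] by (simp add: near_def)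
      have "near e A (mat c ** C)" using near_trans[OF B(2) _ e(2)] near_scale[OF n] c by simp
      moreover have "C \<noteq> 0" using near_nonzero[OF n e(2) B(1)] .
      ultimately show ?thesis using proj_class_scale[OF c(1), of C]
        by (auto intro!: image_eqI[of _ _ "mat c ** C"])
    qed
    moreover have "0 < e * mnorm B" using e B by simp
    ultimately show "\<exists>d>0. \<forall>C. dist C B < d \<longrightarrow> C \<in> ?S" by blast
  qed
  then show "openin (top_of_set (- {0})) ?S" by (subst openin_open_eq) (auto simp: open_Compl)
qed

lemma compact_space_Pgl2: "compact_space (Pgl2_topology :: ('a::nonarch_local_field ^ 2 ^ 2) set topology)"
proof -
  let ?P = "{A :: 'a ^ 2 ^ 2. mnorm A = 1}"
  have "compactin (top_of_set (- {0})) ?P"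
    using compact_mnorm_1 by (auto simp: compactin_subtopology)
  then have "compactin Pgl2_topology (proj_class ` ?P)"
    using quotient_map_proj_class by (intro image_compactin quotient_imp_continuous_map)
  moreover have "proj_class ` ?P = Pgl2"
  proof
    show "proj_class ` ?P \<subseteq> Pgl2" unfolding Pgl2_def by (rule image_mono) auto
    show "Pgl2 \<subseteq> proj_class ` ?P"
    proof
      fix x :: "('a ^ 2 ^ 2) set" assume "x \<in> Pgl2"
      then obtain A where A: "A \<noteq> 0" "x = proj_class A" by (auto simp: Pgl2_def)
      obtain c where "c \<noteq> 0" "mnorm (mat c ** A) = 1" using ex_mnorm_1[OF A(1)] by blast
      then show "x \<in> proj_class ` ?P"
        using A(2) by (intro image_eqI[of _ _ "mat c ** A"]) (simp_all add: proj_class_scale)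
    qed
  qed
  ultimately show ?thesis by (simp add: compact_space_def)
qed

text \<open>The space is compact, so closures of supports are compact automatically.\<close>

lemma schwartz_space_XX:
  "f \<in> schwartz_space XX \<longleftrightarrow> (\<forall>y. y \<notin> Pgl2 \<times> Pgl2 \<longrightarrow> f y = 0) \<and>
     (\<forall>y\<in>Pgl2 \<times> Pgl2. \<exists>U. openin XX U \<and> y \<in> U \<and> (\<forall>z\<in>U. f z = f y))"
proof -
  have "compact_space (XX :: (('a ^ 2 ^ 2) set \<times> ('a ^ 2 ^ 2) set) topology)"
    by (simp add: compact_space_prod_topology compact_space_Pgl2)
  then have "compactin XX (XX closure_of S)" for S :: "(('a ^ 2 ^ 2) set \<times> ('a ^ 2 ^ 2) set) set"
    by (intro closedin_compact_space) simp_all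
  then show ?thesis by (simp add: schwartz_space_def)
qed

definition ind :: "'a::nonarch_local_field mpair set \<Rightarrow> ('a ^ 2 ^ 2) set \<times> ('a ^ 2 ^ 2) set \<Rightarrow> complex" where
  "ind W y = (if y \<in> pcl ` W then 1 else 0)"

lemma ind_pcl: "clop W \<Longrightarrow> ind W (pcl w) = (if w \<in> W then 1 else 0)"
  by (simp add: ind_def pcl_in_image_iff)

lemma pcl_mem_iff: "y \<in> Pgl2 \<times> Pgl2 \<longleftrightarrow> (\<exists>A B. A \<noteq> 0 \<and> B \<noteq> 0 \<and> y = pcl (A, B))"
  by (cases y) (auto simp: Pgl2_def)

lemma ind_outside: "clop W \<Longrightarrow> y \<notin> Pgl2 \<times> Pgl2 \<Longrightarrow> ind W y = 0"
  unfolding ind_def pcl_mem_iff clop_def by (auto dest: uniform_nonzero)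

lemma ind_schwartz:
  fixes W :: "'a::nonarch_local_field mpair set"
  assumes W: "clop W" shows "ind W \<in> schwartz_space XX"
  unfolding schwartz_space_XX
proof (intro conjI allI impI ballI)
  show "ind W y = 0" if "y \<notin> Pgl2 \<times> Pgl2" for y using that W by (simp add: ind_outside)
  fix y :: "('a ^ 2 ^ 2) set \<times> ('a ^ 2 ^ 2) set" assume "y \<in> Pgl2 \<times> Pgl2"
  then obtain A B where y: "A \<noteq> 0" "B \<noteq> 0" "y = pcl (A, B)" unfolding pcl_mem_iff by blast
  obtain e where e: "0 < e" "e < 1" "uniform e W" using W by (auto simp: clop_def)
  let ?U = "proj_class ` {A'. near e A A'} \<times> proj_class ` {B'. near e B B'}"
  have "ind W z = ind W y" if "z \<in> ?U" for z
  proof -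
    obtain A' B' where z: "z = pcl (A', B')" "near e A A'" "near e B B'" using \<open>z \<in> ?U\<close> by auto
    have "(A', B') \<in> W \<longleftrightarrow> (A, B) \<in> W"
      using uniform_near[OF e(3)] z(2,3) z(2,3)[THEN near_sym[OF _ e(2)]] by blast
    then show ?thesis unfolding z(1) y(3) by (simp only: ind_pcl[OF W])
  qed
  moreover have "openin XX ?U"
    using openin_proj_class_near[OF y(1) e(1,2)] openin_proj_class_near[OF y(2) e(1,2)]
    by (simp add: openin_prod_Times_iff)
  moreover have "y \<in> ?U" using near_refl[of e] e y by auto
  ultimately show "\<exists>U. openin XX U \<and> y \<in> U \<and> (\<forall>z\<in>U. ind W z = ind W y)" by blast
qed

lemma schwartz_outside:
  assumes "f \<in> schwartz_space XX" "y \<notin> Pgl2 \<times> Pgl2" shows "f y = 0"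
  using assms(1)[unfolded schwartz_space_XX] assms(2) by blast

lemma schwartz_locally_constant:
  assumes "f \<in> schwartz_space XX" "y \<in> Pgl2 \<times> Pgl2"
  shows "\<exists>U. openin XX U \<and> y \<in> U \<and> (\<forall>z\<in>U. f z = f y)"
  using assms(1)[unfolded schwartz_space_XX] assms(2) by blast

lemma schwartz_add:
  assumes "f \<in> schwartz_space XX" "g \<in> schwartz_space XX"
  shows "(\<lambda>y. f y + g y) \<in> schwartz_space XX"
  unfolding schwartz_space_XX
proof (intro conjI allI impI ballI)
  show "f y + g y = 0" if "y \<notin> Pgl2 \<times> Pgl2" for y
    using assms[THEN schwartz_outside, OF that] by simp
  fix y assume y: "y \<in> (Pgl2 \<times> Pgl2 :: (('a ^ 2 ^ 2) set \<times> ('a ^ 2 ^ 2) set) set)"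
  obtain U V where U: "openin XX U" "y \<in> U" "\<forall>z\<in>U. f z = f y"
    and V: "openin XX V" "y \<in> V" "\<forall>z\<in>V. g z = g y"
    using assms[THEN schwartz_locally_constant, OF y] by blast
  have "f z + g z = f y + g y" if "z \<in> U \<inter> V" for z
    using bspec[OF U(3), of z] bspec[OF V(3), of z] that by simp
  then show "\<exists>U. openin XX U \<and> y \<in> U \<and> (\<forall>z\<in>U. f z + g z = f y + g y)"
    using openin_Int[OF U(1) V(1)] IntI[OF U(2) V(2)] by blast
qed

lemma schwartz_scale:
  assumes "f \<in> schwartz_space XX" shows "(\<lambda>y. c * f y) \<in> schwartz_space XX"
  unfolding schwartz_space_XX
proof (intro conjI allI impI ballI)
  show "c * f y = 0" if "y \<notin> Pgl2 \<times> Pgl2" for y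
    using assms[THEN schwartz_outside, OF that] by simp
  fix y assume y: "y \<in> (Pgl2 \<times> Pgl2 :: (('a ^ 2 ^ 2) set \<times> ('a ^ 2 ^ 2) set) set)"
  obtain U where U: "openin XX U" "y \<in> U" "\<forall>z\<in>U. f z = f y"
    using assms[THEN schwartz_locally_constant, OF y] by blast
  have "c * f z = c * f y" if "z \<in> U" for z using bspec[OF U(3) that] by simp
  with U(1,2) show "\<exists>U. openin XX U \<and> y \<in> U \<and> (\<forall>z\<in>U. c * f z = c * f y)" by blast
qed

lemma distribution_sum:
  assumes \<xi>: "\<xi> \<in> distributions XX" and "finite I" "\<And>i. i \<in> I \<Longrightarrow> f i \<in> schwartz_space XX"
  shows "(\<lambda>y. \<Sum>i\<in>I. k i * f i y) \<in> schwartz_space XX \<and>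
    \<xi> (\<lambda>y. \<Sum>i\<in>I. k i * f i y) = (\<Sum>i\<in>I. k i * \<xi> (f i))"
  using assms(2,3)
proof (induction I rule: finite_induct)
  case empty
  have z: "ind {} \<in> schwartz_space XX" by (rule ind_schwartz) simp
  have "\<xi> (\<lambda>y. 0 * ind {} y) = 0 * \<xi> (ind {})" using \<xi> z unfolding distributions_def by blast
  then show ?case using schwartz_scale[OF z, of 0] by simp
next
  case (insert i I)
  have 1: "(\<lambda>y. k i * f i y) \<in> schwartz_space XX" using insert.prems by (intro schwartz_scale) simp
  have 2: "\<xi> (\<lambda>y. k i * f i y) = k i * \<xi> (f i)"
    using \<xi> insert.prems[of i] unfolding distributions_def by simp
  have 3: "(\<lambda>y. \<Sum>i\<in>I. k i * f i y) \<in> schwartz_space XX"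
    "\<xi> (\<lambda>y. \<Sum>i\<in>I. k i * f i y) = (\<Sum>i\<in>I. k i * \<xi> (f i))"
    using insert by auto
  have "\<xi> (\<lambda>y. k i * f i y + (\<Sum>i\<in>I. k i * f i y)) = k i * \<xi> (f i) + (\<Sum>i\<in>I. k i * \<xi> (f i))"
    using \<xi> 1 2 3 unfolding distributions_def by simp
  then show ?case using insert.hyps schwartz_add[OF 1 3(1)] by simp
qed

section \<open>Test functions as combinations of indicator functions\<close>

lemma openin_Pgl2_near:
  assumes "openin Pgl2_topology U" "proj_class A \<in> U" "A \<noteq> 0"
  obtains e where "0 < e" "e < 1" "\<And>B. near e A B \<Longrightarrow> proj_class B \<in> U"
proof -
  have "open {A \<in> - {0}. proj_class A \<in> U}"
    using assms(1) by (auto simp: openin_Pgl2_topology intro: openin_open_trans)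
  then obtain d where d: "0 < d" "\<And>B. dist B A < d \<Longrightarrow> proj_class B \<in> U"
    using assms(2,3) unfolding open_dist by blast
  define e where "e = min (1/2) (d / (8 * mnorm A))"
  show ?thesis
  proof
    show "0 < e" "e < 1" using d assms(3) by (simp_all add: e_def)
    fix B assume "near e A B"
    then have "4 * mnorm (B - A) \<le> 4 * (e * mnorm A)" by (simp add: near_def)
    also have "\<dots> \<le> 4 * (d / (8 * mnorm A) * mnorm A)"
      by (intro mult_left_mono mult_right_mono) (simp_all add: e_def)
    also have "\<dots> < d" using d(1) assms(3) by simp
    finally show "proj_class B \<in> U" using d(2)[of B] dist_le_mnorm[of B A] by simp
  qed
qed

text \<open>Lebesgue number argument: since \<open>near\<close> is transitive, the least of finitely
  many radii works at every point, not only at the centres. The values at the centres exhaust the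
  range, which is therefore finite.\<close>

lemma schwartz_uniform:
  fixes f :: "('a::nonarch_local_field ^ 2 ^ 2) set \<times> ('a ^ 2 ^ 2) set \<Rightarrow> complex"
  assumes f: "f \<in> schwartz_space XX"
  obtains e V where "0 < e" "e < 1" "finite V" "f ` (Pgl2 \<times> Pgl2) \<subseteq> V"
    "\<And>A B A' B'. A \<noteq> 0 \<Longrightarrow> B \<noteq> 0 \<Longrightarrow> near e A A' \<Longrightarrow> near e B B' \<Longrightarrow> f (pcl (A', B')) = f (pcl (A, B))"
proof -
  define good where "good p e \<longleftrightarrow> 0 < e \<and> e < 1 \<and>
    (\<forall>A' B'. near e (fst p) A' \<longrightarrow> near e (snd p) B' \<longrightarrow> f (pcl (A', B')) = f (pcl p))" for p e
  have ex: "\<exists>e. good (A, B) e" if nz: "A \<noteq> 0" "B \<noteq> 0" for A B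
  proof -
    have "pcl (A, B) \<in> Pgl2 \<times> Pgl2" using nz unfolding pcl_mem_iff by blast
    from schwartz_locally_constant[OF f this]
    obtain U where U: "openin XX U" "pcl (A, B) \<in> U" "\<forall>z\<in>U. f z = f (pcl (A, B))" by blast
    then obtain U1 U2 where U12: "openin Pgl2_topology U1" "openin Pgl2_topology U2"
      "proj_class A \<in> U1" "proj_class B \<in> U2" "U1 \<times> U2 \<subseteq> U"
      using U(1)[unfolded openin_prod_topology_alt, rule_format, of "proj_class A" "proj_class B"] by auto
    obtain e1 where e1: "0 < e1" "e1 < 1" "\<And>A'. near e1 A A' \<Longrightarrow> proj_class A' \<in> U1"
      using openin_Pgl2_near[OF U12(1,3) nz(1)] by blast
    obtain e2 where e2: "0 < e2" "e2 < 1" "\<And>B'. near e2 B B' \<Longrightarrow> proj_class B' \<in> U2"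
      using openin_Pgl2_near[OF U12(2,4) nz(2)] by blast
    have "f (pcl (A', B')) = f (pcl (A, B))" if "near (min e1 e2) A A'" "near (min e1 e2) B B'" for A' B'
    proof -
      have "proj_class A' \<in> U1" "proj_class B' \<in> U2"
        using e1(3)[OF near_mono[OF that(1)]] e2(3)[OF near_mono[OF that(2)]] by simp_all
      then have "pcl (A', B') \<in> U" using U12(5) by auto
      with U(3) show ?thesis by (rule bspec)
    qed
    then show ?thesis using e1 e2 by (intro exI[of _ "min e1 e2"]) (simp add: good_def)
  qed
  define E where "E p = (SOME e. good p e)" for p
  have E: "good (A, B) (E (A, B))" if "A \<noteq> 0" "B \<noteq> 0" for A B
    unfolding E_def using someI_ex[OF ex[OF that]] .
  have E_pos: "0 < E (A, B)" if "A \<noteq> 0" "B \<noteq> 0" for A B using E[OF that] by (simp add: good_def)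
  obtain T where T: "finite T" "T \<subseteq> (- {0}) \<times> (- {0})"
    "\<forall>A B. A \<noteq> 0 \<longrightarrow> B \<noteq> 0 \<longrightarrow> (\<exists>(A0, B0)\<in>T. \<exists>c d. c \<noteq> 0 \<and> d \<noteq> 0 \<and>
       near (E (A0, B0)) A0 (mat c ** A) \<and> near (E (A0, B0)) B0 (mat d ** B))"
    by (rule finite_near_cover[of E, OF E_pos])
  \<comment> \<open>The value \<open>1/2\<close> makes the set nonempty and keeps \<open>e\<close>
    below 1.\<close>
  define e where "e = Min (insert (1/2) (E ` T))"
  have fin: "finite (insert (1/2) (E ` T))" using T(1) by simp
  have e: "e \<le> 1/2" "\<And>p. p \<in> T \<Longrightarrow> e \<le> E p"
    unfolding e_def by (rule Min_le[OF fin]; simp)+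
  have "0 < E p" if "p \<in> T" for p using E_pos[of "fst p" "snd p"] that T(2) by (cases p) auto
  then have e_pos: "0 < e" unfolding e_def using fin by (subst Min_gr_iff) auto
  have key: "\<exists>p\<in>T. \<forall>A' B'. near e A A' \<longrightarrow> near e B B' \<longrightarrow> f (pcl (A', B')) = f (pcl p)"
    if nz: "A \<noteq> 0" "B \<noteq> 0" for A B
  proof -
    obtain A0 B0 c d where p: "(A0, B0) \<in> T" "c \<noteq> 0" "d \<noteq> 0"
      "near (E (A0, B0)) A0 (mat c ** A)" "near (E (A0, B0)) B0 (mat d ** B)"
      using T(3)[rule_format, OF nz] by auto
    have g: "good (A0, B0) (E (A0, B0))" using E p(1) T(2) by blast
    have "f (pcl (A', B')) = f (pcl (A0, B0))" if n: "near e A A'" "near e B B'" for A' B'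
    proof -
      have "near (E (A0, B0)) (mat c ** A) (mat c ** A')" "near (E (A0, B0)) (mat d ** B) (mat d ** B')"
        using n[THEN near_mono[OF _ e(2)[OF p(1)]], THEN near_scale] .
      then have "near (E (A0, B0)) A0 (mat c ** A')" "near (E (A0, B0)) B0 (mat d ** B')"
        using p(4,5) g near_trans by (auto simp: good_def)
      then have "f (pcl (mat c ** A', mat d ** B')) = f (pcl (A0, B0))"
        using g by (auto simp: good_def)
      then show ?thesis using p by (simp add: proj_class_scale)
    qed
    then show ?thesis using p(1) by blast
  qed
  have near0: "near e A A" for A using e_pos by (simp add: near_refl)
  show ?thesis
  proof
    show "0 < e" "e < 1" "finite ((\<lambda>p. f (pcl p)) ` T)" using e_pos e(1) T(1) by simp_all
    show "f ` (Pgl2 \<times> Pgl2) \<subseteq> (\<lambda>p. f (pcl p)) ` T"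
    proof
      fix v assume "v \<in> f ` (Pgl2 \<times> Pgl2)"
      then obtain y where v: "v = f y" and y: "y \<in> Pgl2 \<times> Pgl2" by (rule imageE)
      obtain A B where AB: "A \<noteq> 0" "B \<noteq> 0" "y = pcl (A, B)" using y unfolding pcl_mem_iff by blast
      obtain p where "p \<in> T" "f (pcl (A, B)) = f (pcl p)"
        using key[OF AB(1,2)] near0[of A] near0[of B] by blast
      then show "v \<in> (\<lambda>p. f (pcl p)) ` T" unfolding v AB(3) by (rule rev_image_eqI)
    qed
    show "f (pcl (A', B')) = f (pcl (A, B))"
      if h: "A \<noteq> 0" "B \<noteq> 0" "near e A A'" "near e B B'" for A B A' B'
    proof -
      obtain p where p: "\<forall>A' B'. near e A A' \<longrightarrow> near e B B' \<longrightarrow> f (pcl (A', B')) = f (pcl p)"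
        using key[OF h(1,2)] by blast
      show ?thesis
        using p[rule_format, OF h(3,4)] p[rule_format, OF near0[of A] near0[of B]] by simp
    qed
  qed
qed

lemma schwartz_as_sum:
  fixes f :: "('a::nonarch_local_field ^ 2 ^ 2) set \<times> ('a ^ 2 ^ 2) set \<Rightarrow> complex"
  assumes f: "f \<in> schwartz_space XX"
  obtains V W where "finite V" "\<And>v. v \<in> V \<Longrightarrow> clop (W v)" "f = (\<lambda>y. \<Sum>v\<in>V. v * ind (W v) y)"
proof -
  obtain e V where e: "0 < e" "e < 1" and V: "finite V" "f ` (Pgl2 \<times> Pgl2) \<subseteq> V"
    and near: "\<And>A B A' B'. A \<noteq> 0 \<Longrightarrow> B \<noteq> 0 \<Longrightarrow> near e A A' \<Longrightarrow> near e B B' \<Longrightarrow>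
      f (pcl (A', B')) = f (pcl (A, B))"
    using schwartz_uniform[OF f] by blast
  define W where "W v = {(A, B). A \<noteq> 0 \<and> B \<noteq> 0 \<and> f (pcl (A, B)) = v}" for v
  have W: "clop (W v)" for v
  proof -
    have "uniform e (W v)"
    proof (rule uniformI)
      fix A B assume AB: "(A, B) \<in> W v"
      then show "A \<noteq> 0 \<and> B \<noteq> 0" by (simp add: W_def)
      show "(mat c ** A, mat d ** B) \<in> W v" if "c \<noteq> 0" "d \<noteq> 0" for c d
        using AB that by (simp add: W_def proj_class_scale mat_mult_eq_0_iff)
      show "(A', B') \<in> W v" if "near e A A'" "near e B B'" for A' B'
        using AB near[OF _ _ that] that[THEN near_nonzero[OF _ e(2)]] by (simp add: W_def)
    qed
    with e show ?thesis by (auto simp: clop_def)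
  qed
  have "f y = (\<Sum>v\<in>V. v * ind (W v) y)" for y
  proof (cases "y \<in> Pgl2 \<times> Pgl2")
    case True
    then obtain A B where y: "A \<noteq> 0" "B \<noteq> 0" "y = pcl (A, B)" unfolding pcl_mem_iff by blast
    have "(\<Sum>v\<in>V. v * ind (W v) y) = (\<Sum>v\<in>V. if v = f y then v else 0)"
      unfolding y(3) ind_pcl[OF W] using y by (intro sum.cong refl) (auto simp: W_def)
    also have "\<dots> = f y" using V(1) subsetD[OF V(2) imageI[OF True]] by simp
    finally show ?thesis by simp
  next
    case False
    then show ?thesis using schwartz_outside[OF f] W by (simp add: ind_outside)
  qed
  with V(1) W show ?thesis by (intro that) auto
qed

section \<open>Translation between distributions and measures\<close>

lemma pullback_swap_ind:
  assumes "clop W" shows "pullback_fun XX prod.swap (ind W) = ind (prod.swap -` W)"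
proof
  fix y
  show "pullback_fun XX prod.swap (ind W) y = ind (prod.swap -` W) y"
  proof (cases "y \<in> Pgl2 \<times> Pgl2")
    case True
    then obtain A B where y: "y = pcl (A, B)" unfolding pcl_mem_iff by blast
    have "ind W (pcl (B, A)) = ind (prod.swap -` W) (pcl (A, B))"
      unfolding ind_pcl[OF assms] ind_pcl[OF clop_swap[OF assms]] by simp
    with True show ?thesis by (simp add: pullback_fun_def y)
  qed (simp add: pullback_fun_def ind_outside[OF clop_swap[OF assms]])
qed

text \<open>The second group element is the class of \<open>matrix_inv h\<close>, as the action
  inverts it once more.\<close>

lemma pullback_diag_act_ind:
  assumes "clop W" "invertible g" "invertible h"
  shows "pullback_fun XX (diag_act (proj_class g, proj_class (matrix_inv h))) (ind W) = ind (lract g h -` W)"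
proof
  fix y
  have hh: "matrix_inv (matrix_inv h) = h"
    using matrix_inv_mult[OF assms(3)] matrix_inv_mult[OF invertible_matrix_inv[OF assms(3)]]
    by (metis matrix_mul_assoc matrix_mul_lid matrix_mul_rid)
  note cl = clop_lract[OF assms]
  show "pullback_fun XX (diag_act (proj_class g, proj_class (matrix_inv h))) (ind W) y = ind (lract g h -` W) y"
  proof (cases "y \<in> Pgl2 \<times> Pgl2")
    case True
    then obtain A B where y: "y = pcl (A, B)" unfolding pcl_mem_iff by blast
    have "diag_act (proj_class g, proj_class (matrix_inv h)) y = pcl (g ** A ** h, g ** B ** h)"
      by (simp add: y diag_act_def pgl_act_proj_class[OF invertible_matrix_inv[OF assms(3)]] hh)
    moreover have "ind W (pcl (g ** A ** h, g ** B ** h)) = ind (lract g h -` W) (pcl (A, B))"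
      unfolding ind_pcl[OF assms(1)] ind_pcl[OF cl] by simp
    ultimately show ?thesis using True by (simp add: pullback_fun_def y)
  qed (simp add: pullback_fun_def ind_outside[OF cl])
qed

lemma invariant_measure_ind:
  fixes \<xi> :: "(('a::nonarch_local_field ^ 2 ^ 2) set \<times> ('a ^ 2 ^ 2) set \<Rightarrow> complex) \<Rightarrow> complex"
  assumes "\<xi> \<in> invariant_distributions XX (diag_act ` carrier (PGL2 \<times>\<times> PGL2))"
  shows "invariant_measure (\<lambda>W. \<xi> (ind W))"
proof
  have \<xi>: "\<xi> \<in> distributions XX"
    and inv: "\<And>\<phi>. \<phi> \<in> diag_act ` carrier (PGL2 \<times>\<times> PGL2) \<Longrightarrow> push_distribution XX \<phi> \<xi> = \<xi>"
    using assms by (auto simp: invariant_distributions_def)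
  fix U V :: "'a mpair set" assume U: "clop U"
  show "\<xi> (ind (U \<union> V)) = \<xi> (ind U) + \<xi> (ind V)" if V: "clop V" and UV: "U \<inter> V = {}"
  proof -
    have "ind (U \<union> V) y = ind U y + ind V y" for y
    proof (cases "y \<in> Pgl2 \<times> Pgl2")
      case True
      then obtain A B where y: "y = pcl (A, B)" unfolding pcl_mem_iff by blast
      show ?thesis
        unfolding y ind_pcl[OF U] ind_pcl[OF V] ind_pcl[OF clop_Un[OF U V]] using UV by auto
    qed (simp add: ind_outside U V clop_Un)
    then have "ind (U \<union> V) = (\<lambda>y. ind U y + ind V y)" by auto
    moreover have "\<xi> (\<lambda>y. ind U y + ind V y) = \<xi> (ind U) + \<xi> (ind V)"
      using \<xi> ind_schwartz[OF U] ind_schwartz[OF V] unfolding distributions_def by blast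
    ultimately show ?thesis by simp
  qed
  fix g h :: "'a ^ 2 ^ 2" assume gh: "invertible g" "invertible h"
  have "(proj_class g, proj_class (matrix_inv h)) \<in> carrier (PGL2 \<times>\<times> PGL2)"
    using gh invertible_matrix_inv by (auto simp: DirProd_def carrier_PGL2)
  then have "push_distribution XX (diag_act (proj_class g, proj_class (matrix_inv h))) \<xi> (ind U) = \<xi> (ind U)"
    by (simp add: inv)
  then show "\<xi> (ind (lract g h -` U)) = \<xi> (ind U)"
    by (simp add: push_distribution_def ind_schwartz[OF U] pullback_diag_act_ind[OF U gh])
qed

theorem theoremC:
  "invariant_distributions
     (prod_topology Pgl2_topology
       (Pgl2_topology :: ('a::nonarch_local_field ^ 2 ^ 2) set topology))
     (diag_act ` carrier (PGL2 \<times>\<times> PGL2))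
   \<subseteq> invariant_distributions (prod_topology Pgl2_topology Pgl2_topology) {prod.swap}"
proof
  fix \<xi> :: "(('a ^ 2 ^ 2) set \<times> ('a ^ 2 ^ 2) set \<Rightarrow> complex) \<Rightarrow> complex"
  assume inv: "\<xi> \<in> invariant_distributions XX (diag_act ` carrier (PGL2 \<times>\<times> PGL2))"
  then have \<xi>: "\<xi> \<in> distributions XX" by (simp add: invariant_distributions_def)
  interpret invariant_measure "\<lambda>W. \<xi> (ind W)" by (rule invariant_measure_ind[OF inv])
  have "\<xi> (pullback_fun XX prod.swap f) = \<xi> f" if f: "f \<in> schwartz_space XX" for f
  proof -
    obtain V W where V: "finite V" "\<And>v. v \<in> V \<Longrightarrow> clop (W v)" "f = (\<lambda>y. \<Sum>v\<in>V. v * ind (W v) y)"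
      using schwartz_as_sum[OF f] by blast
    have "pullback_fun XX prod.swap f = (\<lambda>y. \<Sum>v\<in>V. v * pullback_fun XX prod.swap (ind (W v)) y)"
      by (rule ext) (simp add: V(3) pullback_fun_def)
    also have "\<dots> = (\<lambda>y. \<Sum>v\<in>V. v * ind (prod.swap -` W v) y)"
      using V(2) by (simp add: pullback_swap_ind)
    finally have "\<xi> (pullback_fun XX prod.swap f) = (\<Sum>v\<in>V. v * \<xi> (ind (prod.swap -` W v)))"
      using distribution_sum[OF \<xi> V(1), of "\<lambda>v. ind (prod.swap -` W v)" "\<lambda>v. v"] V(2)
      by (simp add: ind_schwartz clop_swap)
    also have "\<dots> = (\<Sum>v\<in>V. v * \<xi> (ind (W v)))" using V(2) by (simp add: m_swap)
    also have "\<dots> = \<xi> f"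
      using distribution_sum[OF \<xi> V(1), of "\<lambda>v. ind (W v)" "\<lambda>v. v"] V(2,3)
      by (simp add: ind_schwartz)
    finally show ?thesis .
  qed
  moreover have "\<xi> \<in> extensional (schwartz_space XX)" using \<xi> by (simp add: distributions_def)
  ultimately have "push_distribution XX prod.swap \<xi> = \<xi>"
    by (auto simp: push_distribution_def fun_eq_iff extensional_def restrict_def)
  with \<xi> show "\<xi> \<in> invariant_distributions XX {prod.swap}"
    by (simp add: invariant_distributions_def)
qed

end
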